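(* Let $r_1,r_2>0$ with $r_1+r_2\le 2$, and let $\pi_1:M^{14}=Sp(2)\times S^4\to\widetilde N^{11}$ be the Riemannian submersion defined in the context. Let $f:M^{14}\to\mathbb{R}$, $f(Q,(t_1,t_2))=t_1$. The function $\widetilde F:\widetilde N^{11}\to\mathbb{R}$ defined by $\widetilde F\circ\pi_1=f$ is an isoparametric function on $\widetilde N^{11}$ which satisfies $$|\nabla^{\widetilde N}\widetilde F|^2=1-\widetilde F^2,\qquad \Delta^{\widetilde N}\widetilde F=-\left(1+\frac{3}{1+\frac{2}{r_1}(1-\widetilde F^2)}\right)\widetilde F.$$ The corresponding isoparametric foliation is exactly the foliation of $\widetilde N^{11}$ by the orbits of the action $\Psi$ of $Sp(2)$ given by $\Psi(P,[(Q,(t_1,t_2))])=[(PQ,(t_1,t_2))]$, i.e. the isoparametric hypersurfaces (regular level sets of $\widetilde F$) are the principal orbits $Sp(2)_\theta=\{[(Q,(\cos\theta,\sin\theta))]:Q\in Sp(2)\}$, $\theta\in(0,\pi)$, and the focal submanifolds (singular level sets) are the singular orbits of $\Psi$.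
   Context: $\mathbb{H}$ denotes the quaternions, identified with $\mathbb{R}^4$. $Sp(2)=\{Q\in M(2,\mathbb{H}): QQ^*=I\}$ and $S^3=Sp(1)$ is the group of unit quaternions. For $r_1,r_2>0$, $g_r$ is the left invariant metric on $Sp(2)$ with $$\Big|Q\begin{pmatrix} x& y\\ -\overline{y}& z\end{pmatrix}\Big|^2_{g_r}=\frac{r_1}{2}|x|^2+|y|^2+\frac{r_2}{2}|z|^2,\qquad x,y,z\in\mathbb{H},\ \mathrm{Re}(x)=\mathrm{Re}(z)=0.$$ Let $S^4\subset\mathbb{R}\oplus\mathbb{H}=\mathbb{R}^5$ be the unit sphere with its standard metric, with points written $(t_1,t_2)$, $t_1\in\mathbb{R}$, $t_2\in\mathbb{H}$. Let $M^{14}=Sp(2)\times S^4$ carry the product of $g_r$ and the standard metric. $S^3$ acts freely and isometrically on $M^{14}$ by $$p\cdot (Q,(t_1,t_2))=\Big(Q\begin{pmatrix}\overline p&0\\0&1\end{pmatrix},(t_1,pt_2)\Big).$$ $\widetilde N^{11}$ is the quotient of $M^{14}$ by this action, with the metric making $\pi_1:M^{14}\to\widetilde N^{11}$, $(Q,(t_1,t_2))\mapsto[(Q,(t_1,t_2))]$, a Riemannian submersion. $\nabla^{\widetilde N}$ and $\Delta^{\widetilde N}$ (the divergence of the gradient) denote the gradient and Laplacian on $\widetilde N^{11}$. A function $F:N\to\mathbb{R}$ on a Riemannian manifold is transnormal if $|\nabla F|^2=b(F)$ for some smooth function $b$ on $\mathbb{R}$, and isoparametric if in addition $\Delta F=a(F)$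 for some continuous function $a$ on $\mathbb{R}$. An isoparametric hypersurface is a regular level set of an isoparametric function; the singular level sets are called the focal submanifolds. *)

theory Defs
  imports "HOL-Analysis.Analysis"
begin

section \<open>Smooth maps and embedded submanifolds of Euclidean spaces\<close>

text \<open>Meaningful for open \<open>W\<close>: \<open>C\<^sup>k\<close> via iterated directional derivatives.\<close>

primrec Ck_on :: "nat \<Rightarrow> ('a::euclidean_space \<Rightarrow> 'b::real_normed_vector) \<Rightarrow> 'a set \<Rightarrow> bool" where
  "Ck_on 0 g W \<longleftrightarrow> continuous_on W g"
| "Ck_on (Suc k) g W \<longleftrightarrow>
     g differentiable_on W \<and> (\<forall>v. Ck_on k (\<lambda>x. frechet_derivative g (at x) v) W)"

text \<open>Smoothness on an arbitrary subset \<open>A\<close> of a Euclidean space: locally the restriction of a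
  \<open>C\<^sup>\<infinity>\<close> map defined on an open set. For an embedded submanifold this is
  smoothness in the sense of manifolds, and for open \<open>A\<close> it is the ordinary notion.\<close>

definition smooth_on :: "'a::euclidean_space set \<Rightarrow> ('a \<Rightarrow> 'b::real_normed_vector) \<Rightarrow> bool" where
  "smooth_on A f \<longleftrightarrow>
     (\<forall>a\<in>A. \<exists>W g. open W \<and> a \<in> W \<and> (\<forall>k. Ck_on k g W) \<and> (\<forall>x\<in>A \<inter> W. g x = f x))"

text \<open>Velocities of curves in \<open>A\<close>; the usual tangent space if \<open>A\<close> is an embedded submanifold.\<close>

definition tangent_space :: "'a::euclidean_space set \<Rightarrow> 'a \<Rightarrow> 'a set" where
  "tangent_space A a =
     {v. \<exists>\<gamma>. (\<forall>t. \<gamma> t \<in> A) \<and> \<gamma> 0 = a \<and> (\<gamma> has_vector_derivative v) (at (0::real))}"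


section \<open>Riemannian manifolds given by charts\<close>

text \<open>A chart is a pair \<open>(U, \<phi>)\<close>; values of \<open>\<phi>\<close> outside \<open>U\<close> are irrelevant. The field
  \<open>gram\<close> gives the coordinate matrix \<open>(g\<^sub>i\<^sub>j)\<close> of the metric in a chart, as a function
  of the coordinates.\<close>

type_synonym ('a, 'n) chart = "'a set \<times> ('a \<Rightarrow> real^'n)"

record ('a, 'n) riemannian =
  points :: "'a set"
  charts :: "('a, 'n) chart set"
  gram :: "('a, 'n) chart \<Rightarrow> real^'n \<Rightarrow> real^'n^'n"

definition coord_rep :: "('a, 'n::finite) chart \<Rightarrow> ('a \<Rightarrow> 'b) \<Rightarrow> real^'n \<Rightarrow> 'b" where
  "coord_rep c F = F \<circ> inv_into (fst c) (snd c)"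

definition partial :: "'n::finite \<Rightarrow> (real^'n \<Rightarrow> real) \<Rightarrow> real^'n \<Rightarrow> real" where
  "partial i h u = frechet_derivative h (at u) (axis i 1)"

definition chart_grad ::
    "('a, 'n::finite) riemannian \<Rightarrow> ('a, 'n) chart \<Rightarrow> ('a \<Rightarrow> real) \<Rightarrow> real^'n \<Rightarrow> real^'n" where
  "chart_grad N c F u = matrix_inv (gram N c u) *v (\<chi> i. partial i (coord_rep c F) u)"

definition chart_div ::
    "('a, 'n::finite) riemannian \<Rightarrow> ('a, 'n) chart \<Rightarrow> (real^'n \<Rightarrow> real^'n) \<Rightarrow> real^'n \<Rightarrow> real" where
  "chart_div N c X u =
     (\<Sum>i\<in>UNIV. partial i (\<lambda>w. sqrt (det (gram N c w)) * X w $ i) u) / sqrt (det (gram N c u))"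

text \<open>The value common to all charts around \<open>p\<close>.\<close>

definition grad_norm_sq :: "('a, 'n::finite) riemannian \<Rightarrow> ('a \<Rightarrow> real) \<Rightarrow> 'a \<Rightarrow> real" where
  "grad_norm_sq N F p = (THE s. \<forall>c\<in>charts N. p \<in> fst c \<longrightarrow>
     (let u = snd c p; X = chart_grad N c F u in X \<bullet> (gram N c u *v X)) = s)"

definition laplacian :: "('a, 'n::finite) riemannian \<Rightarrow> ('a \<Rightarrow> real) \<Rightarrow> 'a \<Rightarrow> real" where
  "laplacian N F p = (THE s. \<forall>c\<in>charts N. p \<in> fst c \<longrightarrow>
     chart_div N c (chart_grad N c F) (snd c p) = s)"

definition smooth_fun :: "('a, 'n::finite) riemannian \<Rightarrow> ('a \<Rightarrow> real) \<Rightarrow> bool" where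
  "smooth_fun N F \<longleftrightarrow> (\<forall>c\<in>charts N. smooth_on (snd c ` fst c) (coord_rep c F))"

definition transnormal :: "('a, 'n::finite) riemannian \<Rightarrow> ('a \<Rightarrow> real) \<Rightarrow> bool" where
  "transnormal N F \<longleftrightarrow> smooth_fun N F \<and>
     (\<exists>b::real \<Rightarrow> real. smooth_on UNIV b \<and> (\<forall>p\<in>points N. grad_norm_sq N F p = b (F p)))"

definition isoparametric :: "('a, 'n::finite) riemannian \<Rightarrow> ('a \<Rightarrow> real) \<Rightarrow> bool" where
  "isoparametric N F \<longleftrightarrow> transnormal N F \<and>
     (\<exists>a::real \<Rightarrow> real. continuous_on UNIV a \<and> (\<forall>p\<in>points N. laplacian N F p = a (F p)))"

definition critical_point :: "('a, 'n::finite) riemannian \<Rightarrow> ('a \<Rightarrow> real) \<Rightarrow> 'a \<Rightarrow> bool" where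
  "critical_point N F p \<longleftrightarrow> p \<in> points N \<and>
     (\<forall>c\<in>charts N. p \<in> fst c \<longrightarrow> (coord_rep c F has_derivative (\<lambda>_. 0)) (at (snd c p)))"

definition level_set :: "('a, 'n::finite) riemannian \<Rightarrow> ('a \<Rightarrow> real) \<Rightarrow> real \<Rightarrow> 'a set" where
  "level_set N F s = {p \<in> points N. F p = s}"

definition level_sets :: "('a, 'n::finite) riemannian \<Rightarrow> ('a \<Rightarrow> real) \<Rightarrow> 'a set set" where
  "level_sets N F = {level_set N F s |s. level_set N F s \<noteq> {}}"

definition regular_level_sets :: "('a, 'n::finite) riemannian \<Rightarrow> ('a \<Rightarrow> real) \<Rightarrow> 'a set set" where
  "regular_level_sets N F = {L \<in> level_sets N F. \<forall>p\<in>L. \<not> critical_point N F p}"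

definition singular_level_sets :: "('a, 'n::finite) riemannian \<Rightarrow> ('a \<Rightarrow> real) \<Rightarrow> 'a set set" where
  "singular_level_sets N F = {L \<in> level_sets N F. \<exists>p\<in>L. critical_point N F p}"


section \<open>Quotients by Riemannian submersion\<close>

text \<open>Here \<open>M\<close> is an embedded submanifold of a Euclidean space, \<open>g\<close> a Riemannian metric on it
  (\<open>g m\<close> is used on \<open>tangent_space M m\<close> only) and \<open>R\<close> an equivalence relation on \<open>M\<close> whose
  classes are the fibres of the submersion. A point of the quotient is a class, that is, it
  is itself the fibre.\<close>

definition proj :: "('a \<times> 'a) set \<Rightarrow> 'a \<Rightarrow> 'a set" where
  "proj R m = R `` {m}"

definition horizontal ::
    "'a::euclidean_space set \<Rightarrow> ('a \<times> 'a) set \<Rightarrow> ('a \<Rightarrow> 'a \<Rightarrow> 'a \<Rightarrow> real) \<Rightarrow> 'a \<Rightarrow> 'a set" where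
  "horizontal M R g m =
     {V \<in> tangent_space M m. \<forall>W\<in>tangent_space (proj R m) m. g m V W = 0}"

text \<open>Differential at \<open>m\<close> of the projection read in a chart. A derivative within \<open>M\<close> is
  determined on \<open>tangent_space M m\<close> only, and is only applied to such vectors.\<close>

definition dproj ::
    "'a::euclidean_space set \<Rightarrow> ('a \<times> 'a) set \<Rightarrow> ('a set, 'n::finite) chart \<Rightarrow> 'a \<Rightarrow> 'a \<Rightarrow> real^'n" where
  "dproj M R c m = frechet_derivative (snd c \<circ> proj R) (at m within M)"

text \<open>The maximal atlas of the smooth structure on \<open>M // R\<close>, with the quotient topology, for
  which the projection is a smooth submersion.\<close>

definition quotient_charts ::
    "'a::euclidean_space set \<Rightarrow> ('a \<times> 'a) set \<Rightarrow> ('a set, 'n::finite) chart set" where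
  "quotient_charts M R = {c. case c of (U, \<phi>) \<Rightarrow>
     let D = {m \<in> M. proj R m \<in> U} in
       U \<subseteq> M // R \<and> openin (top_of_set M) D \<and> inj_on \<phi> U \<and> open (\<phi> ` U) \<and>
       smooth_on D (\<phi> \<circ> proj R) \<and> (\<forall>m\<in>D. dproj M R c m ` tangent_space M m = UNIV)}"

text \<open>The metric for which the projection is a Riemannian submersion: at every point of the
  fibre, its differential is isometric on horizontal vectors.\<close>

definition quotient_gram ::
    "'a::euclidean_space set \<Rightarrow> ('a \<times> 'a) set \<Rightarrow> ('a \<Rightarrow> 'a \<Rightarrow> 'a \<Rightarrow> real) \<Rightarrow>
     ('a set, 'n::finite) chart \<Rightarrow> real^'n \<Rightarrow> real^'n^'n" where
  "quotient_gram M R g c u = (THE B.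
     \<forall>m\<in>M. proj R m \<in> fst c \<and> snd c (proj R m) = u \<longrightarrow>
       (\<forall>V\<in>horizontal M R g m. \<forall>W\<in>horizontal M R g m.
          dproj M R c m V \<bullet> (B *v dproj M R c m W) = g m V W))"

definition riemannian_quotient ::
    "'a::euclidean_space set \<Rightarrow> ('a \<times> 'a) set \<Rightarrow> ('a \<Rightarrow> 'a \<Rightarrow> 'a \<Rightarrow> real) \<Rightarrow>
     ('a set, 'n::finite) riemannian" where
  "riemannian_quotient M R g =
     \<lparr>points = M // R, charts = quotient_charts M R, gram = quotient_gram M R g\<rparr>"


section \<open>Quaternions and Sp(2)\<close>

text \<open>A quaternion is the pair of its real and imaginary parts; the norm of this product type
  is the Euclidean norm of \<open>\<real>\<^sup>4\<close>.\<close>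

type_synonym quat = "real \<times> (real^3)"
type_synonym qmat = "quat^2^2"

definition qmul :: "quat \<Rightarrow> quat \<Rightarrow> quat" (infixl "*\<^sub>H" 70) where
  "p *\<^sub>H q = (fst p * fst q - snd p \<bullet> snd q,
             fst p *\<^sub>R snd q + fst q *\<^sub>R snd p + cross3 (snd p) (snd q))"

definition qcnj :: "quat \<Rightarrow> quat" where
  "qcnj q = (fst q, - snd q)"

definition qreal :: "real \<Rightarrow> quat" where
  "qreal a = (a, 0)"

definition qmat_mul :: "qmat \<Rightarrow> qmat \<Rightarrow> qmat" (infixl "**\<^sub>H" 70) where
  "A **\<^sub>H B = (\<chi> i j. \<Sum>k\<in>UNIV. A $ i $ k *\<^sub>H B $ k $ j)"

definition qadj :: "qmat \<Rightarrow> qmat" where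
  "qadj A = (\<chi> i j. qcnj (A $ j $ i))"

definition qdiag :: "quat \<Rightarrow> quat \<Rightarrow> qmat" where
  "qdiag a b = (\<chi> i j. if i = j then (if i = 1 then a else b) else 0)"

definition qid :: qmat where
  "qid = qdiag (qreal 1) (qreal 1)"

definition Sp2 :: "qmat set" where
  "Sp2 = {Q. Q **\<^sub>H qadj Q = qid}"

definition Sp1 :: "quat set" where
  "Sp1 = sphere 0 1"


section \<open>The manifolds and the two actions\<close>

definition S4 :: "(real \<times> quat) set" where
  "S4 = sphere 0 1"

type_synonym m14 = "qmat \<times> (real \<times> quat)"

definition M14 :: "m14 set" where
  "M14 = Sp2 \<times> S4"

text \<open>Polarization of the quadratic form defining \<open>g\<^sub>r\<close>; the relevant entries of
  \<open>X = Q\<^sup>* V\<close> are \<open>x\<close>, \<open>y\<close>, \<open>z\<close>.\<close>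

definition Sp2_metric :: "real \<Rightarrow> real \<Rightarrow> qmat \<Rightarrow> qmat \<Rightarrow> qmat \<Rightarrow> real" where
  "Sp2_metric r1 r2 Q V W = (let X = qadj Q **\<^sub>H V; Y = qadj Q **\<^sub>H W in
     r1 / 2 * (X $ 1 $ 1 \<bullet> Y $ 1 $ 1) + X $ 1 $ 2 \<bullet> Y $ 1 $ 2 + r2 / 2 * (X $ 2 $ 2 \<bullet> Y $ 2 $ 2))"

definition M14_metric :: "real \<Rightarrow> real \<Rightarrow> m14 \<Rightarrow> m14 \<Rightarrow> m14 \<Rightarrow> real" where
  "M14_metric r1 r2 m V W = Sp2_metric r1 r2 (fst m) (fst V) (fst W) + snd V \<bullet> snd W"

fun s3_act :: "quat \<Rightarrow> m14 \<Rightarrow> m14" where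
  "s3_act p (Q, (t1, t2)) = (Q **\<^sub>H qdiag (qcnj p) (qreal 1), (t1, p *\<^sub>H t2))"

definition s3_rel :: "(m14 \<times> m14) set" where
  "s3_rel = {(m, s3_act p m) |m p. m \<in> M14 \<and> p \<in> Sp1}"

definition pi1 :: "m14 \<Rightarrow> m14 set" where
  "pi1 = proj s3_rel"

definition N11 :: "real \<Rightarrow> real \<Rightarrow> (m14 set, 11) riemannian" where
  "N11 r1 r2 = riemannian_quotient M14 s3_rel (M14_metric r1 r2)"

fun f14 :: "m14 \<Rightarrow> real" where
  "f14 (Q, (t1, t2)) = t1"

text \<open>The action of \<open>Sp(2)\<close> on the quotient, classes being sets of points of \<open>M14\<close>; see
  \<open>Psi_pi1\<close> below.\<close>

definition Psi :: "qmat \<Rightarrow> m14 set \<Rightarrow> m14 set" where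
  "Psi P p = (\<lambda>(Q, t). (P **\<^sub>H Q, t)) ` p"

definition Sp2_theta :: "real \<Rightarrow> m14 set set" where
  "Sp2_theta \<theta> = {pi1 (Q, (cos \<theta>, qreal (sin \<theta>))) |Q. Q \<in> Sp2}"


section \<open>Orbits of \<open>\<Psi>\<close>\<close>

definition orbit :: "m14 set \<Rightarrow> m14 set set" where
  "orbit p = {Psi P p |P. P \<in> Sp2}"

definition isotropy :: "m14 set \<Rightarrow> qmat set" where
  "isotropy p = {P \<in> Sp2. Psi P p = p}"

text \<open>Dimension of the homogeneous space \<open>Sp(2) / isotropy p\<close>.\<close>

definition orbit_dim :: "m14 set \<Rightarrow> nat" where
  "orbit_dim p = dim (tangent_space Sp2 qid) - dim (tangent_space (isotropy p) qid)"

text \<open>Orbits of maximal type: the isotropy group is conjugate to a subgroup of every isotropy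
  group.\<close>

definition principal_orbits :: "m14 set set set" where
  "principal_orbits = {orbit p |p. p \<in> M14 // s3_rel \<and>
     (\<forall>q\<in>M14 // s3_rel. \<exists>P\<in>Sp2. (\<lambda>S. P **\<^sub>H S **\<^sub>H qadj P) ` isotropy p \<subseteq> isotropy q)}"

text \<open>Orbits of smaller dimension than the principal ones.\<close>

definition singular_orbits :: "m14 set set set" where
  "singular_orbits = {orbit p |p. p \<in> M14 // s3_rel \<and>
     (\<exists>q\<in>M14 // s3_rel. orbit q \<in> principal_orbits \<and> orbit_dim p < orbit_dim q)}"


section \<open>Well-definedness\<close>

lemma qmul_assoc: "(p *\<^sub>H q) *\<^sub>H r = p *\<^sub>H (q *\<^sub>H r)"
  by (simp add: qmul_def prod_eq_iff cross3_def vec_eq_iff forall_3 inner_vec_def sum_3 algebra_simps)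

lemma norm_qmul: "norm (p *\<^sub>H q) = norm p * norm q"
proof -
  have "(norm (p *\<^sub>H q))\<^sup>2 = (norm p * norm q)\<^sup>2"
    unfolding power_mult_distrib power2_norm_eq_inner
    by (simp add: qmul_def inner_prod_def cross3_def inner_vec_def sum_3) algebra
  then show ?thesis by simp
qed

lemma qmul_distrib: "(p + q) *\<^sub>H r = p *\<^sub>H r + q *\<^sub>H r" "r *\<^sub>H (p + q) = r *\<^sub>H p + r *\<^sub>H q"
  by (simp_all add: qmul_def prod_eq_iff cross3_def vec_eq_iff forall_3 inner_vec_def sum_3 algebra_simps)

lemma qmul_simps [simp]:
  "qreal 1 *\<^sub>H p = p" "p *\<^sub>H qreal 1 = p" "0 *\<^sub>H p = 0" "p *\<^sub>H 0 = 0"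
  by (simp_all add: qmul_def qreal_def cross3_def prod_eq_iff vec_eq_iff forall_3)

lemma qcnj_simps [simp]:
  "qcnj (qcnj p) = p" "qcnj (qreal a) = qreal a" "qcnj 0 = 0" "qcnj (p + q) = qcnj p + qcnj q"
  "norm (qcnj p) = norm p"
  by (simp_all add: qcnj_def qreal_def prod_eq_iff norm_prod_def)

lemma norm_qreal [simp]: "norm (qreal a) = \<bar>a\<bar>"
  by (simp add: qreal_def norm_prod_def)

lemma qcnj_qmul: "qcnj (p *\<^sub>H q) = qcnj q *\<^sub>H qcnj p"
  by (simp add: qmul_def qcnj_def cross3_def vec_eq_iff forall_3 inner_vec_def sum_3 algebra_simps)

lemma qmul_qcnj: "p *\<^sub>H qcnj p = qreal ((norm p)\<^sup>2)"
  unfolding power2_norm_eq_inner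
  by (simp add: qmul_def qcnj_def qreal_def inner_prod_def cross3_def vec_eq_iff forall_3 inner_vec_def sum_3)

lemma qmat_mul_assoc: "(A **\<^sub>H B) **\<^sub>H C = A **\<^sub>H (B **\<^sub>H C)"
  by (simp add: qmat_mul_def vec_eq_iff sum_2 qmul_distrib qmul_assoc algebra_simps)

lemma qmat_mul_qid [simp]: "qid **\<^sub>H A = A" "A **\<^sub>H qid = A"
  by (simp_all add: qmat_mul_def qid_def qdiag_def vec_eq_iff forall_2 sum_2)

lemma qadj_mul: "qadj (A **\<^sub>H B) = qadj B **\<^sub>H qadj A"
  by (simp add: qmat_mul_def qadj_def vec_eq_iff sum_2 qcnj_qmul)

lemma qdiag_mul: "qdiag a b **\<^sub>H qdiag c d = qdiag (a *\<^sub>H c) (b *\<^sub>H d)"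
  by (simp add: qmat_mul_def qdiag_def vec_eq_iff forall_2 sum_2)

lemma qadj_qdiag: "qadj (qdiag a b) = qdiag (qcnj a) (qcnj b)"
  by (simp add: qadj_def qdiag_def vec_eq_iff forall_2)

lemma Sp2_mul: "P \<in> Sp2 \<Longrightarrow> Q \<in> Sp2 \<Longrightarrow> P **\<^sub>H Q \<in> Sp2"
  by (simp add: Sp2_def qadj_mul) (metis qmat_mul_assoc qmat_mul_qid(2))

lemma Sp2_qdiag: "p \<in> Sp1 \<Longrightarrow> qdiag (qcnj p) (qreal 1) \<in> Sp2"
  using qmul_qcnj[of "qcnj p"] by (simp add: Sp2_def Sp1_def qadj_qdiag qdiag_mul qid_def)

lemma s3_act_M14:
  assumes "p \<in> Sp1" "m \<in> M14"
  shows "s3_act p m \<in> M14"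
proof -
  obtain Q t1 t2 where m: "m = (Q, (t1, t2))" by (metis prod.exhaust)
  have "norm (t1, p *\<^sub>H t2) = norm (t1, t2)"
    using assms(1) by (simp add: norm_Pair norm_qmul Sp1_def)
  then show ?thesis
    using assms by (simp add: m M14_def S4_def Sp2_mul Sp2_qdiag)
qed

lemma s3_act_one: "s3_act (qreal 1) m = m"
  by (cases m) (simp flip: qid_def)

lemma s3_act_mul: "s3_act p (s3_act q m) = s3_act (p *\<^sub>H q) m"
  by (cases m) (simp add: qmul_assoc qmat_mul_assoc qdiag_mul qcnj_qmul)

lemma equiv_s3_rel: "equiv M14 s3_rel"
proof (rule equivI)
  show "s3_rel \<subseteq> M14 \<times> M14"
    unfolding s3_rel_def using s3_act_M14 by blast
  show "refl_on M14 s3_rel"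
  proof (rule refl_onI)
    fix m assume "m \<in> M14"
    moreover have "qreal 1 \<in> Sp1" by (simp add: Sp1_def)
    ultimately show "(m, m) \<in> s3_rel"
      unfolding s3_rel_def by (metis (mono_tags, lifting) mem_Collect_eq s3_act_one)
  qed
  show "sym s3_rel"
  proof (rule symI)
    fix m m' assume "(m, m') \<in> s3_rel"
    then obtain p where m: "m \<in> M14" "p \<in> Sp1" "m' = s3_act p m"
      unfolding s3_rel_def by blast
    then have "s3_act (qcnj p) m' = m" "qcnj p \<in> Sp1" "m' \<in> M14"
      using qmul_qcnj[of "qcnj p"] s3_act_M14 by (simp_all add: s3_act_mul Sp1_def s3_act_one)
    then show "(m', m) \<in> s3_rel"
      unfolding s3_rel_def by (metis (mono_tags, lifting) mem_Collect_eq)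
  qed
  show "trans s3_rel"
  proof (rule transI)
    fix m m' m'' assume "(m, m') \<in> s3_rel" "(m', m'') \<in> s3_rel"
    then obtain p q where *: "m \<in> M14" "p \<in> Sp1" "q \<in> Sp1" "m'' = s3_act q (s3_act p m)"
      unfolding s3_rel_def by blast
    then have "m'' = s3_act (q *\<^sub>H p) m" "q *\<^sub>H p \<in> Sp1"
      by (simp_all add: s3_act_mul Sp1_def norm_qmul)
    then show "(m, m'') \<in> s3_rel"
      unfolding s3_rel_def using *(1) by (metis (mono_tags, lifting) mem_Collect_eq)
  qed
qed

lemma f14_s3_act: "f14 (s3_act p m) = f14 m"
  by (cases m) simp

lemma f14_descends: "\<exists>F. \<forall>m\<in>M14. F (pi1 m) = f14 m"
proof -
  have "f14 ` pi1 m = {f14 m}" if "m \<in> M14" for m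
  proof -
    have "m \<in> pi1 m"
      using equiv_class_self[OF equiv_s3_rel that] by (simp add: pi1_def proj_def)
    moreover have "f14 m' = f14 m" if "m' \<in> pi1 m" for m'
      using that f14_s3_act unfolding pi1_def proj_def s3_rel_def by blast
    ultimately show ?thesis by blast
  qed
  then show ?thesis
    by (intro exI[of _ "\<lambda>p. the_elem (f14 ` p)"]) simp
qed

lemma Psi_pi1:
  assumes "P \<in> Sp2" "(Q, t) \<in> M14"
  shows "Psi P (pi1 (Q, t)) = pi1 (P **\<^sub>H Q, t)"
proof -
  have act: "(\<lambda>(Q, t). (P **\<^sub>H Q, t)) (s3_act p (Q, t)) = s3_act p (P **\<^sub>H Q, t)" for p
    by (cases t) (simp add: qmat_mul_assoc)
  have "(P **\<^sub>H Q, t) \<in> M14"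
    using assms by (simp add: M14_def Sp2_mul)
  then have cls: "pi1 (P **\<^sub>H Q, t) = (\<lambda>p. s3_act p (P **\<^sub>H Q, t)) ` Sp1"
    "pi1 (Q, t) = (\<lambda>p. s3_act p (Q, t)) ` Sp1"
    using assms unfolding pi1_def proj_def s3_rel_def by blast+
  show ?thesis
    unfolding Psi_def cls image_image act ..
qed

end

theory Submission
  imports Defs
begin

text \<open>The gradient \<open>\<xi>\<close> of \<open>f\<close> on \<open>M\<^sup>1\<^sup>4\<close> is horizontal with
  \<open>|\<xi>|\<^sup>2 = 1 - f\<^sup>2\<close>, so it descends to the gradient of \<open>F\<close>. Away from \<open>F = \<plusminus> 1\<close> the
  gradient of \<open>F\<close> together with the ten Killing fields of the left \<open>Sp(2)\<close>-action is a frame whose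
  members commute with \<open>grad F\<close>, hence \<open>2 \<Delta>F\<close> is the logarithmic derivative along \<open>grad F\<close> of the
  determinant of the metric in this frame. That matrix is diagonal when the Killing fields are chosen
  from the three blocks \<open>x\<close>, \<open>y\<close>, \<open>z\<close> at a given \<open>Q\<close>, and only the block \<open>x\<close>, which the fibres of the
  submersion shrink by the factor \<open>(1 - F\<^sup>2) / (r\<^sub>1 / 2 + 1 - F\<^sup>2)\<close>, and \<open>grad F\<close>
  itself contribute. The formula extends to \<open>F = \<plusminus> 1\<close> by continuity. Level sets are orbits because
  unit quaternions act transitively on spheres in the quaternions.\<close>


section \<open>Calculus of \<open>C\<^sup>k\<close> maps\<close>

text \<open>A chart is an arbitrary member of a maximal atlas, and the coordinate metric is a
  definite description over all representatives of a class, so nothing can be computed in a chart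
  directly. Everything is lifted to \<open>M14\<close>: coordinate vectors are images
  \<open>dpr c m V\<close> of tangent vectors of \<open>M14\<close>, and their product is the metric
  of \<open>M14\<close> minus a correction of rank three coming from the fibre. Smoothness of the
  metric in the chart, without which the divergence cannot be handled, requires smooth local
  sections of the projection; they come from explicit charts by way of inverse maps. No connection
  occurs: vanishing Lie brackets turn into symmetry of the second derivatives of an extension of the
  chart to an open set of the ambient space. With n = 1 - t^2 and k = r1 / 2 the frame determinant
  is a constant times n (k n / (k + n))^3, where 3 is the dimension of the imaginary quaternions.
  Its logarithmic derivative in t is -(2 t / n) (1 + 3 k / (k + n)). Multiplied by the speed n of t
  along the gradient and halved, it gives the stated Laplacian, as k / (k + n) = 1 / (1 + 2 n /
  r1).\<close>

abbreviation fder :: "('a::real_normed_vector \<Rightarrow> 'b::real_normed_vector) \<Rightarrow> 'a \<Rightarrow> 'a \<Rightarrow> 'b" where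
  "fder f x \<equiv> frechet_derivative f (at x)"

lemmas velocity_const = has_vector_derivative_const
lemmas linear_velocity = bounded_linear.has_vector_derivative

lemma Ck_on_subset: "Ck_on k f W \<Longrightarrow> V \<subseteq> W \<Longrightarrow> Ck_on k f V"
proof (induction k arbitrary: f)
  case 0
  then show ?case by (auto intro: continuous_on_subset)
next
  case (Suc k)
  then show ?case by (auto intro: differentiable_on_subset)
qed

lemma Ck_on_Suc_imp: "Ck_on (Suc k) f W \<Longrightarrow> Ck_on k f W"
proof (induction k arbitrary: f)
  case 0
  then show ?case by (simp add: differentiable_imp_continuous_on)
next
  case (Suc k)
  then show ?case by simp
qed

lemma Ck_on_cong:
  assumes "open W" "\<And>x. x \<in> W \<Longrightarrow> f x = g x" "Ck_on k f W"
  shows "Ck_on k g W"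
  using assms(2,3)
proof (induction k arbitrary: f g)
  case 0
  then show ?case using continuous_on_cong[of W W f g] by simp
next
  case (Suc k)
  have eq: "(g has_derivative f') (at x) \<longleftrightarrow> (f has_derivative f') (at x)" if "x \<in> W" for x f'
    using has_derivative_transform_within_open[OF _ assms(1) that] Suc.prems(1) by metis
  then have "fder f x = fder g x" if "x \<in> W" for x
    using that by (simp add: frechet_derivative_def)
  then have "Ck_on k (\<lambda>x. fder g x v) W" for v
    using Suc.IH[of "\<lambda>x. fder f x v" "\<lambda>x. fder g x v"] Suc.prems(2)
    by simp
  moreover have "g differentiable_on W"
    using Suc.prems(2) eq assms(1) by (simp add: differentiable_on_eq_differentiable_at differentiable_def)
  ultimately show ?case by simp
qed

text \<open>A derivative given by a formula may replace \<open>frechet_derivative\<close> in the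
  recursion, because on an open set the two agree at every point.\<close>

lemma Ck_on_SucI:
  assumes "open W" "\<And>x. x \<in> W \<Longrightarrow> (f has_derivative f' x) (at x)" "\<And>v. Ck_on k (\<lambda>x. f' x v) W"
  shows "Ck_on (Suc k) f W"
proof -
  have "f differentiable_on W"
    using assms(1,2) by (auto simp: differentiable_on_eq_differentiable_at differentiable_def)
  moreover have "f' x = fder f x" if "x \<in> W" for x
    using frechet_derivative_at[OF assms(2)[OF that]] .
  then have "Ck_on k (\<lambda>x. fder f x v) W" for v
    using Ck_on_cong[OF assms(1) _ assms(3)[of v]] by simp
  ultimately show ?thesis by simp
qed

lemma Ck_on_D:
  "Ck_on (Suc k) f W \<Longrightarrow> open W \<Longrightarrow> x \<in> W \<Longrightarrow> (f has_derivative fder f x) (at x)"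
  by (simp add: differentiable_on_eq_differentiable_at frechet_derivative_works)

lemma Ck_on_frechet: "Ck_on (Suc k) f W \<Longrightarrow> Ck_on k (\<lambda>x. fder f x v) W"
  by simp

lemma Ck_on_local:
  assumes "open W" "\<And>x. x \<in> W \<Longrightarrow> \<exists>V. open V \<and> x \<in> V \<and> Ck_on k f V"
  shows "Ck_on k f W"
  using assms(2)
proof (induction k arbitrary: f)
  case 0
  then have "\<forall>x\<in>W. isCont f x"
    by (metis Ck_on.simps(1) continuous_on_eq_continuous_at)
  then show ?case by (simp add: continuous_at_imp_continuous_on)
next
  case (Suc k)
  have "f differentiable (at x)" if "x \<in> W" for x
    using Suc.prems[OF that] by (metis Ck_on.simps(2) differentiable_on_eq_differentiable_at)
  moreover have "Ck_on k (\<lambda>x. fder f x v) W" for v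
    by (rule Suc.IH) (use Suc.prems in \<open>auto; metis\<close>)
  ultimately show ?case using assms(1) by (simp add: differentiable_on_eq_differentiable_at)
qed

section \<open>Closure properties of smooth maps\<close>

lemma Ck_on_const [simp, intro]: "open W \<Longrightarrow> Ck_on k (\<lambda>x. c) W"
proof (induction k arbitrary: c)
  case (Suc k)
  then show ?case by (intro Ck_on_SucI[where f' = "\<lambda>x v. 0"]) auto
qed auto

lemma Ck_on_linear:
  assumes "bounded_linear L" "open W" shows "Ck_on k L W"
proof (cases k)
  case 0
  then show ?thesis using assms by (simp add: linear_continuous_on)
next
  case (Suc n)
  show ?thesis unfolding Suc
    by (rule Ck_on_SucI[where f' = "\<lambda>x. L"]) (use assms in \<open>auto intro: bounded_linear_imp_has_derivative\<close>)
qed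

lemma Ck_on_id: "open W \<Longrightarrow> Ck_on k (\<lambda>x. x) W"
  by (rule Ck_on_linear[OF bounded_linear_ident])

lemma Ck_on_linear_comp:
  assumes "bounded_linear L" "open W" "Ck_on k f W" shows "Ck_on k (\<lambda>x. L (f x)) W"
  using assms(3)
proof (induction k arbitrary: f)
  case 0
  then show ?case using assms by (simp add: bounded_linear.continuous_on)
next
  case (Suc k)
  have "(f has_derivative fder f x) (at x)" if "x \<in> W" for x
    using Ck_on_D[OF Suc.prems assms(2) that] .
  then show ?case
    by (intro Ck_on_SucI[OF assms(2), where f' = "\<lambda>x v. L (fder f x v)"])
      (use Suc in \<open>auto intro!: bounded_linear.has_derivative[OF assms(1)]\<close>)
qed

lemma Ck_on_add:
  assumes "open W" "Ck_on k f W" "Ck_on k g W" shows "Ck_on k (\<lambda>x. f x + g x) W"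
  using assms(2,3)
proof (induction k arbitrary: f g)
  case 0
  then show ?case by (simp add: continuous_on_add)
next
  case (Suc k)
  have "(f has_derivative fder f x) (at x)"
    "(g has_derivative fder g x) (at x)" if "x \<in> W" for x
    using Ck_on_D[OF _ assms(1) that] Suc.prems by blast+
  then show ?case
    by (intro Ck_on_SucI[OF assms(1),
          where f' = "\<lambda>x v. fder f x v + fder g x v"])
      (use Suc in \<open>auto intro!: has_derivative_add\<close>)
qed

lemma Ck_on_sum:
  assumes "open W" "\<And>i. i \<in> I \<Longrightarrow> Ck_on k (f i) W" shows "Ck_on k (\<lambda>x. \<Sum>i\<in>I. f i x) W"
  using assms(2) by (induction I rule: infinite_finite_induct) (auto intro!: Ck_on_add assms(1))

text \<open>One induction with the Leibniz rule serves every product in use: scalar, inner,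
  quaternionic and matrix multiplication.\<close>

lemma Ck_on_bilinear:
  assumes "bounded_bilinear B" "open W" "Ck_on k f W" "Ck_on k g W"
  shows "Ck_on k (\<lambda>x. B (f x) (g x)) W"
  using assms(3,4)
proof (induction k arbitrary: f g)
  case 0
  then show ?case using bounded_bilinear.continuous_on[OF assms(1)] by simp
next
  case (Suc k)
  have "(f has_derivative fder f x) (at x)"
    "(g has_derivative fder g x) (at x)" if "x \<in> W" for x
    using Ck_on_D[OF _ assms(2) that] Suc.prems by blast+
  moreover have "Ck_on k f W" "Ck_on k g W" using Suc.prems Ck_on_Suc_imp by blast+
  ultimately show ?case
    using Suc
    by (intro Ck_on_SucI[OF assms(2),
          where f' = "\<lambda>x v. B (f x) (fder g x v) + B (fder f x v) (g x)"])
      (auto intro!: bounded_bilinear.FDERIV[OF assms(1)] assms Ck_on_add)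
qed

lemmas Ck_on_scaleR = Ck_on_bilinear[OF bounded_bilinear_scaleR]
lemmas Ck_on_mult = Ck_on_bilinear[OF bounded_bilinear_mult]
lemmas Ck_on_inner = Ck_on_bilinear[OF bounded_bilinear_inner]

lemma Ck_on_minus: "open W \<Longrightarrow> Ck_on k f W \<Longrightarrow> Ck_on k (\<lambda>x. - f x) W"
  using Ck_on_linear_comp[OF bounded_linear_minus[OF bounded_linear_ident]] by blast

lemma Ck_on_diff: "open W \<Longrightarrow> Ck_on k f W \<Longrightarrow> Ck_on k g W \<Longrightarrow> Ck_on k (\<lambda>x. f x - g x) W"
  using Ck_on_add[of W k f "\<lambda>x. - g x"] Ck_on_minus[of W k g] by simp

lemma Ck_on_prod:
  fixes f :: "'i \<Rightarrow> 'a::euclidean_space \<Rightarrow> real"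
  assumes "open W" "\<And>i. i \<in> I \<Longrightarrow> Ck_on k (f i) W" shows "Ck_on k (\<lambda>x. \<Prod>i\<in>I. f i x) W"
  using assms(2) by (induction I rule: infinite_finite_induct) (auto intro!: Ck_on_mult assms(1))

text \<open>The chain rule evaluates the derivative of g in the direction \<open>fder f x v\<close>,
  which varies with x, while \<open>Ck_on\<close> speaks of fixed directions only. Expanding that
  direction in \<open>Basis\<close> gives a finite sum of products to which the induction hypothesis
  applies.\<close>

lemma Ck_on_compose:
  fixes f :: "'a::euclidean_space \<Rightarrow> 'b::euclidean_space"
  assumes "open W" "open V" "Ck_on k f W" "Ck_on k g V" "f ` W \<subseteq> V"
  shows "Ck_on k (\<lambda>x. g (f x)) W"
  using assms(3,4)
proof (induction k arbitrary: g)
  case 0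
  then show ?case using continuous_on_compose2 assms(5) by auto
next
  case (Suc k)
  have f: "Ck_on k f W" using Suc.prems Ck_on_Suc_imp by blast
  have g: "Ck_on k (\<lambda>x. fder g (f x) b) W" for b
    using Suc.IH[OF f, of "\<lambda>y. fder g y b"] Suc.prems(2) by simp
  let ?D = "\<lambda>x v. \<Sum>b\<in>Basis. (fder f x v \<bullet> b) *\<^sub>R fder g (f x) b"
  have "((\<lambda>x. g (f x)) has_derivative ?D x) (at x)" if x: "x \<in> W" for x
  proof -
    have fx: "f x \<in> V" using assms(5) x by blast
    have g': "(g has_derivative fder g (f x)) (at (f x))"
      using Ck_on_D[OF Suc.prems(2) assms(2) fx] .
    have 1: "((\<lambda>x. g (f x)) has_derivative (\<lambda>v. fder g (f x) (fder f x v))) (at x)"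
      by (rule has_derivative_compose[OF Ck_on_D[OF Suc.prems(1) assms(1) x] g'])
    have eq: "fder g (f x) w = (\<Sum>b\<in>Basis. (w \<bullet> b) *\<^sub>R fder g (f x) b)" for w
    proof -
      interpret bounded_linear "fder g (f x)"
        using g' has_derivative_bounded_linear by blast
      have "fder g (f x) w = fder g (f x) (\<Sum>b\<in>Basis. (w \<bullet> b) *\<^sub>R b)"
        by (simp add: euclidean_representation)
      also have "\<dots> = (\<Sum>b\<in>Basis. (w \<bullet> b) *\<^sub>R fder g (f x) b)"
        by (simp add: sum scaleR)
      finally show ?thesis .
    qed
    show ?thesis
      by (rule has_derivative_eq_rhs[OF 1]) (rule ext, rule eq)
  qed
  then show ?case
    by (rule Ck_on_SucI[OF assms(1)])
      (use Suc.prems(1) g assms(1) in \<open>auto intro!: Ck_on_sum Ck_on_scaleR Ck_on_inner\<close>)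
qed

text \<open>The derivative of the inverse is a polynomial in the inverse, which closes the
  induction. For the square root below the derivative is in the same way expressed by the root
  itself.\<close>

lemma Ck_on_inverse_real: "Ck_on k (inverse :: real \<Rightarrow> real) (- {0})"
proof (induction k)
  case 0
  then show ?case by (auto intro!: continuous_intros)
next
  case (Suc k)
  show ?case
    by (rule Ck_on_SucI[where f' = "\<lambda>x v. - (inverse x * v * inverse x)"])
      (use Suc in \<open>auto intro!: Ck_on_minus Ck_on_mult has_derivative_inverse'\<close>)
qed

lemma Ck_on_inverse:
  fixes f :: "'a::euclidean_space \<Rightarrow> real"
  assumes "open W" "Ck_on k f W" "\<And>x. x \<in> W \<Longrightarrow> f x \<noteq> 0"
  shows "Ck_on k (\<lambda>x. inverse (f x)) W"
  by (rule Ck_on_compose[OF assms(1) _ assms(2) Ck_on_inverse_real]) (use assms(3) in auto)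

lemma Ck_on_divide:
  fixes f :: "'a::euclidean_space \<Rightarrow> real"
  assumes "open W" "Ck_on k f W" "Ck_on k g W" "\<And>x. x \<in> W \<Longrightarrow> g x \<noteq> 0"
  shows "Ck_on k (\<lambda>x. f x / g x) W"
  unfolding divide_inverse by (intro Ck_on_mult Ck_on_inverse assms)

lemma Ck_on_sqrt_real: "Ck_on k sqrt {0<..}"
proof (induction k)
  case 0
  then show ?case by (auto intro!: continuous_intros)
next
  case (Suc k)
  have "(sqrt has_derivative (*) (inverse (sqrt x) / 2)) (at x)" if "x \<in> {0<..}" for x
    using DERIV_real_sqrt[of x] that by (auto simp: has_field_derivative_def)
  then show ?case
    by (intro Ck_on_SucI[where f' = "\<lambda>x. (*) (inverse (sqrt x) / 2)"])
      (auto intro!: Ck_on_divide Ck_on_mult Ck_on_inverse Ck_on_const Suc)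
qed

lemma Ck_on_sqrt:
  fixes f :: "'a::euclidean_space \<Rightarrow> real"
  assumes "open W" "Ck_on k f W" "\<And>x. x \<in> W \<Longrightarrow> f x > 0"
  shows "Ck_on k (\<lambda>x. sqrt (f x)) W"
  by (rule Ck_on_compose[OF assms(1) _ assms(2) Ck_on_sqrt_real]) (use assms(3) in auto)

lemma linear_axis: "linear (axis i :: 'a::real_vector \<Rightarrow> 'a^'n)"
  by (rule linearI) (auto simp: axis_def vec_eq_iff)

lemma Ck_on_vec:
  fixes f :: "'a::euclidean_space \<Rightarrow> 'n::finite \<Rightarrow> 'b::euclidean_space"
  assumes "open W" "\<And>i. Ck_on k (\<lambda>x. f x i) W"
  shows "Ck_on k (\<lambda>x. \<chi> i. f x i) W"
proof -
  have "(\<chi> i. f x i) = (\<Sum>i\<in>UNIV. axis i (f x i))" for x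
    by (simp add: vec_eq_iff axis_def if_distrib sum.delta cong: if_cong)
  then show ?thesis
    using assms by (auto intro!: Ck_on_sum Ck_on_linear_comp[of "axis _"]
        simp: linear_axis linear_conv_bounded_linear[symmetric])
qed

lemma Ck_on_vec_nth:
  assumes "open W" "Ck_on k f W"
  shows "Ck_on k (\<lambda>x. f x $ i) W"
  by (rule Ck_on_linear_comp[OF bounded_linear_vec_nth assms])

lemma Ck_on_Pair:
  assumes "open W" "Ck_on k f W" "Ck_on k g W"
  shows "Ck_on k (\<lambda>x. (f x, g x)) W"
proof -
  have "bounded_linear (\<lambda>y. (y, 0))" "bounded_linear (\<lambda>y. (0, y))"
    by (auto intro: bounded_linear_Pair bounded_linear_ident bounded_linear_zero)
  then have "Ck_on k (\<lambda>x. (f x, 0) + (0, g x)) W"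
    by (intro Ck_on_add Ck_on_linear_comp[of "\<lambda>y. (y, 0)"] Ck_on_linear_comp[of "\<lambda>y. (0, y)"] assms)
  then show ?thesis by simp
qed

lemma Ck_on_fst: "open W \<Longrightarrow> Ck_on k f W \<Longrightarrow> Ck_on k (\<lambda>x. fst (f x)) W"
  and Ck_on_snd: "open W \<Longrightarrow> Ck_on k f W \<Longrightarrow> Ck_on k (\<lambda>x. snd (f x)) W"
  using Ck_on_linear_comp bounded_linear_fst bounded_linear_snd by blast+

lemma Ck_on_det:
  fixes A :: "'a::euclidean_space \<Rightarrow> real^'n^'n"
  assumes "open W" "\<And>i j. Ck_on k (\<lambda>x. A x $ i $ j) W"
  shows "Ck_on k (\<lambda>x. det (A x)) W"
  unfolding det_def by (intro Ck_on_sum Ck_on_mult Ck_on_prod Ck_on_const assms)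

text \<open>Cramer's rule writes the solution as a quotient of determinants. Used for the derivative
  of an inverse map and for the gradient, so that matrix inversion never has to be
  differentiated.\<close>

lemma Ck_on_solve:
  fixes A :: "'a::euclidean_space \<Rightarrow> real^'n^'n" and b :: "'a \<Rightarrow> real^'n"
  assumes "open W" "\<And>i j. Ck_on k (\<lambda>x. A x $ i $ j) W" "\<And>i. Ck_on k (\<lambda>x. b x $ i) W"
    and "\<And>x. x \<in> W \<Longrightarrow> det (A x) \<noteq> 0" "\<And>x. x \<in> W \<Longrightarrow> A x *v y x = b x"
  shows "Ck_on k y W"
proof (rule Ck_on_cong[OF assms(1)])
  show "(\<chi> l. det (\<chi> i j. if j = l then b x $ i else A x $ i $ j) / det (A x)) = y x" if "x \<in> W" for x
    using assms(5)[OF that] unfolding cramer[OF assms(4)[OF that]] by (rule sym)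
  have "Ck_on k (\<lambda>x. if j = l then b x $ i else A x $ i $ j) W" for i j l
    using assms(2,3) by (cases "j = l") simp_all
  then have "Ck_on k (\<lambda>x. (\<chi> i j. if j = l then b x $ i else A x $ i $ j) $ i $ j) W" for i j l
    by simp
  then show "Ck_on k (\<lambda>x. \<chi> l. det (\<chi> i j. if j = l then b x $ i else A x $ i $ j) / det (A x)) W"
    using assms(1,2,4) by (intro Ck_on_vec Ck_on_divide Ck_on_det)
qed

text \<open>The derivative of the inverse solves a linear system whose coefficients are the derivative of
  the map at the inverse point, so smoothness bootstraps.\<close>

lemma Ck_on_inv_into:
  fixes \<tau> :: "real^'n \<Rightarrow> real^'n"
  assumes "open W" "\<And>k. Ck_on k \<tau> W" "inj_on \<tau> W"
    and inj: "\<And>x. x \<in> W \<Longrightarrow> inj (fder \<tau> x)"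
  shows "open (\<tau> ` W)" "Ck_on k (inv_into W \<tau>) (\<tau> ` W)"
proof -
  \<comment> \<open>Injectivity is given on all of W, so invariance of domain yields openness of the
    image at once.\<close>
  show op: "open (\<tau> ` W)"
    using invariance_of_domain[of W \<tau>] assms(1-3) Ck_on.simps(1) by blast
  let ?\<omega> = "inv_into W \<tau>"
  let ?D = "\<lambda>x. fder \<tau> x"
  have D: "(\<tau> has_derivative ?D x) (at x)" if "x \<in> W" for x
    using Ck_on_D[OF assms(2)[of "Suc 0"] assms(1) that] .
  have lin: "linear (?D x)" if "x \<in> W" for x
    using D[OF that] has_derivative_linear by blast
  have D\<omega>: "(?\<omega> has_derivative inv (?D (?\<omega> y))) (at y)" if "y \<in> \<tau> ` W" for y
  proof -
    have x: "?\<omega> y \<in> W" "\<tau> (?\<omega> y) = y" using that by (auto intro: inv_into_into f_inv_into_f)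
    have "?D (?\<omega> y) \<circ> inv (?D (?\<omega> y)) = id"
      using linear_injective_imp_surjective[OF lin inj] x surj_iff by blast
    then have "(?\<omega> has_derivative inv (?D (?\<omega> y))) (at (\<tau> (?\<omega> y)))"
      by (intro has_derivative_inverse_strong[OF assms(1) x(1) _ _ D[OF x(1)]])
        (use assms(2)[of 0] assms(3) in \<open>auto simp: inv_into_f_f\<close>)
    then show ?thesis by (simp add: x)
  qed
  show "Ck_on k ?\<omega> (\<tau> ` W)"
  proof (induction k)
    case 0
    show ?case unfolding Ck_on.simps
      by (meson D\<omega> continuous_at_imp_continuous_on has_derivative_continuous)
  next
    case (Suc k)
    show ?case
    proof (rule Ck_on_SucI[OF op D\<omega>])
      fix v
      let ?A = "\<lambda>y. matrix (?D (?\<omega> y))"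
      have "Ck_on k (\<lambda>y. ?D (?\<omega> y) w) (\<tau> ` W)" for w
        by (rule Ck_on_compose[OF op assms(1) Suc])
          (use assms(2)[of "Suc k"] in \<open>auto intro: inv_into_into\<close>)
      then have "Ck_on k (\<lambda>y. ?A y $ i $ j) (\<tau> ` W)" for i j
        unfolding matrix_def by (simp add: Ck_on_vec_nth op)
      moreover have "det (?A y) \<noteq> 0" "?A y *v inv (?D (?\<omega> y)) v = v" if "y \<in> \<tau> ` W" for y
      proof -
        have x: "?\<omega> y \<in> W" using that by (auto intro: inv_into_into)
        show "det (?A y) \<noteq> 0" using det_nz_iff_inj[OF lin[OF x]] inj[OF x] by blast
        show "?A y *v inv (?D (?\<omega> y)) v = v"
          using linear_injective_imp_surjective[OF lin inj, OF x x]
          by (simp only: matrix_vector_mul(2)[OF lin[OF x]] surj_f_inv_f)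
      qed
      ultimately show "Ck_on k (\<lambda>y. inv (?D (?\<omega> y)) v) (\<tau> ` W)"
        by (intro Ck_on_solve[OF op, where b = "\<lambda>y. v" and A = ?A]) (auto simp: op)
    qed
  qed
qed

lemma smooth_on_openI: "open W \<Longrightarrow> (\<And>k. Ck_on k f W) \<Longrightarrow> smooth_on W f"
  unfolding smooth_on_def by blast

text \<open>The mean value theorem applied twice; evaluating it in both orders gives Schwarz's theorem.\<close>

lemma second_difference:
  fixes g :: "'a::euclidean_space \<Rightarrow> real"
  assumes W: "open W" "cball a r \<subseteq> W" and g: "Ck_on 2 g W" and s: "s > 0" "s * (norm u + norm v) \<le> r"
  shows "\<exists>x\<in>cball a (s * (norm u + norm v)).
    g (a + s *\<^sub>R u + s *\<^sub>R v) - g (a + s *\<^sub>R u) - g (a + s *\<^sub>R v) + g a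
      = s * s * fder (\<lambda>x. fder g x u) x v"
proof -
  let ?D = "\<lambda>x. fder g x"
  let ?DD = "\<lambda>x. fder (\<lambda>x. ?D x u) x"
  have g2: "Ck_on (Suc (Suc 0)) g W" using g by (simp add: numeral_2_eq_2)
  then have g1: "Ck_on (Suc 0) (\<lambda>x. ?D x u) W" by simp
  have inW: "a + x *\<^sub>R u + y *\<^sub>R v \<in> cball a (s * (norm u + norm v))" "a + x *\<^sub>R u + y *\<^sub>R v \<in> W"
    if "0 \<le> x" "x \<le> s" "0 \<le> y" "y \<le> s" for x y
  proof -
    have "norm (x *\<^sub>R u + y *\<^sub>R v) \<le> x * norm u + y * norm v"
      using norm_triangle_ineq[of "x *\<^sub>R u" "y *\<^sub>R v"] that by simp
    also have "\<dots> \<le> s * (norm u + norm v)"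
      unfolding distrib_left using that by (intro add_mono mult_right_mono) auto
    moreover have "dist a (a + (x *\<^sub>R u + y *\<^sub>R v)) = norm (x *\<^sub>R u + y *\<^sub>R v)"
      by (metis add_diff_cancel_left' dist_commute dist_norm)
    ultimately show "a + x *\<^sub>R u + y *\<^sub>R v \<in> cball a (s * (norm u + norm v))"
      by (simp add: add.assoc)
    then show "a + x *\<^sub>R u + y *\<^sub>R v \<in> W" using W(2) s(2) by (meson cball_subset_cball_iff order_trans subsetD mem_cball)
  qed
  have lin: "linear (?D x)" "linear (?DD x)" if "x \<in> W" for x
    using Ck_on_D[OF g2 W(1) that] Ck_on_D[OF g1 W(1) that]
    by (auto intro: has_derivative_linear)
  define \<phi> where "\<phi> x = g (a + x *\<^sub>R u + s *\<^sub>R v) - g (a + x *\<^sub>R u)" for x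
  have "(\<phi> has_real_derivative (?D (a + x *\<^sub>R u + s *\<^sub>R v) u - ?D (a + x *\<^sub>R u) u)) (at x)"
    if "0 \<le> x" "x \<le> s" for x
  proof -
    have 1: "a + x *\<^sub>R u + s *\<^sub>R v \<in> W" "a + x *\<^sub>R u \<in> W" using inW(2)[of x s] inW(2)[of x 0] that s by auto
    have "((\<lambda>x. a + x *\<^sub>R u + s *\<^sub>R v) has_derivative (\<lambda>h. h *\<^sub>R u)) (at x)"
      "((\<lambda>x. a + x *\<^sub>R u) has_derivative (\<lambda>h. h *\<^sub>R u)) (at x)"
      by (auto intro!: derivative_eq_intros)
    from this[THEN has_derivative_compose, OF Ck_on_D[OF g2 W(1)]] 1
    have "(\<phi> has_derivative (\<lambda>h. ?D (a + x *\<^sub>R u + s *\<^sub>R v) (h *\<^sub>R u) - ?D (a + x *\<^sub>R u) (h *\<^sub>R u))) (at x)"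
      unfolding \<phi>_def by (intro has_derivative_diff) auto
    then show ?thesis
      unfolding has_field_derivative_def
      by (rule has_derivative_eq_rhs) (use 1[THEN lin(1), THEN linear_cmul] in \<open>auto simp: algebra_simps\<close>)
  qed
  from MVT2[OF s(1) this] obtain x where x: "0 < x" "x < s"
    and eq1: "\<phi> s - \<phi> 0 = s * (?D (a + x *\<^sub>R u + s *\<^sub>R v) u - ?D (a + x *\<^sub>R u) u)"
    by auto
  define \<psi> where "\<psi> y = ?D (a + x *\<^sub>R u + y *\<^sub>R v) u" for y
  have "(\<psi> has_real_derivative (?DD (a + x *\<^sub>R u + y *\<^sub>R v) v)) (at y)"
    if "0 \<le> y" "y \<le> s" for y
  proof -
    have 1: "a + x *\<^sub>R u + y *\<^sub>R v \<in> W" using inW(2)[of x y] that x by auto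
    have "((\<lambda>y. a + x *\<^sub>R u + y *\<^sub>R v) has_derivative (\<lambda>h. h *\<^sub>R v)) (at y)"
      by (auto intro!: derivative_eq_intros)
    from this[THEN has_derivative_compose, OF Ck_on_D[OF g1 W(1) 1]]
    show ?thesis
      unfolding \<psi>_def using 1[THEN lin(2), THEN linear_cmul]
      by (simp add: has_field_derivative_def mult_commute_abs algebra_simps)
  qed
  from MVT2[OF s(1) this] obtain y where y: "0 < y" "y < s"
    and eq2: "\<psi> s - \<psi> 0 = s * ?DD (a + x *\<^sub>R u + y *\<^sub>R v) v"
    by auto
  show ?thesis
  proof (rule bexI)
    show "a + x *\<^sub>R u + y *\<^sub>R v \<in> cball a (s * (norm u + norm v))" using inW(1) x y by auto
    show "g (a + s *\<^sub>R u + s *\<^sub>R v) - g (a + s *\<^sub>R u) - g (a + s *\<^sub>R v) + g a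
      = s * s * ?DD (a + x *\<^sub>R u + y *\<^sub>R v) v"
      using eq1 eq2 by (simp add: \<phi>_def \<psi>_def algebra_simps)
  qed
qed

text \<open>The second difference is symmetric in u and v, but the two orders realise it by mixed
  derivatives at two different points near a. A gap of size 2 e at a then contradicts continuity of
  both mixed derivatives.\<close>

lemma symmetric_second_derivative_real:
  fixes g :: "'a::euclidean_space \<Rightarrow> real"
  assumes W: "open W" "a \<in> W" and g: "Ck_on 2 g W"
  shows "fder (\<lambda>x. fder g x u) a v
       = fder (\<lambda>x. fder g x v) a u" (is "?P a = ?Q a")
proof (rule ccontr)
  assume ne: "?P a \<noteq> ?Q a"
  define e where "e = \<bar>?P a - ?Q a\<bar> / 2"
  have e: "e > 0" using ne by (simp add: e_def)
  have "continuous_on W ?P" "continuous_on W ?Q" using g by (simp_all add: numeral_2_eq_2)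
  then have "isCont ?P a" "isCont ?Q a" using W by (simp_all add: continuous_on_eq_continuous_at)
  then obtain d1 d2 where d: "d1 > 0" "d2 > 0"
    "\<And>x. dist x a < d1 \<Longrightarrow> dist (?P x) (?P a) < e" "\<And>x. dist x a < d2 \<Longrightarrow> dist (?Q x) (?Q a) < e"
    using e unfolding continuous_at_eps_delta by metis
  obtain r0 where r0: "r0 > 0" "cball a r0 \<subseteq> W" using W open_contains_cball by blast
  \<comment> \<open>Halving d1 and d2 keeps a closed ball inside the open balls given by
    continuity.\<close>
  define r where "r = min r0 (min (d1/2) (d2/2))"
  have r: "r > 0" "r \<le> r0" "r < d1" "r < d2" using d r0 by (auto simp: r_def)
  then have rW: "cball a r \<subseteq> W" using r0(2) by auto
  \<comment> \<open>The summand 1 avoids division by zero when u = v = 0.\<close>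
  define s where "s = r / (norm u + norm v + 1)"
  have n: "norm u + norm v + 1 > 0" by (simp add: add_nonneg_pos)
  have s: "s > 0" "s * (norm u + norm v) \<le> r" "s * (norm v + norm u) \<le> r"
    using r(1) n by (auto simp: s_def field_simps)
  obtain x where x: "x \<in> cball a (s * (norm u + norm v))"
    "g (a + s *\<^sub>R u + s *\<^sub>R v) - g (a + s *\<^sub>R u) - g (a + s *\<^sub>R v) + g a = s * s * ?P x"
    using second_difference[OF W(1) rW g s(1,2)] by auto
  obtain y where y: "y \<in> cball a (s * (norm v + norm u))"
    "g (a + s *\<^sub>R v + s *\<^sub>R u) - g (a + s *\<^sub>R v) - g (a + s *\<^sub>R u) + g a = s * s * ?Q y"
    using second_difference[OF W(1) rW g s(1,3)] by auto
  have "s * s * ?P x = s * s * ?Q y" using x(2) y(2) by (simp add: algebra_simps)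
  then have "?P x = ?Q y" using s(1) by simp
  moreover have "dist (?P x) (?P a) < e" by (rule d(3)) (use x(1) s r in \<open>auto simp: dist_commute\<close>)
  moreover have "dist (?Q y) (?Q a) < e" by (rule d(4)) (use y(1) s r in \<open>auto simp: dist_commute\<close>)
  ultimately show False by (auto simp: dist_real_def e_def abs_if split: if_splits)
qed

lemma symmetric_second_derivative:
  fixes g :: "'a::euclidean_space \<Rightarrow> 'b::euclidean_space"
  assumes W: "open W" "a \<in> W" and g: "Ck_on 2 g W"
  shows "fder (\<lambda>x. fder g x u) a v
       = fder (\<lambda>x. fder g x v) a u"
proof (rule euclidean_eqI)
  fix b :: 'b assume "b \<in> Basis"
  have g2: "Ck_on (Suc (Suc 0)) g W" using g by (simp add: numeral_2_eq_2)
  then have g1: "Ck_on (Suc 0) (\<lambda>x. fder g x u) W" for u by simp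
  have b: "Ck_on 2 (\<lambda>x. g x \<bullet> b) W"
    by (rule Ck_on_linear_comp[OF bounded_linear_inner_left W(1) g])
  have c: "fder (\<lambda>x. f x \<bullet> b) x w = fder f x w \<bullet> b"
    if "Ck_on (Suc 0) f W" "x \<in> W" for f x w
    using frechet_derivative_at[OF has_derivative_inner_left[OF Ck_on_D[OF that(1) W(1) that(2)]], of b]
    by metis
  have d: "fder (\<lambda>x. fder (\<lambda>x. g x \<bullet> b) x u) a v
     = fder (\<lambda>x. fder g x u) a v \<bullet> b" for u v
  proof -
    have "((\<lambda>x. fder g x u \<bullet> b) has_derivative
        (\<lambda>v. fder (\<lambda>x. fder g x u) a v \<bullet> b)) (at a)"
      by (rule has_derivative_inner_left[OF Ck_on_D[OF g1 W]])
    then have "((\<lambda>x. fder (\<lambda>x. g x \<bullet> b) x u) has_derivative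
        (\<lambda>v. fder (\<lambda>x. fder g x u) a v \<bullet> b)) (at a)"
      by (rule has_derivative_transform_within_open[OF _ W])
        (simp add: c[OF Ck_on_Suc_imp[OF g2]])
    from frechet_derivative_at[OF this] show ?thesis by metis
  qed
  show "fder (\<lambda>x. fder g x u) a v \<bullet> b
       = fder (\<lambda>x. fder g x v) a u \<bullet> b"
    using symmetric_second_derivative_real[OF W b, of u v] unfolding d .
qed

section \<open>Derivatives of determinants\<close>

text \<open>Each monomial of the Leibniz expansion contains exactly one factor from every row, so
  the product rule differentiates one row at a time.\<close>

lemma has_derivative_det_rows:
  fixes E :: "real \<Rightarrow> real^'n^'n"
  assumes "\<And>i. ((\<lambda>s. E s $ i) has_vector_derivative E' i) (at s0)"
  shows "((\<lambda>s. det (E s)) has_real_derivative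
     (\<Sum>k\<in>UNIV. det (\<chi> i. if i = k then E' i else E s0 $ i))) (at s0)"
proof -
  have c: "((\<lambda>s. E s $ i $ j) has_real_derivative E' i $ j) (at s0)" for i j
    using linear_velocity[OF bounded_linear_vec_nth assms]
    by (simp add: has_real_derivative_iff_has_vector_derivative)
  have p: "((\<lambda>s. \<Prod>i\<in>UNIV. E s $ i $ p i) has_real_derivative
     (\<Sum>k\<in>UNIV. \<Prod>i\<in>UNIV. (\<chi> i. if i = k then E' i else E s0 $ i) $ i $ p i)) (at s0)" for p
  proof -
    have "(\<Prod>i\<in>UNIV. (\<chi> i. if i = k then E' i else E s0 $ i) $ i $ p i)
       = E' k $ p k * (\<Prod>i\<in>UNIV - {k}. E s0 $ i $ p i)" for k
      by (subst prod.remove[of _ k]) (auto intro!: prod.cong)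
    moreover have "((\<lambda>s. \<Prod>i\<in>UNIV. E s $ i $ p i) has_derivative
        (\<lambda>h. \<Sum>k\<in>UNIV. E' k $ p k * h * (\<Prod>i\<in>UNIV - {k}. E s0 $ i $ p i))) (at s0)"
      by (rule has_derivative_prod) (use c in \<open>simp add: has_field_derivative_def\<close>)
    ultimately show ?thesis
      unfolding has_field_derivative_def
      by (elim has_derivative_eq_rhs) (simp add: sum_distrib_right sum_distrib_left mult_ac fun_eq_iff)
  qed
  have "((\<lambda>s. \<Sum>p\<in>{p. p permutes UNIV}. of_int (sign p) * (\<Prod>i\<in>UNIV. E s $ i $ p i)) has_real_derivative
     (\<Sum>p\<in>{p. p permutes UNIV}. of_int (sign p) *
       (\<Sum>k\<in>UNIV. \<Prod>i\<in>UNIV. (\<chi> i. if i = k then E' i else E s0 $ i) $ i $ p i))) (at s0)"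
    by (intro DERIV_sum DERIV_cmult p)
  then show ?thesis
    unfolding det_def sum_distrib_left by (subst sum.swap)
qed

text \<open>Each T applied to a row is a combination of the rows; substituted for row k, only its
  k-th coefficient survives in the determinant. The sum of these coefficients is the trace of a
  conjugate of the transpose of T.\<close>

lemma jacobi_formula:
  fixes E :: "real \<Rightarrow> real^'n^'n" and T :: "real^'n^'n"
  assumes "\<And>i. ((\<lambda>s. E s $ i) has_vector_derivative T *v (E s0 $ i)) (at s0)" "det (E s0) \<noteq> 0"
  shows "((\<lambda>s. det (E s)) has_real_derivative trace T * det (E s0)) (at s0)"
proof -
  obtain Ei where Ei: "Ei ** E s0 = mat 1" "E s0 ** Ei = mat 1"
    using assms(2) invertible_det_nz[of "E s0"] unfolding invertible_def by blast
  \<comment> \<open>The matrix of T in the basis formed by the rows of \<open>E s0\<close>.\<close>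
  define c where "c = E s0 ** transpose T ** Ei"
  have cE: "c ** E s0 = E s0 ** transpose T"
    by (simp add: c_def Ei flip: matrix_mul_assoc)
  have row: "T *v (E s0 $ k) = (\<Sum>i\<in>UNIV. c $ k $ i *s row i (E s0))" for k
  proof -
    have "T *v (E s0 $ k) = (E s0 ** transpose T) $ k"
      by (simp add: vec_eq_iff matrix_matrix_mult_def matrix_vector_mult_def transpose_def mult.commute)
    also have "\<dots> = (\<Sum>i\<in>UNIV. c $ k $ i *s row i (E s0))"
      unfolding cE[symmetric] by (simp add: vec_eq_iff matrix_matrix_mult_def row_def)
    finally show ?thesis .
  qed
  have "det (\<chi> i. if i = k then T *v (E s0 $ i) else E s0 $ i) = c $ k $ k * det (E s0)" for k
  proof -
    have "(\<chi> i. if i = k then T *v (E s0 $ i) else E s0 $ i) =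
       (\<chi> i. if i = k then (\<Sum>i\<in>UNIV. c $ k $ i *s row i (E s0)) else row i (E s0))"
      by (simp add: vec_eq_iff row row_def)
    then show ?thesis using cramer_lemma_transpose[of k "c $ k" "E s0"] by simp
  qed
  moreover have "trace c = trace T"
  proof -
    have "trace c = trace (Ei ** (E s0 ** transpose T))"
      unfolding c_def by (rule trace_mul_sym)
    also have "\<dots> = trace (transpose T)" by (simp add: matrix_mul_assoc Ei)
    finally show ?thesis by (simp add: trace_def transpose_def)
  qed
  ultimately have "(\<Sum>k\<in>UNIV. det (\<chi> i. if i = k then T *v (E s0 $ i) else E s0 $ i)) = trace T * det (E s0)"
    by (simp add: trace_def flip: sum_distrib_right)
  then show ?thesis using has_derivative_det_rows[OF assms(1)] by simp
qed


section \<open>Quaternionic matrices\<close>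

abbreviation velocity :: "(real \<Rightarrow> 'a::real_normed_vector) \<Rightarrow> 'a \<Rightarrow> bool" where
  "velocity \<gamma> v \<equiv> (\<gamma> has_vector_derivative v) (at 0)"

abbreviation TM :: "m14 \<Rightarrow> m14 set" where
  "TM \<equiv> tangent_space M14"

abbreviation \<pi> :: "m14 \<Rightarrow> m14 set" where
  "\<pi> \<equiv> proj s3_rel"

definition qm :: "quat \<Rightarrow> quat \<Rightarrow> quat \<Rightarrow> quat \<Rightarrow> qmat" where
  "qm a b c d = (\<chi> i j. if i = 1 then (if j = 1 then a else b) else (if j = 1 then c else d))"

lemma qm_nth [simp]:
  "qm a b c d $ 1 $ 1 = a" "qm a b c d $ 1 $ 2 = b" "qm a b c d $ 2 $ 1 = c" "qm a b c d $ 2 $ 2 = d"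
  by (simp_all add: qm_def)

lemma qm_eq_iff: "A = B \<longleftrightarrow> A $ 1 $ 1 = B $ 1 $ 1 \<and> A $ 1 $ 2 = B $ 1 $ 2 \<and> A $ 2 $ 1 = B $ 2 $ 1 \<and> A $ 2 $ 2 = B $ 2 $ 2"
  for A B :: qmat
  by (auto simp: vec_eq_iff forall_2)

lemma qmat_mul_nth: "(A **\<^sub>H B) $ i $ j = A $ i $ 1 *\<^sub>H B $ 1 $ j + A $ i $ 2 *\<^sub>H B $ 2 $ j"
  by (simp add: qmat_mul_def sum_2)

lemma qadj_nth [simp]: "qadj A $ i $ j = qcnj (A $ j $ i)"
  by (simp add: qadj_def)

lemma qdiag_nth [simp]: "qdiag a b $ 1 $ 1 = a" "qdiag a b $ 1 $ 2 = 0" "qdiag a b $ 2 $ 1 = 0" "qdiag a b $ 2 $ 2 = b"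
  by (simp_all add: qdiag_def)

lemma qid_nth [simp]: "qid $ 1 $ 1 = qreal 1" "qid $ 1 $ 2 = 0" "qid $ 2 $ 1 = 0" "qid $ 2 $ 2 = qreal 1"
  by (simp_all add: qid_def)

lemma qmul_scaleR: "(c *\<^sub>R p) *\<^sub>H q = c *\<^sub>R (p *\<^sub>H q)" "p *\<^sub>H (c *\<^sub>R q) = c *\<^sub>R (p *\<^sub>H q)"
  by (simp_all add: qmul_def prod_eq_iff cross3_def vec_eq_iff forall_3 inner_vec_def sum_3 algebra_simps)

lemma qcnj_scaleR: "qcnj (c *\<^sub>R p) = c *\<^sub>R qcnj p"
  by (simp add: qcnj_def prod_eq_iff)

lemma qcnj_minus: "qcnj (- p) = - qcnj p"
  by (simp add: qcnj_def prod_eq_iff)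

lemma qreal_add: "qreal (a + b) = qreal a + qreal b"
  by (simp add: qreal_def)

lemma qreal_mul: "qreal a *\<^sub>H p = a *\<^sub>R p" "p *\<^sub>H qreal a = a *\<^sub>R p"
  by (simp_all add: qmul_def qreal_def prod_eq_iff)

lemma scaleR_qreal: "c *\<^sub>R qreal a = qreal (c * a)"
  by (simp add: qreal_def)

lemma qreal_eq_iff [simp]: "qreal a = qreal b \<longleftrightarrow> a = b" "qreal a = 0 \<longleftrightarrow> a = 0" "qreal 0 = 0"
  by (auto simp: qreal_def prod_eq_iff)

lemma qcnj_qmul_self: "qcnj p *\<^sub>H p = qreal ((norm p)\<^sup>2)"
  using qmul_qcnj[of "qcnj p"] by simp

lemma bilinear_qmul: "bounded_bilinear (*\<^sub>H)"
  unfolding bilinear_conv_bounded_bilinear[symmetric] bilinear_def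
  by (intro conjI allI linearI) (simp_all only: qmul_distrib qmul_scaleR)

lemmas qmul_minus = bounded_bilinear.minus_left[OF bilinear_qmul]
  bounded_bilinear.minus_right[OF bilinear_qmul]

lemma bounded_linear_qcnj: "bounded_linear qcnj"
  unfolding linear_conv_bounded_linear[symmetric] by (rule linearI) (simp_all only: qcnj_simps qcnj_scaleR)

lemma bilinear_qmat_mul: "bounded_bilinear (**\<^sub>H)"
  unfolding bilinear_conv_bounded_bilinear[symmetric] bilinear_def
  by (auto intro!: linearI simp: qm_eq_iff qmat_mul_nth qmul_distrib qmul_scaleR algebra_simps)

lemmas qmat_mul_velocity = bounded_bilinear.has_vector_derivative[OF bilinear_qmat_mul]
lemmas qmat_mul_add = bounded_bilinear.add_left[OF bilinear_qmat_mul]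
  bounded_bilinear.add_right[OF bilinear_qmat_mul]
lemmas qmat_mul_zero [simp] = bounded_bilinear.zero_left[OF bilinear_qmat_mul]
  bounded_bilinear.zero_right[OF bilinear_qmat_mul]
lemmas qmat_mul_scaleR = bounded_bilinear.scaleR_left[OF bilinear_qmat_mul]
  bounded_bilinear.scaleR_right[OF bilinear_qmat_mul]

lemma bounded_linear_qadj: "bounded_linear qadj"
  unfolding linear_conv_bounded_linear[symmetric] by (auto intro!: linearI simp: qm_eq_iff qcnj_scaleR)

lemma qadj_qadj [simp]: "qadj (qadj A) = A"
  by (simp add: qm_eq_iff)

lemma inner_qmul_left: "(a *\<^sub>H p) \<bullet> q = p \<bullet> (qcnj a *\<^sub>H q)"
  by (simp add: qmul_def qcnj_def inner_prod_def cross3_def inner_vec_def sum_3 algebra_simps)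

lemma inner_qmul_right: "(p *\<^sub>H a) \<bullet> q = p \<bullet> (q *\<^sub>H qcnj a)"
  by (simp add: qmul_def qcnj_def inner_prod_def cross3_def inner_vec_def sum_3 algebra_simps)

lemma inner_imaginary: "(0, v) \<bullet> q = v \<bullet> snd q" "q \<bullet> (0, v) = snd q \<bullet> v" for v :: "real^3" and q :: quat
  by (auto simp: inner_prod_def)

lemma inner_qreal: "q \<bullet> qreal a = a * fst q"
  by (simp add: qreal_def inner_prod_def)

text \<open>\<open>Sp2\<close> provides only a right inverse. Left multiplication by the adjoint is
  injective on a finite-dimensional real space, hence surjective, so the adjoint has a right inverse
  too, and that must be Q.\<close>

lemma Sp2_left:
  assumes "Q \<in> Sp2" shows "qadj Q **\<^sub>H Q = qid"
proof -
  have Q: "Q **\<^sub>H qadj Q = qid" using assms by (simp add: Sp2_def)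
  have "linear ((**\<^sub>H) (qadj Q))"
    using bilinear_qmat_mul unfolding bilinear_conv_bounded_bilinear[symmetric] bilinear_def by blast
  moreover have "inj ((**\<^sub>H) (qadj Q))"
    by (rule injI) (metis Q qmat_mul_assoc qmat_mul_qid(1))
  ultimately have "surj ((**\<^sub>H) (qadj Q))" by (rule linear_inj_imp_surj)
  then obtain B where B: "qadj Q **\<^sub>H B = qid" by (metis surjD)
  then have "Q = B" by (metis Q qmat_mul_assoc qmat_mul_qid)
  then show ?thesis using B by simp
qed

lemma Sp2_right: "Q \<in> Sp2 \<Longrightarrow> Q **\<^sub>H qadj Q = qid"
  by (simp add: Sp2_def)

lemma Sp2_cancel [simp]:
  assumes "Q \<in> Sp2" shows "qadj Q **\<^sub>H (Q **\<^sub>H A) = A" "Q **\<^sub>H (qadj Q **\<^sub>H A) = A"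
  by (metis assms Sp2_left Sp2_right qmat_mul_assoc qmat_mul_qid(1))+

lemma Sp2_qadj: "Q \<in> Sp2 \<Longrightarrow> qadj Q \<in> Sp2"
  using Sp2_left by (simp add: Sp2_def)

lemma qid_Sp2 [simp]: "qid \<in> Sp2"
  by (simp add: Sp2_def qm_eq_iff)

lemma Sp1_iff: "p \<in> Sp1 \<longleftrightarrow> norm p = 1"
  by (simp add: Sp1_def)

lemma Sp2_entries:
  assumes "Q \<in> Sp2"
  shows "(norm (Q $ 1 $ 1))\<^sup>2 + (norm (Q $ 1 $ 2))\<^sup>2 = 1"
    "(norm (Q $ 1 $ 2))\<^sup>2 + (norm (Q $ 2 $ 2))\<^sup>2 = 1"
    "Q $ 2 $ 1 *\<^sub>H qcnj (Q $ 1 $ 1) + Q $ 2 $ 2 *\<^sub>H qcnj (Q $ 1 $ 2) = 0"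
proof -
  have "(Q **\<^sub>H qadj Q) $ i $ j = qid $ i $ j" "(qadj Q **\<^sub>H Q) $ i $ j = qid $ i $ j" for i j
    using Sp2_left[OF assms] Sp2_right[OF assms] by simp_all
  note e = this(1)[of 1 1] this(2)[of 2 2] this(1)[of 2 1]
  show "(norm (Q $ 1 $ 1))\<^sup>2 + (norm (Q $ 1 $ 2))\<^sup>2 = 1"
    "(norm (Q $ 1 $ 2))\<^sup>2 + (norm (Q $ 2 $ 2))\<^sup>2 = 1"
    "Q $ 2 $ 1 *\<^sub>H qcnj (Q $ 1 $ 1) + Q $ 2 $ 2 *\<^sub>H qcnj (Q $ 1 $ 2) = 0"
    using e by (simp_all add: qmat_mul_nth qmul_qcnj qcnj_qmul_self flip: qreal_add)
qed


section \<open>Tangent spaces\<close>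

text \<open>The Lie algebra sp(2) of skew-Hermitian matrices in the coordinates (x, y, z) of the
  metric, with the imaginary quaternions x and z stored as vectors.\<close>

definition lie :: "(real^3) \<times> quat \<times> (real^3) \<Rightarrow> qmat" where
  "lie w = qm (0, fst w) (fst (snd w)) (- qcnj (fst (snd w))) (0, snd (snd w))"

lemma lie_nth [simp]: "lie w $ 1 $ 1 = (0, fst w)" "lie w $ 1 $ 2 = fst (snd w)"
  "lie w $ 2 $ 1 = - qcnj (fst (snd w))" "lie w $ 2 $ 2 = (0, snd (snd w))"
  by (simp_all add: lie_def)

lemma linear_lie: "linear lie"
  by (rule linearI) (simp_all add: qm_eq_iff qcnj_scaleR prod_eq_iff)

lemma lie_iff: "X + qadj X = 0 \<longleftrightarrow> X \<in> range lie"
proof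
  assume *: "X + qadj X = 0"
  have "(X + qadj X) $ i $ j = 0" for i j by (simp add: *)
  from this[of 1 1] this[of 1 2] this[of 2 2] this[of 2 1]
  have "X = lie (snd (X $ 1 $ 1), X $ 1 $ 2, snd (X $ 2 $ 2))"
    by (simp add: qm_eq_iff qcnj_def prod_eq_iff eq_neg_iff_add_eq_0)
  then show "X \<in> range lie" by (rule range_eqI)
next
  assume "X \<in> range lie"
  then show "X + qadj X = 0" by (auto simp: qm_eq_iff qcnj_def qcnj_minus prod_eq_iff)
qed

text \<open>Rescales a line tangent to a sphere back onto the sphere. Its derivative at 0 vanishes,
  so the velocity is unaffected; this replaces exponential maps and geodesics throughout.\<close>

definition normalizer :: "real \<Rightarrow> real \<Rightarrow> real" where
  "normalizer c s = inverse (sqrt (1 + s\<^sup>2 * c))"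

lemma normalizer_simps: "normalizer c 0 = 1" "c \<ge> 0 \<Longrightarrow> (normalizer c s)\<^sup>2 * (1 + s\<^sup>2 * c) = 1"
  "c \<ge> 0 \<Longrightarrow> normalizer c s > 0"
  by (auto simp: normalizer_def power_inverse add_nonneg_eq_0_iff intro!: add_pos_nonneg left_inverse)

lemma normalizer_derivative:
  assumes "c \<ge> 0" shows "(normalizer c has_real_derivative 0) (at 0)"
proof -
  have "((\<lambda>s. inverse (sqrt (1 + s\<^sup>2 * c))) has_real_derivative 0) (at 0)"
    by (auto intro!: derivative_eq_intros)
  then show ?thesis by (simp add: normalizer_def[abs_def])
qed

lemma normalizer_scaleR_derivative:
  fixes f :: "real \<Rightarrow> 'a::real_normed_vector"
  assumes "velocity f f'" "c \<ge> 0"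
  shows "velocity (\<lambda>s. normalizer c s *\<^sub>R f s) f'"
  using has_vector_derivative_scaleR[OF normalizer_derivative[OF assms(2)] assms(1)]
  by (simp add: normalizer_simps)

definition imcurve :: "real^3 \<Rightarrow> real \<Rightarrow> quat" where
  "imcurve v s = normalizer ((norm v)\<^sup>2) s *\<^sub>R (1, s *\<^sub>R v)"

lemma imcurve: "imcurve v s \<in> Sp1" "imcurve v 0 = qreal 1" "velocity (imcurve v) (0, v)"
proof -
  have "(norm (1::real, s *\<^sub>R v))\<^sup>2 = 1 + s\<^sup>2 * (norm v)\<^sup>2"
    by (simp add: norm_prod_def power_mult_distrib)
  then have "(norm (imcurve v s))\<^sup>2 = 1"
    using normalizer_simps(2)[of "(norm v)\<^sup>2" s] unfolding imcurve_def norm_scaleR power_mult_distrib power2_abs by simp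
  then show "imcurve v s \<in> Sp1"
    unfolding Sp1_iff using norm_ge_zero[of "imcurve v s"] by (simp add: power2_eq_1_iff)
  show "imcurve v 0 = qreal 1" by (simp add: imcurve_def normalizer_simps qreal_def)
  have "velocity (\<lambda>s. (1::real, s *\<^sub>R v)) (0, v)"
    by (auto intro!: derivative_eq_intros)
  from normalizer_scaleR_derivative[OF this, of "(norm v)\<^sup>2"]
  show "velocity (imcurve v) (0, v)"
    by (simp add: imcurve_def[abs_def])
qed

text \<open>For an off-diagonal skew-Hermitian X, the product of 1 + s X with its adjoint is a real
  multiple of the identity, so a scalar factor is enough to return to Sp(2). This fails for general
  X.\<close>

definition offcurve :: "quat \<Rightarrow> real \<Rightarrow> qmat" where
  "offcurve y s = normalizer ((norm y)\<^sup>2) s *\<^sub>R (qid + s *\<^sub>R lie (0, y, 0))"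

lemma offcurve: "offcurve y s \<in> Sp2" "offcurve y 0 = qid" "velocity (offcurve y) (lie (0, y, 0))"
proof -
  let ?n = "normalizer ((norm y)\<^sup>2) s"
  have n: "?n * (?n * (1 + s\<^sup>2 * (norm y)\<^sup>2)) = 1"
    using normalizer_simps(2)[of "(norm y)\<^sup>2" s] by (simp add: power2_eq_square mult.assoc)
  have "(qid + s *\<^sub>R lie (0, y, 0)) **\<^sub>H qadj (qid + s *\<^sub>R lie (0, y, 0)) = (1 + s\<^sup>2 * (norm y)\<^sup>2) *\<^sub>R qid"
    by (simp add: qm_eq_iff qmat_mul_nth qmul_distrib qmul_scaleR qcnj_scaleR qmul_minus qcnj_minus
        qmul_qcnj qcnj_qmul_self scaleR_qreal flip: zero_prod_def)
      (simp add: qreal_add[symmetric] scaleR_qreal power2_eq_square algebra_simps)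
  then show "offcurve y s \<in> Sp2"
    using n by (simp add: Sp2_def offcurve_def qmat_mul_scaleR
        linear_cmul[OF bounded_linear.linear[OF bounded_linear_qadj]])
  show "offcurve y 0 = qid" by (simp add: offcurve_def normalizer_simps)
  have "velocity (\<lambda>s. qid + s *\<^sub>R lie (0, y, 0)) (lie (0, y, 0))"
    by (auto intro!: derivative_eq_intros)
  from normalizer_scaleR_derivative[OF this, of "(norm y)\<^sup>2"]
  show "velocity (offcurve y) (lie (0, y, 0))"
    by (simp add: offcurve_def[abs_def])
qed

lemma bounded_linear_qdiag: "bounded_linear (\<lambda>q. qdiag q 0)" "bounded_linear (\<lambda>q. qdiag 0 q)"
  unfolding linear_conv_bounded_linear[symmetric] by (auto intro!: linearI simp: qm_eq_iff)

lemma qdiag_curve: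
  assumes "velocity u u'"
  shows "velocity (\<lambda>s. qdiag (u s) c) (qdiag u' 0)"
    "velocity (\<lambda>s. qdiag c (u s)) (qdiag 0 u')"
proof -
  have e: "qdiag (u s) c = qdiag (u s) 0 + qdiag 0 c" "qdiag c (u s) = qdiag 0 (u s) + qdiag c 0" for s
    by (simp_all add: qm_eq_iff)
  show "velocity (\<lambda>s. qdiag (u s) c) (qdiag u' 0)"
    "velocity (\<lambda>s. qdiag c (u s)) (qdiag 0 u')"
    unfolding e using linear_velocity[OF bounded_linear_qdiag(1) assms]
      linear_velocity[OF bounded_linear_qdiag(2) assms]
    by (auto intro!: derivative_eq_intros)
qed

lemma tangent_spaceI:
  "(\<And>s. \<gamma> s \<in> A) \<Longrightarrow> \<gamma> 0 = a \<Longrightarrow> velocity \<gamma> v \<Longrightarrow> v \<in> tangent_space A a"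
  unfolding tangent_space_def by blast

lemma tangent_spaceE:
  assumes "v \<in> tangent_space A a"
  obtains \<gamma> where "\<And>s. \<gamma> s \<in> A" "\<gamma> 0 = a" "velocity \<gamma> v"
  using assms unfolding tangent_space_def by blast

text \<open>Differentiating the defining equation and conjugating by Q gives the skew-Hermitian
  condition. Conversely x, y and z are realised separately by three curves through the identity,
  whose product has the sum of their velocities.\<close>

lemma tangent_space_Sp2:
  assumes Q: "Q \<in> Sp2" shows "tangent_space Sp2 Q = range (\<lambda>w. Q **\<^sub>H lie w)"
proof (intro equalityI subsetI)
  fix V assume "V \<in> tangent_space Sp2 Q"
  then obtain \<gamma> where \<gamma>: "\<And>s. \<gamma> s \<in> Sp2" "\<gamma> 0 = Q" "velocity \<gamma> V"
    by (rule tangent_spaceE) blast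
  have "velocity (\<lambda>s. \<gamma> s **\<^sub>H qadj (\<gamma> s)) (\<gamma> 0 **\<^sub>H qadj V + V **\<^sub>H qadj (\<gamma> 0))"
    by (rule qmat_mul_velocity[OF \<gamma>(3)
          linear_velocity[OF bounded_linear_qadj \<gamma>(3)]])
  then have "velocity (\<lambda>s. qid) (Q **\<^sub>H qadj V + V **\<^sub>H qadj Q)"
    using \<gamma>(1,2) by (simp add: Sp2_right)
  then have 0: "Q **\<^sub>H qadj V + V **\<^sub>H qadj Q = 0"
    using vector_derivative_unique_at[OF _ velocity_const] by blast
  have "qadj Q **\<^sub>H (Q **\<^sub>H qadj V + V **\<^sub>H qadj Q) **\<^sub>H Q = qadj V **\<^sub>H Q + qadj Q **\<^sub>H V"
    by (simp add: qmat_mul_add Q qmat_mul_assoc Sp2_left)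
  then have "qadj Q **\<^sub>H V + qadj (qadj Q **\<^sub>H V) = 0" by (simp add: 0 qadj_mul add.commute)
  then obtain w where "qadj Q **\<^sub>H V = lie w" unfolding lie_iff by blast
  then have "V = Q **\<^sub>H lie w" using Sp2_cancel(2)[OF Q, of V] by simp
  then show "V \<in> range (\<lambda>w. Q **\<^sub>H lie w)" by blast
next
  fix V assume "V \<in> range (\<lambda>w. Q **\<^sub>H lie w)"
  then obtain x y z where V: "V = Q **\<^sub>H lie (x, y, z)" by auto
  define \<gamma> where "\<gamma> s = Q **\<^sub>H (qdiag (imcurve x s) (qreal 1) **\<^sub>H (offcurve y s **\<^sub>H qdiag (qreal 1) (imcurve z s)))" for s
  have diag: "qdiag a b \<in> Sp2" if "a \<in> Sp1" "b \<in> Sp1" for a b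
    using that by (simp add: Sp2_def qadj_qdiag qdiag_mul qmul_qcnj Sp1_iff qid_def)
  show "V \<in> tangent_space Sp2 Q"
  proof (rule tangent_spaceI)
    show "\<gamma> s \<in> Sp2" for s
      unfolding \<gamma>_def by (intro Sp2_mul Q diag offcurve imcurve) (simp_all add: Sp1_iff)
    show "\<gamma> 0 = Q" by (simp add: \<gamma>_def imcurve offcurve flip: qid_def)
    have "velocity \<gamma> (Q **\<^sub>H (qid **\<^sub>H (qid **\<^sub>H qdiag 0 (0, z) + lie (0, y, 0) **\<^sub>H qid)
        + qdiag (0, x) 0 **\<^sub>H (qid **\<^sub>H qid)) + 0 **\<^sub>H (qid **\<^sub>H (qid **\<^sub>H qid)))"
      unfolding \<gamma>_def[abs_def]
      using qmat_mul_velocity[OF velocity_const[of Q]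
        qmat_mul_velocity[OF qdiag_curve(1)[OF imcurve(3)[of x], where c = "qreal 1"]
         qmat_mul_velocity[OF offcurve(3)[of y]
           qdiag_curve(2)[OF imcurve(3)[of z], where c = "qreal 1"]]]]
      by (simp add: imcurve offcurve flip: qid_def)
    moreover have "qdiag 0 (0, z) + lie (0, y, 0) + qdiag (0, x) 0 = lie (x, y, z)"
      by (simp add: qm_eq_iff zero_prod_def)
    ultimately show "velocity \<gamma> V" by (simp add: V)
  qed
qed

lemma unit_velocity:
  fixes \<gamma> :: "real \<Rightarrow> 'a::real_inner"
  assumes "velocity \<gamma> v" "\<And>s. norm (\<gamma> s) = 1" shows "\<gamma> 0 \<bullet> v = 0"
proof -
  have "velocity (\<lambda>s. \<gamma> s \<bullet> \<gamma> s) (\<gamma> 0 \<bullet> v + v \<bullet> \<gamma> 0)"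
    by (rule bounded_bilinear.has_vector_derivative[OF bounded_bilinear_inner assms(1) assms(1)])
  then have "velocity (\<lambda>s. 1::real) (\<gamma> 0 \<bullet> v + v \<bullet> \<gamma> 0)"
    using assms(2) by (simp add: dot_square_norm)
  then have "\<gamma> 0 \<bullet> v + v \<bullet> \<gamma> 0 = 0"
    using vector_derivative_unique_at[OF _ velocity_const] by blast
  then show ?thesis by (simp add: inner_commute)
qed

lemma tangent_space_S4:
  assumes t: "t \<in> S4" shows "tangent_space S4 t = {\<tau>. t \<bullet> \<tau> = 0}"
proof (intro equalityI subsetI)
  fix \<tau> assume "\<tau> \<in> tangent_space S4 t"
  then obtain \<gamma> where \<gamma>: "\<And>s. \<gamma> s \<in> S4" "\<gamma> 0 = t" "velocity \<gamma> \<tau>"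
    by (rule tangent_spaceE) blast
  then show "\<tau> \<in> {\<tau>. t \<bullet> \<tau> = 0}" using unit_velocity[OF \<gamma>(3)] by (simp add: S4_def)
next
  fix \<tau> assume \<tau>: "\<tau> \<in> {\<tau>. t \<bullet> \<tau> = 0}"
  define \<gamma> where "\<gamma> s = normalizer ((norm \<tau>)\<^sup>2) s *\<^sub>R (t + s *\<^sub>R \<tau>)" for s
  show "\<tau> \<in> tangent_space S4 t"
  proof (rule tangent_spaceI)
    have "(norm (t + s *\<^sub>R \<tau>))\<^sup>2 = 1 + s\<^sup>2 * (norm \<tau>)\<^sup>2" for s
    proof -
      have "t \<bullet> t = 1" "t \<bullet> \<tau> = 0" "\<tau> \<bullet> t = 0"
        using t \<tau> by (auto simp: S4_def norm_eq_1 inner_commute)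
      then show ?thesis
        unfolding power2_norm_eq_inner by (simp add: inner_add_left inner_add_right power2_eq_square del: dot_square_norm)
    qed
    then have "(norm (\<gamma> s))\<^sup>2 = 1" for s
      using normalizer_simps(2)[of "(norm \<tau>)\<^sup>2" s] by (simp add: \<gamma>_def power_mult_distrib)
    then have "norm (\<gamma> s) = 1" for s
      using norm_ge_zero[of "\<gamma> s"] by (metis norm_ge_zero one_power2 power2_eq_imp_eq zero_le_one)
    then show "\<gamma> s \<in> S4" for s by (simp add: S4_def)
    show "\<gamma> 0 = t" by (simp add: \<gamma>_def normalizer_simps)
    have "velocity (\<lambda>s. t + s *\<^sub>R \<tau>) \<tau>"
      by (auto intro!: derivative_eq_intros)
    from normalizer_scaleR_derivative[OF this, of "(norm \<tau>)\<^sup>2"]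
    show "velocity \<gamma> \<tau>"
      by (simp add: \<gamma>_def[abs_def])
  qed
qed

lemma tangent_space_Times:
  "tangent_space (A \<times> B) m = tangent_space A (fst m) \<times> tangent_space B (snd m)"
proof (intro equalityI subsetI)
  fix V assume "V \<in> tangent_space (A \<times> B) m"
  then obtain \<gamma> where \<gamma>: "\<And>s. \<gamma> s \<in> A \<times> B" "\<gamma> 0 = m" "velocity \<gamma> V"
    by (rule tangent_spaceE) blast
  have "fst V \<in> tangent_space A (fst m)" "snd V \<in> tangent_space B (snd m)"
    using \<gamma> linear_velocity[OF bounded_linear_fst \<gamma>(3)]
      linear_velocity[OF bounded_linear_snd \<gamma>(3)]
    by (auto intro!: tangent_spaceI[of "\<lambda>s. fst (\<gamma> s)"] tangent_spaceI[of "\<lambda>s. snd (\<gamma> s)"] simp: mem_Times_iff)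
  then show "V \<in> tangent_space A (fst m) \<times> tangent_space B (snd m)" by (simp add: mem_Times_iff)
next
  fix V assume V: "V \<in> tangent_space A (fst m) \<times> tangent_space B (snd m)"
  then have "fst V \<in> tangent_space A (fst m)" "snd V \<in> tangent_space B (snd m)"
    by (auto simp: mem_Times_iff)
  then obtain \<gamma> \<delta> where \<gamma>: "\<And>s. \<gamma> s \<in> A" "\<gamma> 0 = fst m" "velocity \<gamma> (fst V)"
    and \<delta>: "\<And>s. \<delta> s \<in> B" "\<delta> 0 = snd m" "velocity \<delta> (snd V)"
    by (elim tangent_spaceE) blast
  show "V \<in> tangent_space (A \<times> B) m"
    by (rule tangent_spaceI[of "\<lambda>s. (\<gamma> s, \<delta> s)"])
      (use \<gamma> \<delta> has_vector_derivative_Pair[OF \<gamma>(3) \<delta>(3)] in auto)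
qed

section \<open>Fibres and vertical vectors\<close>

text \<open>The fundamental vector field of the action for the imaginary quaternion v; the minus
  sign comes from the conjugate of p in the first component.\<close>

definition vert :: "m14 \<Rightarrow> real^3 \<Rightarrow> m14" where
  "vert m v = (fst m **\<^sub>H qdiag (0, - v) 0, (0, (0, v) *\<^sub>H snd (snd m)))"

text \<open>The coordinates \<open>t\<^sub>1\<close> and \<open>t\<^sub>2\<close> of a point \<open>m = (Q, (t\<^sub>1, t\<^sub>2))\<close>.\<close>

abbreviation ht :: "m14 \<Rightarrow> real" where
  "ht m \<equiv> fst (snd m)"

abbreviation hq :: "m14 \<Rightarrow> quat" where
  "hq m \<equiv> snd (snd m)"

lemma s3_act_eq: "s3_act p m = (fst m **\<^sub>H qdiag (qcnj p) (qreal 1), (ht m, p *\<^sub>H hq m))"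
  by (cases m) simp

lemma proj_s3: "m \<in> M14 \<Longrightarrow> \<pi> m = {s3_act p m |p. p \<in> Sp1}"
  unfolding proj_def s3_rel_def by blast

lemma proj_s3_act:
  assumes "m \<in> M14" "p \<in> Sp1" shows "\<pi> (s3_act p m) = \<pi> m"
proof -
  have "(m, s3_act p m) \<in> s3_rel" unfolding s3_rel_def using assms by blast
  then show ?thesis unfolding proj_def using equiv_class_eq[OF equiv_s3_rel] by metis
qed

lemma proj_eq_iff:
  assumes "m \<in> M14" "m' \<in> M14" shows "\<pi> m = \<pi> m' \<longleftrightarrow> (\<exists>p\<in>Sp1. m' = s3_act p m)"
proof -
  have "\<pi> m = \<pi> m' \<longleftrightarrow> (m, m') \<in> s3_rel"
    unfolding proj_def using eq_equiv_class_iff[OF equiv_s3_rel assms] .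
  then show ?thesis unfolding s3_rel_def using assms by blast
qed

lemma s3_act_derivative:
  assumes "velocity u u'"
  shows "velocity (\<lambda>s. s3_act (u s) m) (fst m **\<^sub>H qdiag (qcnj u') 0, (0, u' *\<^sub>H hq m))"
proof -
  have "velocity (\<lambda>s. fst m **\<^sub>H qdiag (qcnj (u s)) (qreal 1)) (fst m **\<^sub>H qdiag (qcnj u') 0)"
    using qmat_mul_velocity[OF velocity_const[of "fst m"]
      qdiag_curve(1)[OF linear_velocity[OF bounded_linear_qcnj assms]]] by simp
  moreover have "velocity (\<lambda>s. u s *\<^sub>H hq m) (u' *\<^sub>H hq m)"
    using bounded_bilinear.has_vector_derivative[OF bilinear_qmul assms velocity_const[of "hq m"]] by simp
  ultimately show ?thesis
    unfolding s3_act_eq by (intro has_vector_derivative_Pair velocity_const)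
qed

text \<open>A curve in the fibre has the form p(s) acting on m, with p at first not known to be
  differentiable. The linear map \<open>L\<close> reads p(s) off the (1,1) entry of the adjoint of Q
  times the first component, so p inherits a velocity, which is imaginary because p has unit
  length.\<close>

lemma tangent_space_fibre:
  assumes m: "m \<in> M14" shows "tangent_space (\<pi> m) m = range (vert m)"
proof (intro equalityI subsetI)
  fix V assume "V \<in> tangent_space (\<pi> m) m"
  then obtain \<gamma> where \<gamma>: "\<And>s. \<gamma> s \<in> \<pi> m" "\<gamma> 0 = m" "velocity \<gamma> V"
    by (rule tangent_spaceE) blast
  from \<gamma>(1) have "\<forall>s. \<exists>p. p \<in> Sp1 \<and> \<gamma> s = s3_act p m" unfolding proj_s3[OF m] by blast
  then obtain p where p: "\<And>s. p s \<in> Sp1" "\<And>s. \<gamma> s = s3_act (p s) m" by metis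
  have Q: "fst m \<in> Sp2" using m by (simp add: M14_def mem_Times_iff)
  define L :: "m14 \<Rightarrow> quat" where "L = (\<lambda>V. qcnj ((qadj (fst m) **\<^sub>H fst V) $ 1 $ 1))"
  have "bounded_linear L"
    unfolding L_def
    by (intro bounded_linear_compose[OF bounded_linear_qcnj] bounded_linear_compose[OF bounded_linear_vec_nth]
       bounded_linear_compose[OF bounded_bilinear.bounded_linear_right[OF bilinear_qmat_mul]] bounded_linear_fst)
  then have "velocity (\<lambda>s. L (\<gamma> s)) (L V)"
    using linear_velocity \<gamma>(3) by blast
  moreover have Lp: "L (\<gamma> s) = p s" for s
    by (simp add: p(2) L_def s3_act_eq Q)
  ultimately have p': "velocity p (L V)" by simp
  have p0: "p 0 = qreal 1" using Lp[of 0] by (simp add: L_def \<gamma>(2) Sp2_left[OF Q])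
  have "p 0 \<bullet> L V = 0" by (rule unit_velocity[OF p']) (use p(1) in \<open>simp add: Sp1_iff\<close>)
  then have "fst (L V) = 0" by (simp add: p0 inner_commute[of "qreal 1"] inner_qreal)
  then obtain v where LV: "L V = (0, v)" by (metis prod.collapse)
  have \<gamma>': "\<gamma> = (\<lambda>s. s3_act (p s) m)" by (rule ext) (rule p(2))
  have "V = (fst m **\<^sub>H qdiag (qcnj (0, v)) 0, (0, (0, v) *\<^sub>H hq m))"
    using vector_derivative_unique_at[OF \<gamma>(3)[unfolded \<gamma>'] s3_act_derivative[OF p'[unfolded LV], of m]] .
  then have "V = vert m v" by (simp add: vert_def qcnj_def)
  then show "V \<in> range (vert m)" by blast
next
  fix V assume "V \<in> range (vert m)"
  then obtain v where V: "V = vert m v" by blast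
  show "V \<in> tangent_space (\<pi> m) m"
  proof (rule tangent_spaceI)
    show "s3_act (imcurve v s) m \<in> \<pi> m" for s
      unfolding proj_s3[OF m] using imcurve(1) by blast
    show "s3_act (imcurve v 0) m = m" by (simp add: imcurve s3_act_one)
    show "velocity (\<lambda>s. s3_act (imcurve v s) m) V"
      using s3_act_derivative[OF imcurve(3)[of v], of m] by (simp add: V vert_def qcnj_def)
  qed
qed

lemma TM_eq:
  assumes m: "m \<in> M14"
  shows "TM m = {(fst m **\<^sub>H lie w, \<tau>) |w \<tau>. snd m \<bullet> \<tau> = 0}"
proof -
  have "range f \<times> {\<tau>. P \<tau>} = {(f w, \<tau>) |w \<tau>. P \<tau>}" for f :: "'a \<Rightarrow> 'b" and P :: "'c \<Rightarrow> bool"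
    by auto
  then show ?thesis
    using m by (simp only: M14_def mem_Times_iff tangent_space_Times tangent_space_Sp2 tangent_space_S4)
qed

lemma subspace_TM: "m \<in> M14 \<Longrightarrow> subspace (TM m)"
  and dim_TM: "m \<in> M14 \<Longrightarrow> dim (TM m) = 14"
proof -
  assume m: "m \<in> M14"
  have Q: "fst m \<in> Sp2" and t: "snd m \<in> S4" using m by (auto simp: M14_def mem_Times_iff)
  have lin: "linear (\<lambda>w. fst m **\<^sub>H lie w)"
    using bounded_linear_compose[OF bounded_bilinear.bounded_linear_right[OF bilinear_qmat_mul]
        linear_lie[unfolded linear_conv_bounded_linear]] bounded_linear.linear by blast
  have eq: "TM m = range (\<lambda>w. fst m **\<^sub>H lie w) \<times> {\<tau>. snd m \<bullet> \<tau> = 0}"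
    unfolding M14_def tangent_space_Times tangent_space_Sp2[OF Q] tangent_space_S4[OF t] ..
  have s: "subspace (range (\<lambda>w. fst m **\<^sub>H lie w))" "subspace {\<tau>. snd m \<bullet> \<tau> = 0}"
    using linear_subspace_image[OF lin subspace_UNIV] subspace_hyperplane by auto
  then show "subspace (TM m)" unfolding eq by (rule subspace_Times)
  have "inj (\<lambda>w. fst m **\<^sub>H lie w)"
  proof (rule injI)
    fix w w' assume "fst m **\<^sub>H lie w = fst m **\<^sub>H lie w'"
    then have "lie w = lie w'" using Sp2_cancel(1)[OF Q] by metis
    then show "w = w'" by (simp add: qm_eq_iff prod_eq_iff)
  qed
  then have "dim (range (\<lambda>w. fst m **\<^sub>H lie w)) = 10"
    using dim_image_eq[OF lin, of UNIV] by simp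
  moreover have "dim {\<tau>. snd m \<bullet> \<tau> = 0} = 4"
    using t by (subst dim_hyperplane) (auto simp: S4_def)
  ultimately show "dim (TM m) = 14"
    unfolding eq dim_Times[OF s] by simp
qed

lemma vert_TM: "m \<in> M14 \<Longrightarrow> vert m v \<in> TM m"
proof -
  assume m: "m \<in> M14"
  have 1: "qdiag (0, - v) 0 = lie (- v, 0, 0)" by (simp add: qm_eq_iff zero_prod_def qcnj_def)
  have 2: "snd m \<bullet> (0, (0, v) *\<^sub>H hq m) = 0"
  proof -
    obtain Q t1 t2 where m': "m = (Q, (t1, t2))" by (metis prod.exhaust)
    have "t2 \<bullet> ((0, v) *\<^sub>H t2) = 0"
      using inner_qmul_right[of "(0, v)" t2 t2] by (simp add: inner_commute[of t2] qmul_qcnj inner_qreal)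
    then show ?thesis by (simp add: m')
  qed
  show ?thesis unfolding TM_eq[OF m] vert_def 1 using 2 by blast
qed


section \<open>The metric on \<open>Sp(2) \<times> S\<^sup>4\<close>\<close>

lemma linear_s3_act: "linear (s3_act p)"
  by (rule linearI) (simp_all add: s3_act_eq qmat_mul_add qmat_mul_scaleR qmul_distrib qmul_scaleR)

lemmas bounded_linear_s3_act = linear_s3_act[unfolded linear_conv_bounded_linear]

lemma tangent_space_image:
  assumes L: "bounded_linear L" and "L ` A \<subseteq> B" "V \<in> tangent_space A a"
  shows "L V \<in> tangent_space B (L a)"
proof -
  obtain \<gamma> where \<gamma>: "\<And>s. \<gamma> s \<in> A" "\<gamma> 0 = a" "velocity \<gamma> V"
    using assms(3) by (rule tangent_spaceE) blast
  show ?thesis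
    by (rule tangent_spaceI[of "\<lambda>s. L (\<gamma> s)"])
      (use assms(2) \<gamma> linear_velocity[OF L \<gamma>(3)] in auto)
qed

lemma TM_s3_act:
  assumes "p \<in> Sp1" "V \<in> TM m" shows "s3_act p V \<in> TM (s3_act p m)"
proof -
  have "s3_act p ` M14 \<subseteq> M14" using s3_act_M14[OF assms(1)] by blast
  then show ?thesis
    by (rule tangent_space_image[OF bounded_linear_s3_act _ assms(2)])
qed

lemma Sp2_metric_lie:
  assumes "Q \<in> Sp2"
  shows "Sp2_metric r1 r2 Q (Q **\<^sub>H lie w) (Q **\<^sub>H lie w')
     = r1 / 2 * (fst w \<bullet> fst w') + fst (snd w) \<bullet> fst (snd w') + r2 / 2 * (snd (snd w) \<bullet> snd (snd w'))"
  by (simp add: Sp2_metric_def assms inner_prod_def)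

lemma M14_metric_commute: "M14_metric r1 r2 m V W = M14_metric r1 r2 m W V"
  by (simp add: M14_metric_def Sp2_metric_def Let_def inner_commute)

lemma linear_M14_metric: "linear (M14_metric r1 r2 m V)"
  by (rule linearI)
    (simp_all add: M14_metric_def Sp2_metric_def Let_def qmat_mul_add qmat_mul_scaleR inner_add_right algebra_simps add_divide_distrib
      del: inner_real_def)

text \<open>The adjoint of Q times V is conjugated by diag(p, 1): x becomes p x cnj p, y becomes p y
  and z is fixed, while the quaternion part of the sphere vector is multiplied by p. All of these
  are rotations.\<close>

lemma M14_metric_s3_act:
  assumes p: "p \<in> Sp1"
  shows "M14_metric r1 r2 (s3_act p m) (s3_act p V) (s3_act p W) = M14_metric r1 r2 m V W"
proof -
  have rot: "(p *\<^sub>H a) \<bullet> (p *\<^sub>H b) = a \<bullet> b" "(a *\<^sub>H qcnj p) \<bullet> (b *\<^sub>H qcnj p) = a \<bullet> b" for a b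
  proof -
    have "(p *\<^sub>H a) \<bullet> (p *\<^sub>H b) = a \<bullet> ((qcnj p *\<^sub>H p) *\<^sub>H b)"
      by (simp only: inner_qmul_left qmul_assoc)
    moreover have "(a *\<^sub>H qcnj p) \<bullet> (b *\<^sub>H qcnj p) = a \<bullet> (b *\<^sub>H (qcnj p *\<^sub>H p))"
      by (simp only: inner_qmul_right qmul_assoc qcnj_simps)
    ultimately show "(p *\<^sub>H a) \<bullet> (p *\<^sub>H b) = a \<bullet> b" "(a *\<^sub>H qcnj p) \<bullet> (b *\<^sub>H qcnj p) = a \<bullet> b"
      using p by (simp_all add: qcnj_qmul_self Sp1_iff)
  qed
  have X: "qadj (fst (s3_act p m)) **\<^sub>H fst (s3_act p V)
    = qdiag p (qreal 1) **\<^sub>H (qadj (fst m) **\<^sub>H fst V) **\<^sub>H qdiag (qcnj p) (qreal 1)" for V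
    by (simp add: s3_act_eq qadj_mul qadj_qdiag qmat_mul_assoc)
  show ?thesis
    unfolding M14_metric_def Sp2_metric_def Let_def X
    by (simp add: qmat_mul_nth rot s3_act_eq inner_prod_def[of "snd _"] inner_Pair qmul_assoc)
qed

text \<open>Chosen so that its inner product with v is the metric product with
  \<open>vert m v\<close>; its zeros are therefore the horizontal vectors. Divided by
  \<open>fibre_norm\<close> it plays the role of the connection form of the submersion.\<close>

definition moment :: "real \<Rightarrow> m14 \<Rightarrow> m14 \<Rightarrow> real^3" where
  "moment r1 m V = snd (snd (snd V) *\<^sub>H qcnj (hq m) - (r1 / 2) *\<^sub>R ((qadj (fst m) **\<^sub>H fst V) $ 1 $ 1))"

text \<open>The squared length of \<open>vert m v\<close> for every unit v. Since it does not depend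
  on v, the horizontal projection \<open>hor\<close> is a plain formula.\<close>

definition fibre_norm :: "real \<Rightarrow> m14 \<Rightarrow> real" where
  "fibre_norm r1 m = r1 / 2 + (norm (hq m))\<^sup>2"

definition hor :: "real \<Rightarrow> m14 \<Rightarrow> m14 \<Rightarrow> m14" where
  "hor r1 m V = V - vert m (inverse (fibre_norm r1 m) *\<^sub>R moment r1 m V)"

lemma M14_metric_vert:
  assumes m: "m \<in> M14" shows "M14_metric r1 r2 m V (vert m v) = moment r1 m V \<bullet> v"
proof -
  have Q: "fst m \<in> Sp2" using m by (simp add: M14_def mem_Times_iff)
  have 1: "snd (snd V) \<bullet> ((0, v) *\<^sub>H hq m) = snd (snd (snd V) *\<^sub>H qcnj (hq m)) \<bullet> v"
    using inner_qmul_right[of "(0, v)" "hq m" "snd (snd V)"]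
    by (simp add: inner_commute[of "snd (snd V)"] inner_imaginary inner_commute[of v])
  have 2: "(qadj (fst m) **\<^sub>H fst V) $ 1 $ 1 \<bullet> (0, - v) = - (snd ((qadj (fst m) **\<^sub>H fst V) $ 1 $ 1) \<bullet> v)"
    by (simp add: inner_imaginary)
  have 3: "snd V \<bullet> (0, q) = snd (snd V) \<bullet> q" for q
    by (simp add: inner_prod_def[of "snd V"])
  show ?thesis
    unfolding M14_metric_def Sp2_metric_def Let_def vert_def fst_conv snd_conv Sp2_cancel(1)[OF Q] 3 1 moment_def
    by (simp add: 2 inner_diff_left)
qed

lemma moment_vert:
  assumes m: "m \<in> M14" shows "moment r1 m (vert m v) = fibre_norm r1 m *\<^sub>R v"
proof -
  have Q: "fst m \<in> Sp2" using m by (simp add: M14_def mem_Times_iff)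
  show ?thesis
    by (simp add: moment_def vert_def Q qmul_assoc qmul_qcnj qreal_mul fibre_norm_def algebra_simps)
qed

lemma linear_moment: "linear (moment r1 m)"
  by (rule linearI) (simp_all add: moment_def qmat_mul_add qmat_mul_scaleR qmul_distrib qmul_scaleR algebra_simps)

text \<open>The quaternion whose imaginary part is the moment gets conjugated by p, and conjugation
  keeps real quaternions real.\<close>

lemma moment_s3_act:
  assumes p: "p \<in> Sp1" and 0: "moment r1 m V = 0" shows "moment r1 (s3_act p m) (s3_act p V) = 0"
proof -
  let ?q = "snd (snd V) *\<^sub>H qcnj (hq m) - (r1 / 2) *\<^sub>R ((qadj (fst m) **\<^sub>H fst V) $ 1 $ 1)"
  have "?q = qreal (fst ?q)" using 0 by (simp add: moment_def qreal_def prod_eq_iff)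
  moreover have "moment r1 (s3_act p m) (s3_act p V) = snd (p *\<^sub>H ?q *\<^sub>H qcnj p)"
    by (simp add: moment_def s3_act_eq qadj_mul qadj_qdiag qmat_mul_assoc[symmetric] qmat_mul_nth qcnj_qmul
        bounded_bilinear.diff_left[OF bilinear_qmul] bounded_bilinear.diff_right[OF bilinear_qmul]
        qmul_scaleR qmul_assoc qmul_distrib)
  moreover have "snd (p *\<^sub>H qreal a *\<^sub>H qcnj p) = 0" for a
    by (simp add: qreal_mul qmul_scaleR qmul_qcnj) (simp add: qreal_def)
  ultimately show ?thesis by metis
qed

lemma horizontal_iff:
  assumes m: "m \<in> M14"
  shows "V \<in> horizontal M14 s3_rel (M14_metric r1 r2) m \<longleftrightarrow> V \<in> TM m \<and> moment r1 m V = 0"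
  unfolding horizontal_def tangent_space_fibre[OF m]
  by (auto simp: M14_metric_vert[OF m] inner_eq_zero_iff dest: spec[of _ "moment r1 m V"])

section \<open>Velocities of curves under smooth maps\<close>

lemma eventually_curve:
  assumes "open W" "\<gamma> 0 \<in> W" "velocity \<gamma> V"
  shows "\<forall>\<^sub>F r in at 0. \<gamma> r \<in> W"
  using has_vector_derivative_continuous[OF assms(3)] assms(1,2) unfolding continuous_at tendsto_def by blast

lemma frechet_curve:
  assumes g: "Ck_on (Suc 0) g W" "open W" and \<gamma>: "\<gamma> 0 \<in> W" "velocity \<gamma> v"
  shows "velocity (\<lambda>r. g (\<gamma> r)) (fder g (\<gamma> 0) v)"
proof -
  note D = Ck_on_D[OF g \<gamma>(1)]
  from has_derivative_compose[OF \<gamma>(2)[unfolded has_vector_derivative_def] D] show ?thesis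
    unfolding has_vector_derivative_def linear_cmul[OF has_derivative_linear[OF D]] .
qed

lemma velocity_eventually:
  assumes "(f has_vector_derivative v) (at x)" "\<forall>\<^sub>F r in at x. f r = g r" "f x = g x"
  shows "(g has_vector_derivative v) (at x)"
  using assms unfolding has_vector_derivative_def by (auto intro: has_derivative_transform_eventually)

lemma section_tangent:
  fixes s :: "real^'n \<Rightarrow> 'a::euclidean_space"
  assumes V: "open V" "y \<in> V" and s: "Ck_on (Suc 0) s V" "\<And>x. x \<in> V \<Longrightarrow> s x \<in> A"
  shows "fder s y v \<in> tangent_space A (s y)"
proof (rule tangent_spaceI)
  \<comment> \<open>\<open>tangent_space\<close> asks for a curve staying in A at all times, so
    outside V the line is replaced by a constant; only the behaviour near 0 matters.\<close>
  define \<gamma> where "\<gamma> r = (if y + r *\<^sub>R v \<in> V then s (y + r *\<^sub>R v) else s y)" for r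
  show "\<gamma> r \<in> A" for r using s(2) V(2) by (simp add: \<gamma>_def)
  show "\<gamma> 0 = s y" by (simp add: \<gamma>_def)
  have line: "velocity (\<lambda>r. y + r *\<^sub>R v) v"
    by (auto intro!: derivative_eq_intros)
  have "\<forall>\<^sub>F r in at 0. s (y + r *\<^sub>R v) = \<gamma> r"
    using eventually_curve[OF V(1) _ line] V(2) by (simp add: \<gamma>_def eventually_mono)
  with frechet_curve[OF s(1) V(1) _ line] V(2)
  show "velocity \<gamma> (fder s y v)"
    by (auto intro: velocity_eventually simp: \<gamma>_def)
qed

locale berger =
  fixes r1 r2 :: real
  assumes r1_pos: "r1 > 0" and r2_pos: "r2 > 0"
begin

abbreviation "met \<equiv> M14_metric r1 r2"
abbreviation "Hor \<equiv> horizontal M14 s3_rel met"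
abbreviation "Charts \<equiv> quotient_charts M14 s3_rel :: (m14 set, 11) chart set"
abbreviation "dpr \<equiv> dproj M14 s3_rel :: (m14 set, 11) chart \<Rightarrow> _"

lemma fibre_norm_pos: "fibre_norm r1 m > 0"
  using r1_pos by (simp add: fibre_norm_def add_pos_nonneg)

lemma hor_Hor:
  assumes m: "m \<in> M14" and V: "V \<in> TM m" shows "hor r1 m V \<in> Hor m"
proof -
  have "hor r1 m V \<in> TM m"
    unfolding hor_def using subspace_TM[OF m] V vert_TM[OF m] by (intro subspace_diff)
  moreover have "moment r1 m (hor r1 m V) = 0"
    unfolding hor_def linear_diff[OF linear_moment] moment_vert[OF m] using fibre_norm_pos[of m] by simp
  ultimately show ?thesis by (simp add: horizontal_iff m)
qed

text \<open>Removing the three mutually orthogonal vertical directions subtracts the product of the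
  moments over the common squared length. This evaluates the quotient metric on arbitrary lifts,
  horizontal or not.\<close>

lemma metric_hor:
  assumes m: "m \<in> M14"
  shows "met m (hor r1 m V) (hor r1 m W) = met m V W - moment r1 m V \<bullet> moment r1 m W / fibre_norm r1 m"
proof -
  have d: "met m A (B - C) = met m A B - met m A C" "met m (B - C) A = met m B A - met m C A" for A B C
    using linear_diff[OF linear_M14_metric] M14_metric_commute by metis+
  have v: "met m (vert m v) A = moment r1 m A \<bullet> v" for A v
    using M14_metric_vert[OF m] M14_metric_commute by metis
  show ?thesis
    using fibre_norm_pos[of m]
    by (simp add: hor_def d v M14_metric_vert[OF m] linear_diff[OF linear_moment] moment_vert[OF m]
        inner_diff_left inner_diff_right divide_inverse inner_commute)
qed

lemma metric_pos:
  assumes m: "m \<in> M14" and V: "V \<in> TM m" and "V \<noteq> 0" shows "met m V V > 0"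
proof -
  have Q: "fst m \<in> Sp2" using m by (simp add: M14_def mem_Times_iff)
  obtain w \<tau> where V': "V = (fst m **\<^sub>H lie w, \<tau>)" using V unfolding TM_eq[OF m] by blast
  let ?a = "r1 / 2 * (fst w \<bullet> fst w)" and ?b = "fst (snd w) \<bullet> fst (snd w)"
    and ?c = "r2 / 2 * (snd (snd w) \<bullet> snd (snd w))" and ?d = "\<tau> \<bullet> \<tau>"
  have "w \<noteq> 0 \<or> \<tau> \<noteq> 0"
    using \<open>V \<noteq> 0\<close> linear_0[OF linear_lie] by (auto simp: V' zero_prod_def[symmetric])
  moreover have eq: "met m V V = ?a + ?b + ?c + ?d"
    by (simp add: M14_metric_def V' Sp2_metric_lie[OF Q])
  moreover have "0 \<le> ?a" "0 \<le> ?b" "0 \<le> ?c" "0 \<le> ?d"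
    using r1_pos r2_pos by simp_all
  moreover have "0 < ?a \<or> 0 < ?b \<or> 0 < ?c \<or> 0 < ?d"
    using calculation(1) r1_pos r2_pos by (auto simp: prod_eq_iff)
  ultimately show ?thesis by linarith
qed

lemma Hor_s3_act:
  assumes "m \<in> M14" "p \<in> Sp1" "V \<in> Hor m" shows "s3_act p V \<in> Hor (s3_act p m)"
  using assms by (simp add: horizontal_iff s3_act_M14 moment_s3_act TM_s3_act)

lemma subspace_Hor: "m \<in> M14 \<Longrightarrow> subspace (Hor m)"
  using subspace_TM[of m] linear_moment[of r1 m]
  by (auto simp: subspace_def horizontal_iff linear_0 linear_add linear_cmul)


section \<open>Charts of the quotient\<close>

definition chart_dom :: "(m14 set, 11) chart \<Rightarrow> m14 set" where
  "chart_dom c = {m \<in> M14. \<pi> m \<in> fst c}"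

definition crd :: "(m14 set, 11) chart \<Rightarrow> m14 \<Rightarrow> real^11" where
  "crd c = snd c \<circ> \<pi>"

lemma dom_M14: "m \<in> chart_dom c \<Longrightarrow> m \<in> M14"
  by (simp add: chart_dom_def)

lemma Charts_iff:
  "c \<in> Charts \<longleftrightarrow> fst c \<subseteq> M14 // s3_rel \<and> openin (top_of_set M14) (chart_dom c) \<and> inj_on (snd c) (fst c) \<and>
     open (snd c ` fst c) \<and> smooth_on (chart_dom c) (crd c) \<and> (\<forall>m\<in>chart_dom c. dpr c m ` TM m = UNIV)"
  unfolding quotient_charts_def chart_dom_def crd_def by (cases c) (simp add: Let_def)

lemma Charts_image:
  assumes "c \<in> Charts" shows "snd c ` fst c = crd c ` chart_dom c"
proof -
  have "fst c = \<pi> ` chart_dom c"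
    using assms unfolding Charts_iff chart_dom_def proj_def by (auto simp: quotient_def)
  then show ?thesis by (simp add: crd_def image_comp)
qed

text \<open>Exactly what is needed to differentiate coordinates along curves. It is separated from
  membership in the atlas because the submersion condition for the explicit charts is itself proved
  with these derivative rules.\<close>

definition prechart :: "(m14 set, 11) chart \<Rightarrow> bool" where
  "prechart c \<longleftrightarrow> openin (top_of_set M14) (chart_dom c) \<and> smooth_on (chart_dom c) (crd c)"

lemma Charts_prechart: "c \<in> Charts \<Longrightarrow> prechart c"
  by (simp add: Charts_iff prechart_def)

lemma crd_extension:
  assumes c: "prechart c" and m: "m \<in> chart_dom c"
  obtains W g where "open W" "m \<in> W" "\<And>k. Ck_on k g W" "\<And>x. x \<in> M14 \<inter> W \<Longrightarrow> x \<in> chart_dom c \<and> g x = crd c x"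
proof -
  obtain W g where W: "open W" "m \<in> W" "\<forall>k. Ck_on k g W" "\<forall>x\<in>chart_dom c \<inter> W. g x = crd c x"
    using c m unfolding prechart_def smooth_on_def by blast
  obtain T where T: "open T" "chart_dom c = M14 \<inter> T" using c unfolding prechart_def openin_open by blast
  show ?thesis
    by (rule that[of "W \<inter> T" g]) (use W T m Ck_on_subset[OF W(3)[rule_format], of "W \<inter> T"] in auto)
qed

lemma crd_derivative:
  assumes c: "prechart c" and m: "m \<in> chart_dom c"
  shows "(crd c has_derivative dpr c m) (at m within M14)"
proof -
  obtain W g where W: "open W" "m \<in> W" "\<And>k. Ck_on k g W" "\<And>x. x \<in> M14 \<inter> W \<Longrightarrow> x \<in> chart_dom c \<and> g x = crd c x"
    by (rule crd_extension[OF assms]) blast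
  have "(g has_derivative fder g m) (at m within M14)"
    using Ck_on_D[OF W(3) W(1,2)] has_derivative_at_withinI by blast
  moreover have "\<forall>\<^sub>F x in at m within M14. g x = crd c x"
    unfolding eventually_at_topological using W by auto
  moreover have "g m = crd c m" using W(2,4) m dom_M14 by auto
  ultimately have "(crd c has_derivative fder g m) (at m within M14)"
    by (rule has_derivative_transform_eventually) (use m dom_M14 in auto)
  \<comment> \<open>A derivative within \<open>M14\<close> is not unique off the tangent space;
    \<open>dproj\<close> is one choice, and existence of some derivative is enough for that choice
    to be one.\<close>
  then show ?thesis
    unfolding dproj_def crd_def[symmetric] using frechet_derivative_works differentiableI by blast
qed

lemma linear_dpr: "prechart c \<Longrightarrow> m \<in> chart_dom c \<Longrightarrow> linear (dpr c m)"
  using crd_derivative has_derivative_linear by blast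

lemma dpr_curve:
  assumes c: "prechart c" and m: "m \<in> chart_dom c" and \<gamma>: "\<And>s. \<gamma> s \<in> M14" "\<gamma> 0 = m" "velocity \<gamma> V"
  shows "velocity (\<lambda>s. crd c (\<gamma> s)) (dpr c m V)"
proof -
  have "(crd c has_derivative dpr c m) (at (\<gamma> 0) within range \<gamma>)"
    using has_derivative_subset[OF crd_derivative[OF c m], of "range \<gamma>"] \<gamma>(1,2) by (simp add: image_subset_iff)
  from has_derivative_in_compose[OF \<gamma>(3)[unfolded has_vector_derivative_def] this]
  have "((\<lambda>s. crd c (\<gamma> s)) has_derivative (\<lambda>s. dpr c m (s *\<^sub>R V))) (at 0)" .
  then show ?thesis
    unfolding has_vector_derivative_def linear_cmul[OF linear_dpr[OF c m]] .
qed

lemma section_derivative: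
  fixes s :: "real^'n \<Rightarrow> m14"
  assumes c: "prechart c" and V: "open V" "y \<in> V"
    and s: "Ck_on (Suc 0) s V" "\<And>x. x \<in> V \<Longrightarrow> s x \<in> M14" "s y \<in> chart_dom c"
  shows "((\<lambda>x. crd c (s x)) has_derivative (\<lambda>v. dpr c (s y) (fder s y v))) (at y)"
proof -
  have "(s has_derivative fder s y) (at y within V)"
    by (rule has_derivative_at_withinI[OF Ck_on_D[OF s(1) V]])
  moreover have "(crd c has_derivative dpr c (s y)) (at (s y) within s ` V)"
    by (rule has_derivative_subset[OF crd_derivative[OF c s(3)]]) (use s(2) in auto)
  ultimately have "((\<lambda>x. crd c (s x)) has_derivative (\<lambda>v. dpr c (s y) (fder s y v))) (at y within V)"
    by (rule has_derivative_in_compose)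
  then show ?thesis unfolding at_within_open[OF V(2,1)] .
qed

text \<open>Differentiate the identity crd c (s x) = x on the open set V.\<close>

lemma section_dpr:
  fixes s :: "real^11 \<Rightarrow> m14"
  assumes c: "prechart c" and V: "open V" "y \<in> V"
    and s: "Ck_on (Suc 0) s V" "\<And>x. x \<in> V \<Longrightarrow> s x \<in> M14" "s y \<in> chart_dom c" "\<And>x. x \<in> V \<Longrightarrow> crd c (s x) = x"
  shows "dpr c (s y) (fder s y v) = v"
proof -
  have "((\<lambda>x. x) has_derivative (\<lambda>v. dpr c (s y) (fder s y v))) (at y)"
    by (rule has_derivative_transform_within_open[OF section_derivative[OF c V s(1-3)] V]) (simp_all add: s(4))
  then have "(\<lambda>v. dpr c (s y) (fder s y v)) = (\<lambda>v. v)"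
    using has_derivative_unique[OF _ has_derivative_ident] by blast
  then show ?thesis by (rule fun_cong)
qed

lemmas chart_dpr_curve = dpr_curve[OF Charts_prechart]
  and chart_linear_dpr = linear_dpr[OF Charts_prechart]
  and chart_crd_extension = crd_extension[OF Charts_prechart]

text \<open>Both sides compute the velocity of the same coordinate curve, hence agree on tangent
  vectors although they may differ elsewhere.\<close>

lemma dpr_extension:
  assumes c: "c \<in> Charts" and W: "open W" "Ck_on (Suc 0) g W" "\<And>x. x \<in> M14 \<inter> W \<Longrightarrow> x \<in> chart_dom c \<and> g x = crd c x"
    and m: "m \<in> M14" "m \<in> W" and V: "V \<in> TM m"
  shows "dpr c m V = fder g m V"
proof -
  obtain \<gamma> where \<gamma>: "\<And>s. \<gamma> s \<in> M14" "\<gamma> 0 = m" "velocity \<gamma> V"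
    using V by (rule tangent_spaceE) blast
  have ev: "\<forall>\<^sub>F s in at 0. g (\<gamma> s) = crd c (\<gamma> s)"
    using eventually_curve[OF W(1) _ \<gamma>(3)] m(2) \<gamma>(1,2) W(3) by (simp add: eventually_mono)
  have "velocity (\<lambda>s. crd c (\<gamma> s)) (fder g m V)"
    using velocity_eventually[OF frechet_curve[OF W(2,1) _ \<gamma>(3)] ev] m W(3) \<gamma>(2) by simp
  moreover have "m \<in> chart_dom c" using W(3) m by auto
  ultimately show ?thesis
    using chart_dpr_curve[OF c _ \<gamma>] vector_derivative_unique_at by blast
qed

lemma dpr_vert:
  assumes c: "c \<in> Charts" and m: "m \<in> chart_dom c" shows "dpr c m (vert m v) = 0"
proof -
  note mM = dom_M14[OF m]
  have "vert m v \<in> tangent_space (\<pi> m) m" using tangent_space_fibre[OF mM] by blast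
  then obtain \<gamma> where \<gamma>: "\<And>s. \<gamma> s \<in> \<pi> m" "\<gamma> 0 = m" "velocity \<gamma> (vert m v)"
    by (rule tangent_spaceE) blast
  have "\<gamma> s \<in> M14" "crd c (\<gamma> s) = crd c m" for s
  proof -
    obtain p where p: "p \<in> Sp1" "\<gamma> s = s3_act p m" using \<gamma>(1)[of s] unfolding proj_s3[OF mM] by blast
    show "\<gamma> s \<in> M14" "crd c (\<gamma> s) = crd c m"
      using proj_s3_act[OF mM p(1)] s3_act_M14[OF p(1) mM] by (simp_all add: p(2) crd_def)
  qed
  then have "velocity (\<lambda>s. crd c m) (dpr c m (vert m v))"
    using chart_dpr_curve[OF c m _ \<gamma>(2,3)] by simp
  then show ?thesis using vector_derivative_unique_at[OF _ velocity_const] by blast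
qed

lemma dpr_hor:
  assumes c: "c \<in> Charts" and m: "m \<in> chart_dom c" shows "dpr c m (hor r1 m V) = dpr c m V"
  unfolding hor_def linear_diff[OF chart_linear_dpr[OF c m]] dpr_vert[OF assms] by simp

lemma dpr_surj:
  assumes c: "c \<in> Charts" and m: "m \<in> chart_dom c"
  obtains V where "V \<in> TM m" "dpr c m V = v"
proof -
  have "\<forall>m\<in>chart_dom c. dpr c m ` TM m = UNIV"
    using c[unfolded Charts_iff] by (elim conjE)
  from bspec[OF this m] have "v \<in> dpr c m ` TM m" by (simp only: UNIV_I)
  then show ?thesis using that by blast
qed

text \<open>Dimension count: \<open>14 = 11 + 3\<close>.\<close>

lemma dpr_moment_inj:
  assumes c: "c \<in> Charts" and m: "m \<in> chart_dom c"
  shows "inj_on (\<lambda>V. (dpr c m V, moment r1 m V)) (TM m)"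
proof -
  note mM = dom_M14[OF m]
  let ?T = "TM m"
  let ?\<Phi> = "\<lambda>V. (dpr c m V, moment r1 m V)"
  note lin = chart_linear_dpr[OF c m] linear_moment[of r1 m]
  have lin\<Phi>: "linear ?\<Phi>"
    by (rule linearI) (simp_all add: linear_add[OF lin(1)] linear_add[OF lin(2)] linear_cmul[OF lin(1)] linear_cmul[OF lin(2)])
  have surj: "\<exists>V\<in>?T. ?\<Phi> V = (a, b)" for a b
  proof -
    obtain V where V: "V \<in> ?T" "dpr c m V = a" by (rule dpr_surj[OF c m])
    \<comment> \<open>The vertical correction adjusts the moment to b and is invisible to
      \<open>dpr\<close>.\<close>
    define v where "v = inverse (fibre_norm r1 m) *\<^sub>R (b - moment r1 m V)"
    have "V + vert m v \<in> ?T"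
      using subspace_add[OF subspace_TM[OF mM] V(1) vert_TM[OF mM]] .
    moreover have "?\<Phi> (V + vert m v) = (a, b)"
      unfolding linear_add[OF lin(1)] linear_add[OF lin(2)] dpr_vert[OF c m] moment_vert[OF mM]
      using fibre_norm_pos[of m] V(2) by (simp add: v_def)
    ultimately show ?thesis by blast
  qed
  have "dim (UNIV :: ((real^11) \<times> (real^3)) set) = dim ?T"
    by (simp add: dim_TM[OF mM])
  \<comment> \<open>Parametrising the tangent space by the target space makes the map an
    endomorphism, for which surjectivity implies injectivity.\<close>
  then obtain \<psi> :: "(real^11) \<times> (real^3) \<Rightarrow> m14" where \<psi>: "linear \<psi>" "\<psi> ` UNIV = ?T" "inj_on \<psi> UNIV"
    using subspace_isomorphism[OF subspace_UNIV subspace_TM[OF mM]] by blast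
  have "linear (?\<Phi> \<circ> \<psi>)" using linear_compose[OF \<psi>(1) lin\<Phi>] .
  moreover have "surj (?\<Phi> \<circ> \<psi>)"
    unfolding surj_def
  proof
    fix ab :: "(real^11) \<times> (real^3)"
    obtain V where "V \<in> ?T" "?\<Phi> V = ab" using surj by (metis prod.collapse)
    then have "V \<in> range \<psi>" using \<psi>(2) by simp
    then obtain x where "V = \<psi> x" by blast
    then have "ab = (?\<Phi> \<circ> \<psi>) x" using \<open>?\<Phi> V = ab\<close> by simp
    then show "\<exists>x. ab = (?\<Phi> \<circ> \<psi>) x" ..
  qed
  ultimately have "inj (?\<Phi> \<circ> \<psi>)" by (rule linear_surj_imp_inj)
  then have "inj_on ?\<Phi> (\<psi> ` UNIV)" by (rule inj_on_imageI)
  then show ?thesis unfolding \<psi>(2) .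
qed

lemma dpr_inj_Hor:
  assumes "c \<in> Charts" "m \<in> chart_dom c" "V \<in> Hor m" "W \<in> Hor m" "dpr c m V = dpr c m W"
  shows "V = W"
  using inj_onD[OF dpr_moment_inj[OF assms(1,2)], of V W] assms(3-5) by (simp add: horizontal_iff dom_M14[OF assms(2)])

lemma dpr_surj_Hor:
  assumes c: "c \<in> Charts" and m: "m \<in> chart_dom c" obtains V where "V \<in> Hor m" "dpr c m V = v"
proof -
  obtain V where V: "V \<in> TM m" "dpr c m V = v" by (rule dpr_surj[OF c m])
  show ?thesis
    by (rule that[of "hor r1 m V"]) (use V dpr_hor[OF c m] hor_Hor[OF dom_M14[OF m]] in auto)
qed

lemma crd_s3_act: "m \<in> M14 \<Longrightarrow> p \<in> Sp1 \<Longrightarrow> crd c (s3_act p m) = crd c m"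
  by (simp add: crd_def proj_s3_act)

lemma dom_s3_act: "m \<in> chart_dom c \<Longrightarrow> p \<in> Sp1 \<Longrightarrow> s3_act p m \<in> chart_dom c"
  by (simp add: chart_dom_def proj_s3_act s3_act_M14)

lemma crd_eqD:
  assumes "c \<in> Charts" "m \<in> chart_dom c" "m' \<in> chart_dom c" "crd c m = crd c m'"
  obtains p where "p \<in> Sp1" "m' = s3_act p m"
proof -
  have "inj_on (snd c) (fst c)" using assms(1) by (simp add: Charts_iff)
  then have "\<pi> m = \<pi> m'" using assms(2-4) unfolding chart_dom_def crd_def by (auto dest: inj_onD)
  then show ?thesis using proj_eq_iff[OF dom_M14 dom_M14] assms that by blast
qed

lemma dpr_s3_act:
  assumes c: "c \<in> Charts" and m: "m \<in> chart_dom c" and p: "p \<in> Sp1" and V: "V \<in> TM m"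
  shows "dpr c (s3_act p m) (s3_act p V) = dpr c m V"
proof -
  obtain \<gamma> where \<gamma>: "\<And>s. \<gamma> s \<in> M14" "\<gamma> 0 = m" "velocity \<gamma> V"
    using V by (rule tangent_spaceE) blast
  have "velocity (\<lambda>s. s3_act p (\<gamma> s)) (s3_act p V)"
    using linear_velocity[OF bounded_linear_s3_act \<gamma>(3)] .
  from chart_dpr_curve[OF c dom_s3_act[OF m p] _ _ this]
  have "velocity (\<lambda>s. crd c (s3_act p (\<gamma> s))) (dpr c (s3_act p m) (s3_act p V))"
    using \<gamma> s3_act_M14[OF p] by simp
  then show ?thesis
    using chart_dpr_curve[OF c m \<gamma>] crd_s3_act[OF \<gamma>(1) p] vector_derivative_unique_at by simp
qed

lemma gram_exists:
  assumes c: "c \<in> Charts" and m: "m \<in> chart_dom c"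
  obtains B where "\<And>V W. V \<in> Hor m \<Longrightarrow> W \<in> Hor m \<Longrightarrow> dpr c m V \<bullet> (B *v dpr c m W) = met m V W"
proof -
  note mM = dom_M14[OF m]
  have "\<exists>V. V \<in> Hor m \<and> dpr c m V = v" for v
    by (rule dpr_surj_Hor[OF c m]) blast
  then obtain l where l: "\<And>v. l v \<in> Hor m" "\<And>v. dpr c m (l v) = v"
    using choice[of "\<lambda>v V. V \<in> Hor m \<and> dpr c m V = v"] by blast
  \<comment> \<open>The products of the horizontal lifts of the coordinate vectors.\<close>
  define B :: "real^11^11" where "B = (\<chi> i j. met m (l (axis i 1)) (l (axis j 1)))"
  have rep: "V = (\<Sum>i\<in>UNIV. (dpr c m V $ i) *\<^sub>R l (axis i 1))" if "V \<in> Hor m" for V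
  proof (rule dpr_inj_Hor[OF c m that])
    show "(\<Sum>i\<in>UNIV. (dpr c m V $ i) *\<^sub>R l (axis i 1)) \<in> Hor m"
      by (intro subspace_sum subspace_scale subspace_Hor mM l)
    show "dpr c m V = dpr c m (\<Sum>i\<in>UNIV. (dpr c m V $ i) *\<^sub>R l (axis i 1))"
      by (simp add: linear_sum[OF chart_linear_dpr[OF c m]] linear_cmul[OF chart_linear_dpr[OF c m]] l(2))
        (simp add: vec_eq_iff axis_def if_distrib cong: if_cong)
  qed
  show ?thesis
  proof (rule that)
    fix V W assume V: "V \<in> Hor m" and W: "W \<in> Hor m"
    have r: "met m X (\<Sum>i\<in>UNIV. a i *\<^sub>R Y i) = (\<Sum>i\<in>UNIV. a i * met m X (Y i))" for X Y and a :: "11 \<Rightarrow> real"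
      by (simp add: linear_sum[OF linear_M14_metric] linear_cmul[OF linear_M14_metric])
    have "met m V W = met m V (\<Sum>j\<in>UNIV. (dpr c m W $ j) *\<^sub>R l (axis j 1))"
      by (rule arg_cong[OF rep[OF W]])
    also have "\<dots> = (\<Sum>j\<in>UNIV. dpr c m W $ j * met m (l (axis j 1)) V)"
      unfolding r by (simp only: M14_metric_commute[of r1 r2 m V])
    also have "\<dots> = (\<Sum>j\<in>UNIV. dpr c m W $ j * met m (l (axis j 1)) (\<Sum>i\<in>UNIV. (dpr c m V $ i) *\<^sub>R l (axis i 1)))"
      by (intro sum.cong refl arg_cong2[where f = "(*)"] arg_cong[OF rep[OF V]])
    also have "\<dots> = (\<Sum>j\<in>UNIV. \<Sum>i\<in>UNIV. dpr c m V $ i * (B $ i $ j * dpr c m W $ j))"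
      unfolding r sum_distrib_left B_def
      by (intro sum.cong refl) (simp add: M14_metric_commute mult_ac)
    also have "\<dots> = dpr c m V \<bullet> (B *v dpr c m W)"
      by (subst sum.swap) (simp add: inner_vec_def matrix_vector_mult_def sum_distrib_left)
    finally show "dpr c m V \<bullet> (B *v dpr c m W) = met m V W" by simp
  qed
qed

abbreviation "gr \<equiv> quotient_gram M14 s3_rel met :: (m14 set, 11) chart \<Rightarrow> _"

text \<open>The definite description ranges over the whole fibre. A matrix found at one point works
  at all others since the action is isometric and preserves coordinates; it is unique since
  \<open>dpr\<close> maps horizontal vectors onto all of the coordinate space.\<close>

lemma gram_eq:
  assumes c: "c \<in> Charts" and m: "m \<in> chart_dom c" and "V \<in> Hor m" "W \<in> Hor m"
  shows "dpr c m V \<bullet> (gr c (crd c m) *v dpr c m W) = met m V W"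
proof -
  define P where "P B \<longleftrightarrow> (\<forall>m'\<in>M14. \<pi> m' \<in> fst c \<and> snd c (\<pi> m') = crd c m \<longrightarrow>
       (\<forall>V\<in>Hor m'. \<forall>W\<in>Hor m'. dpr c m' V \<bullet> (B *v dpr c m' W) = met m' V W))" for B
  have P_iff: "P B \<longleftrightarrow> (\<forall>m'\<in>chart_dom c. crd c m' = crd c m \<longrightarrow>
       (\<forall>V\<in>Hor m'. \<forall>W\<in>Hor m'. dpr c m' V \<bullet> (B *v dpr c m' W) = met m' V W))" for B
    unfolding P_def chart_dom_def crd_def by auto
  note mM = dom_M14[OF m]
  obtain B where B: "\<And>V W. V \<in> Hor m \<Longrightarrow> W \<in> Hor m \<Longrightarrow> dpr c m V \<bullet> (B *v dpr c m W) = met m V W"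
    by (rule gram_exists[OF c m]) blast
  have "P B"
    unfolding P_iff
  proof (intro ballI impI)
    fix m' V W assume m': "m' \<in> chart_dom c" "crd c m' = crd c m" and V: "V \<in> Hor m'" and W: "W \<in> Hor m'"
    obtain p where p: "p \<in> Sp1" "m = s3_act p m'" using crd_eqD[OF c m'(1) m m'(2)] by blast
    have T: "V \<in> TM m'" "W \<in> TM m'"
      using V W by (simp_all add: horizontal_iff dom_M14[OF m'(1)])
    have H: "s3_act p V \<in> Hor m" "s3_act p W \<in> Hor m"
      unfolding p(2) using Hor_s3_act[OF dom_M14[OF m'(1)] p(1)] V W by blast+
    show "dpr c m' V \<bullet> (B *v dpr c m' W) = met m' V W"
      using B[OF H] unfolding p(2) dpr_s3_act[OF c m'(1) p(1) T(1)] dpr_s3_act[OF c m'(1) p(1) T(2)]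
        M14_metric_s3_act[OF p(1)] .
  qed
  moreover have "B' = B" if "P B'" for B'
  proof -
    have "v \<bullet> (B' *v w) = v \<bullet> (B *v w)" for v w
    proof -
      obtain V where V: "V \<in> Hor m" "dpr c m V = v" by (rule dpr_surj_Hor[OF c m]) blast
      obtain W where W: "W \<in> Hor m" "dpr c m W = w" by (rule dpr_surj_Hor[OF c m]) blast
      have "dpr c m V \<bullet> (B' *v dpr c m W) = met m V W" using that m V(1) W(1) unfolding P_iff by blast
      then show ?thesis using B[OF V(1) W(1)] V(2) W(2) by simp
    qed
    then have "B' *v w = B *v w" for w using vector_eq_ldot[of "B' *v w" "B *v w"] by blast
    then show ?thesis by (simp add: matrix_eq)
  qed
  ultimately have "P (gr c (crd c m))"
    unfolding quotient_gram_def P_def[symmetric] by (rule theI)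
  then show ?thesis using assms unfolding P_iff by blast
qed

lemma gram_eq_tangent:
  assumes c: "c \<in> Charts" and m: "m \<in> chart_dom c" and V: "V \<in> TM m" and W: "W \<in> TM m"
  shows "dpr c m V \<bullet> (gr c (crd c m) *v dpr c m W)
    = met m V W - moment r1 m V \<bullet> moment r1 m W / fibre_norm r1 m"
  using gram_eq[OF c m hor_Hor[OF dom_M14[OF m] V] hor_Hor[OF dom_M14[OF m] W]]
  by (simp add: dpr_hor[OF c m] metric_hor[OF dom_M14[OF m]])

lemma gram_pos:
  assumes c: "c \<in> Charts" and m: "m \<in> chart_dom c" and "v \<noteq> 0"
  shows "v \<bullet> (gr c (crd c m) *v v) > 0"
proof -
  obtain V where V: "V \<in> Hor m" "dpr c m V = v" by (rule dpr_surj_Hor[OF c m]) blast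
  have "V \<noteq> 0" using V \<open>v \<noteq> 0\<close> linear_0[OF chart_linear_dpr[OF c m]] by auto
  then show ?thesis
    using gram_eq[OF c m V(1) V(1)] metric_pos[OF dom_M14[OF m]] V by (simp add: horizontal_iff dom_M14[OF m])
qed

end

lemma linear_rep_axis:
  fixes v :: "real^'n"
  assumes "linear f" shows "f v = (\<Sum>i\<in>UNIV. (v $ i) *\<^sub>R f (axis i 1))"
proof -
  have "f v = f (\<Sum>i\<in>UNIV. (v $ i) *\<^sub>R axis i 1)"
    by (rule arg_cong[of _ _ f]) (simp add: vec_eq_iff axis_def if_distrib cong: if_cong)
  then show ?thesis by (simp only: linear_sum[OF assms] linear_cmul[OF assms])
qed

text \<open>Every matrix on the segment from the identity to B has a positive form and is therefore
  invertible, so by the intermediate value theorem the determinant keeps the sign it has at the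
  identity.\<close>

lemma posdef_det_pos:
  fixes B :: "real^'n^'n"
  assumes "\<And>v. v \<noteq> 0 \<Longrightarrow> v \<bullet> (B *v v) > 0" shows "det B > 0"
proof (rule ccontr)
  assume "\<not> det B > 0"
  define A where "A s = (\<chi> i j. (1 - s) * (mat 1 :: real^'n^'n) $ i $ j + s * B $ i $ j)" for s
  have A01: "A 0 = mat 1" "A 1 = B" by (simp_all add: A_def vec_eq_iff)
  have "continuous_on {0..1} (\<lambda>s. det (A s))"
    unfolding det_def A_def by (auto intro!: continuous_intros)
  then obtain s where s: "0 \<le> s" "s \<le> 1" "det (A s) = 0"
    using IVT2'[of "\<lambda>s. det (A s)" 1 0 0] \<open>\<not> det B > 0\<close> by (auto simp: A01)
  then have "\<not> invertible (A s)" by (simp add: invertible_det_nz)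
  then obtain v where v: "v \<noteq> 0" "A s *v v = 0"
    using matrix_left_invertible_ker invertible_left_inverse by metis
  have Av: "A s *v v = (1 - s) *\<^sub>R v + s *\<^sub>R (B *v v)"
  proof -
    have "A s = (1 - s) *\<^sub>R mat 1 + s *\<^sub>R B" by (simp add: A_def vec_eq_iff)
    then show ?thesis by (simp add: matrix_vector_mult_add_rdistrib scaleR_matrix_vector_assoc[symmetric])
  qed
  have "0 = v \<bullet> (A s *v v)" by (simp add: v)
  also have "\<dots> = (1 - s) * (v \<bullet> v) + s * (v \<bullet> (B *v v))" unfolding Av by (simp add: inner_add_right)
  finally have 0: "(1 - s) * (v \<bullet> v) + s * (v \<bullet> (B *v v)) = 0" by simp
  have "v \<bullet> v > 0" "v \<bullet> (B *v v) > 0" using v assms by auto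
  moreover have "0 \<le> (1 - s) * (v \<bullet> v)" using s by simp
  ultimately show False
    using s 0 mult_pos_pos[of s "v \<bullet> (B *v v)"] by (cases "s = 0") (simp, linarith)
qed


section \<open>Explicit charts of the quotient\<close>

type_synonym model = "quat \<times> (real^3) \<times> quat"

text \<open>Near a point \<open>[(P\<^sup>*, t)]\<close> a representative \<open>(Q, t)\<close> is determined by the second column of
  \<open>P Q\<close> together with \<open>t\<^sub>1\<close> and the invariant \<open>(P Q)\<^sub>1\<^sub>1 t\<^sub>2\<close>; the latter two are
  read through the stereographic projection from \<open>(-h, 0)\<close>, where \<open>h\<^sup>2 = 1\<close>.\<close>

definition mcoord :: "qmat \<Rightarrow> real \<Rightarrow> m14 \<Rightarrow> model" where
  "mcoord P h m = (let A = P **\<^sub>H fst m in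
     (A $ 1 $ 2, snd (A $ 2 $ 2), inverse (1 + h * ht m) *\<^sub>R (A $ 1 $ 1 *\<^sub>H hq m)))"

text \<open>Positivity of the real part of the (2,2) entry allows it to be recovered by a square
  root from the rest of its column; the second condition excludes the centre of the stereographic
  projection.\<close>

definition mdom :: "qmat \<Rightarrow> real \<Rightarrow> m14 set" where
  "mdom P h = {m \<in> M14. fst ((P **\<^sub>H fst m) $ 2 $ 2) > 0 \<and> 1 + h * ht m > 0}"

definition model_dom :: "model set" where
  "model_dom = {u. (norm (fst u))\<^sup>2 + (norm (fst (snd u)))\<^sup>2 < 1}"

text \<open>The freedom in p is spent on making the (1,1) entry of P Q the positive real \<alpha>.
  The (2,1) entry is then forced by orthogonality of the rows, and the sphere component is the
  inverse stereographic projection of z.\<close>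

definition msect :: "qmat \<Rightarrow> real \<Rightarrow> model \<Rightarrow> m14" where
  "msect P h u = (let b = fst u; e = fst (snd u); \<alpha> = sqrt (1 - (norm b)\<^sup>2);
      d = (sqrt (1 - (norm b)\<^sup>2 - (norm e)\<^sup>2), e); z = inverse \<alpha> *\<^sub>R snd (snd u) in
     (qadj P **\<^sub>H qm (qreal \<alpha>) b (- (inverse \<alpha> *\<^sub>R (d *\<^sub>H qcnj b))) d,
      (h * ((1 - (norm z)\<^sup>2) / (1 + (norm z)\<^sup>2)), (2 / (1 + (norm z)\<^sup>2)) *\<^sub>R z)))"

lemma S4_iff: "t \<in> S4 \<longleftrightarrow> (fst t)\<^sup>2 + (norm (snd t))\<^sup>2 = 1"
  by (simp add: S4_def norm_prod_def)

lemma M14_iff: "m \<in> M14 \<longleftrightarrow> fst m \<in> Sp2 \<and> snd m \<in> S4"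
  by (simp add: M14_def mem_Times_iff)

lemma model_dom_pos:
  assumes "u \<in> model_dom"
  shows "1 - (norm (fst u))\<^sup>2 > 0" "1 - (norm (fst u))\<^sup>2 - (norm (fst (snd u)))\<^sup>2 > 0"
  using assms zero_le_power2[of "norm (fst (snd u))"] unfolding model_dom_def mem_Collect_eq by linarith+

lemma msect_matrix:
  assumes u: "u \<in> model_dom" and P: "P \<in> Sp2"
  shows "P **\<^sub>H fst (msect P h u) = qm (qreal (sqrt (1 - (norm (fst u))\<^sup>2))) (fst u)
      (- (inverse (sqrt (1 - (norm (fst u))\<^sup>2)) *\<^sub>R ((sqrt (1 - (norm (fst u))\<^sup>2 - (norm (fst (snd u)))\<^sup>2), fst (snd u)) *\<^sub>H qcnj (fst u))))
      (sqrt (1 - (norm (fst u))\<^sup>2 - (norm (fst (snd u)))\<^sup>2), fst (snd u))"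
  by (simp add: msect_def Let_def P)

lemma Sp2_section:
  assumes "\<alpha> > 0" "\<alpha>\<^sup>2 = 1 - (norm b)\<^sup>2" "(norm d)\<^sup>2 = \<alpha>\<^sup>2"
  shows "qm (qreal \<alpha>) b (- (inverse \<alpha> *\<^sub>R (d *\<^sub>H qcnj b))) d \<in> Sp2"
proof -
  have e: "\<alpha>\<^sup>2 + (norm b)\<^sup>2 = 1" using assms(2) by simp
  have "(inverse \<alpha>)\<^sup>2 * ((norm d)\<^sup>2 * (norm b)\<^sup>2) + (norm d)\<^sup>2 = 1"
  proof -
    have "(inverse \<alpha>)\<^sup>2 * (\<alpha>\<^sup>2 * (norm b)\<^sup>2) = (norm b)\<^sup>2"
      using assms(1) by (simp add: power_inverse mult.assoc[symmetric])
    then show ?thesis using e unfolding assms(3) by linarith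
  qed
  then show ?thesis
    using assms(1) e
    by (simp add: Sp2_def qm_eq_iff qmat_mul_nth qmul_minus qcnj_minus qcnj_scaleR qmul_scaleR qcnj_qmul qmul_assoc
       qmul_qcnj qcnj_qmul_self qreal_mul scaleR_qreal flip: qreal_add)
      (simp add: qmul_assoc[symmetric] qmul_qcnj qreal_mul scaleR_qreal norm_qmul power_mult_distrib flip: qreal_add)
qed

lemma stereographic_section:
  fixes z :: quat
  assumes "h\<^sup>2 = (1::real)"
  defines "t \<equiv> (h * ((1 - (norm z)\<^sup>2) / (1 + (norm z)\<^sup>2)), (2 / (1 + (norm z)\<^sup>2)) *\<^sub>R z)"
  shows "t \<in> S4" "1 + h * fst t = 2 / (1 + (norm z)\<^sup>2)"
proof -
  let ?n = "(norm z)\<^sup>2"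
  have n: "1 + ?n > 0" by (simp add: add_pos_nonneg)
  have "(fst t)\<^sup>2 = ((1 - ?n) / (1 + ?n))\<^sup>2" using assms(1) unfolding t_def fst_conv power_mult_distrib by simp
  moreover have "(norm (snd t))\<^sup>2 = (2 / (1 + ?n))\<^sup>2 * ?n"
    unfolding t_def snd_conv norm_scaleR power_mult_distrib power2_abs ..
  moreover have "((1 - ?n) / (1 + ?n))\<^sup>2 + (2 / (1 + ?n))\<^sup>2 * ?n = 1"
  proof -
    have "((1 - ?n) / (1 + ?n))\<^sup>2 + (2 / (1 + ?n))\<^sup>2 * ?n = ((1 - ?n)\<^sup>2 + 4 * ?n) / (1 + ?n)\<^sup>2"
      by (simp add: power_divide add_divide_distrib)
    also have "(1 - ?n)\<^sup>2 + 4 * ?n = (1 + ?n)\<^sup>2" by (simp add: power2_eq_square algebra_simps)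
    finally show ?thesis using n by simp
  qed
  ultimately show "t \<in> S4" by (simp add: S4_iff)
  have "1 + h * fst t = 1 + h\<^sup>2 * ((1 - ?n) / (1 + ?n))" by (simp add: t_def power2_eq_square)
  also have "\<dots> = 2 / (1 + ?n)" using n assms(1) by (simp add: field_simps)
  finally show "1 + h * fst t = 2 / (1 + ?n)" .
qed

lemma msect:
  assumes u: "u \<in> model_dom" and P: "P \<in> Sp2" and h: "h\<^sup>2 = 1"
  shows "msect P h u \<in> mdom P h" "mcoord P h (msect P h u) = u"
proof -
  let ?\<alpha> = "sqrt (1 - (norm (fst u))\<^sup>2)" and ?\<delta> = "sqrt (1 - (norm (fst u))\<^sup>2 - (norm (fst (snd u)))\<^sup>2)"
  let ?z = "inverse ?\<alpha> *\<^sub>R snd (snd u)"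
  let ?m = "msect P h u"
  note pos = model_dom_pos[OF u]
  have \<alpha>: "?\<alpha> > 0" "?\<alpha>\<^sup>2 = 1 - (norm (fst u))\<^sup>2" using pos by simp_all
  have d: "(norm (?\<delta>, fst (snd u)))\<^sup>2 = ?\<alpha>\<^sup>2" "?\<delta> > 0"
    using pos by (simp_all add: norm_prod_def)
  have "fst ?m = qadj P **\<^sub>H (P **\<^sub>H fst ?m)" using P by simp
  also have "\<dots> \<in> Sp2"
    unfolding msect_matrix[OF u P] using Sp2_section[OF \<alpha> d(1)] Sp2_mul[OF Sp2_qadj[OF P]] by blast
  finally have "fst ?m \<in> Sp2" .
  moreover have snd_m: "snd ?m = (h * ((1 - (norm ?z)\<^sup>2) / (1 + (norm ?z)\<^sup>2)), (2 / (1 + (norm ?z)\<^sup>2)) *\<^sub>R ?z)"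
    by (simp only: msect_def Let_def snd_conv)
  note st = stereographic_section[OF h, of ?z, folded snd_m]
  ultimately have "?m \<in> M14" using st(1) by (simp add: M14_iff)
  moreover have n: "1 + (norm ?z)\<^sup>2 > 0" by (simp add: add_pos_nonneg)
  then have "1 + h * fst (snd ?m) > 0" unfolding st(2) by simp
  ultimately show "msect P h u \<in> mdom P h"
    using d(2) by (simp add: mdom_def msect_matrix[OF u P])
  have "inverse (2 / (1 + (norm ?z)\<^sup>2)) *\<^sub>R (qreal ?\<alpha> *\<^sub>H snd (snd ?m)) = snd (snd u)"
  proof -
    have "snd (snd ?m) = (2 / (1 + (norm ?z)\<^sup>2)) *\<^sub>R ?z" by (simp only: snd_m snd_conv)
    moreover have "inverse (2 / (1 + (norm ?z)\<^sup>2)) * (?\<alpha> * ((2 / (1 + (norm ?z)\<^sup>2)) * inverse ?\<alpha>)) = 1"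
    proof -
      have "inverse (2 / n) * (x * ((2 / n) * inverse x)) = 1" if "x > 0" "n > 0" for x n :: real
        using that by (simp add: field_simps)
      then show ?thesis using n \<alpha>(1) by blast
    qed
    ultimately show ?thesis by (simp only: qreal_mul scaleR_scaleR scaleR_one)
  qed
  then show "mcoord P h (msect P h u) = u"
    unfolding mcoord_def Let_def msect_matrix[OF u P] st(2) by simp
qed

lemma mdom_M14: "m \<in> mdom P h \<Longrightarrow> m \<in> M14"
  by (simp add: mdom_def)

lemma mcoord_model_dom:
  assumes m: "m \<in> mdom P h" and P: "P \<in> Sp2" shows "mcoord P h m \<in> model_dom"
proof -
  let ?A = "P **\<^sub>H fst m"
  have "?A \<in> Sp2" using m P Sp2_mul by (simp add: mdom_def M14_iff)
  from Sp2_entries(2)[OF this]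
  have "(norm (?A $ 1 $ 2))\<^sup>2 + ((fst (?A $ 2 $ 2))\<^sup>2 + (norm (snd (?A $ 2 $ 2)))\<^sup>2) = 1"
    by (simp add: norm_prod_def[of "?A $ 2 $ 2"])
  moreover have "(fst (?A $ 2 $ 2))\<^sup>2 > 0" using m by (simp add: mdom_def)
  ultimately have "(norm (?A $ 1 $ 2))\<^sup>2 + (norm (snd (?A $ 2 $ 2)))\<^sup>2 < 1" by linarith
  then show ?thesis by (simp add: model_dom_def mcoord_def Let_def)
qed

lemma msect_mcoord:
  assumes m: "m \<in> mdom P h" and P: "P \<in> Sp2" and h: "h\<^sup>2 = 1"
  shows "\<exists>p\<in>Sp1. m = s3_act p (msect P h (mcoord P h m))"
proof -
  define A where "A = P **\<^sub>H fst m"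
  define a b c d where abcd: "a = A $ 1 $ 1" "b = A $ 1 $ 2" "c = A $ 2 $ 1" "d = A $ 2 $ 2"
  define t1 t2 where t: "t1 = ht m" "t2 = hq m"
  define u where "u = mcoord P h m"
  have u: "u \<in> model_dom" unfolding u_def by (rule mcoord_model_dom[OF m P])
  have A: "A \<in> Sp2" and d0: "fst d > 0" and t0: "1 + h * t1 > 0" and tS: "t1\<^sup>2 + (norm t2)\<^sup>2 = 1"
    using m P Sp2_mul by (simp_all add: mdom_def M14_iff A_def abcd t S4_iff)
  note ent = Sp2_entries[OF A, folded abcd]
  have u': "fst u = b" "fst (snd u) = snd d" "snd (snd u) = inverse (1 + h * t1) *\<^sub>R (a *\<^sub>H t2)"
    by (simp_all add: u_def mcoord_def Let_def abcd t A_def)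
  define \<alpha> where "\<alpha> = sqrt (1 - (norm b)\<^sup>2)"
  have "\<alpha>\<^sup>2 = 1 - (norm b)\<^sup>2" "\<alpha> > 0" using model_dom_pos[OF u] by (simp_all add: \<alpha>_def u')
  then have \<alpha>: "\<alpha> > 0" "(norm a)\<^sup>2 = \<alpha>\<^sup>2" "norm a = \<alpha>"
    using ent(1) power2_eq_imp_eq[of "norm a" \<alpha>] by simp_all
  have "sqrt (1 - (norm b)\<^sup>2 - (norm (snd d))\<^sup>2) = fst d"
  proof (rule real_sqrt_unique)
    have "(norm d)\<^sup>2 = (fst d)\<^sup>2 + (norm (snd d))\<^sup>2" by (simp add: norm_prod_def)
    then show "(fst d)\<^sup>2 = 1 - (norm b)\<^sup>2 - (norm (snd d))\<^sup>2" using ent(2) by simp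
  qed (use d0 in simp)
  then have mat: "P **\<^sub>H fst (msect P h u) = qm (qreal \<alpha>) b (- (inverse \<alpha> *\<^sub>R (d *\<^sub>H qcnj b))) d"
    unfolding msect_matrix[OF u P] u' by (simp add: \<alpha>_def)
  \<comment> \<open>The action multiplies the first column by cnj p on the right, so p must turn the
    real entry \<alpha> = |a| of the section into a.\<close>
  define p where "p = inverse \<alpha> *\<^sub>R qcnj a"
  have p: "p \<in> Sp1" using \<alpha> by (simp add: Sp1_iff p_def)
  have ap: "qreal \<alpha> *\<^sub>H qcnj p = a" "p *\<^sub>H a = qreal \<alpha>"
    using \<alpha> by (simp_all add: p_def qcnj_scaleR qreal_mul qmul_scaleR qcnj_qmul_self scaleR_qreal power2_eq_square)
  \<comment> \<open>Orthogonality of the rows determines c from a, b and d, since |a| = \<alpha> is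
    positive.\<close>
  have c: "c = - (inverse \<alpha> *\<^sub>R (d *\<^sub>H qcnj b)) *\<^sub>H qcnj p"
  proof -
    have "c *\<^sub>H qcnj a = - (d *\<^sub>H qcnj b)" using ent(3) by (simp add: eq_neg_iff_add_eq_0)
    then have "(c *\<^sub>H qcnj a) *\<^sub>H a = - (d *\<^sub>H qcnj b) *\<^sub>H a" by simp
    then have "\<alpha>\<^sup>2 *\<^sub>R c = - ((d *\<^sub>H qcnj b) *\<^sub>H a)" by (simp add: qmul_assoc qcnj_qmul_self \<alpha> qreal_mul qmul_minus)
    then have "inverse (\<alpha>\<^sup>2) *\<^sub>R (\<alpha>\<^sup>2 *\<^sub>R c) = inverse (\<alpha>\<^sup>2) *\<^sub>R (- ((d *\<^sub>H qcnj b) *\<^sub>H a))" by simp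
    moreover have "inverse (\<alpha>\<^sup>2) *\<^sub>R (\<alpha>\<^sup>2 *\<^sub>R c) = c" using \<alpha>(1) by simp
    ultimately have "c = inverse (\<alpha>\<^sup>2) *\<^sub>R (- ((d *\<^sub>H qcnj b) *\<^sub>H a))" by simp
    then show ?thesis
      by (simp add: p_def qcnj_scaleR qmul_minus qmul_scaleR power2_eq_square)
  qed
  have "P **\<^sub>H fst (s3_act p (msect P h u)) = (P **\<^sub>H fst (msect P h u)) **\<^sub>H qdiag (qcnj p) (qreal 1)"
    by (simp add: s3_act_eq qmat_mul_assoc)
  also have "\<dots> = A"
    unfolding mat by (simp add: qm_eq_iff qmat_mul_nth ap flip: abcd c)
  finally have "qadj P **\<^sub>H (P **\<^sub>H fst (s3_act p (msect P h u))) = qadj P **\<^sub>H A" by simp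
  then have fst: "fst (s3_act p (msect P h u)) = fst m"
    using P by (simp add: A_def)
  let ?z = "inverse \<alpha> *\<^sub>R snd (snd u)"
  have "norm ?z = inverse \<alpha> * (inverse (1 + h * t1) * (\<alpha> * norm t2))"
    using \<alpha> t0 by (simp add: u' norm_qmul)
  also have "\<dots> = norm t2 / (1 + h * t1)" using \<alpha>(1) by (simp add: field_simps)
  finally have "(norm ?z)\<^sup>2 = (norm t2)\<^sup>2 / (1 + h * t1)\<^sup>2" by (simp add: power_divide)
  also have "(norm t2)\<^sup>2 = (1 + h * t1) * (1 - h * t1)"
  proof -
    have "(1 + h * t1) * (1 - h * t1) = 1 - h\<^sup>2 * t1\<^sup>2" by (simp add: algebra_simps power2_eq_square)
    then show ?thesis using tS h by simp
  qed
  finally have nz: "(norm ?z)\<^sup>2 = (1 - h * t1) / (1 + h * t1)"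
    using t0 by (simp add: power2_eq_square)
  then have n1: "1 + (norm ?z)\<^sup>2 = 2 / (1 + h * t1)" "1 - (norm ?z)\<^sup>2 = 2 * (h * t1) / (1 + h * t1)"
    using t0 by (simp_all add: field_simps)
  have s: "snd (msect P h u) = (h * ((1 - (norm ?z)\<^sup>2) / (1 + (norm ?z)\<^sup>2)), (2 / (1 + (norm ?z)\<^sup>2)) *\<^sub>R ?z)"
    unfolding msect_def Let_def snd_conv u' \<alpha>_def[symmetric] ..
  have "fst (snd (msect P h u)) = t1"
    unfolding s n1 using t0 h by (simp add: power2_eq_square)
  moreover have "snd (snd (msect P h u)) = (1 + h * t1) *\<^sub>R ?z"
    unfolding s n1 using t0 by simp
  then have "p *\<^sub>H snd (snd (msect P h u)) = t2"
  proof -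
    have "(1 + h * t1) * (inverse \<alpha> * inverse (1 + h * t1)) * \<alpha> = 1"
    proof -
      have "x * (inverse y * inverse x) * y = 1" if "x > 0" "y > 0" for x y :: real
        using that by (simp add: field_simps)
      then show ?thesis using t0 \<alpha>(1) by blast
    qed
    moreover assume "snd (snd (msect P h u)) = (1 + h * t1) *\<^sub>R ?z"
    ultimately show ?thesis by (simp add: u' qmul_scaleR qmul_assoc[symmetric] ap qreal_mul)
  qed
  ultimately have "snd (s3_act p (msect P h u)) = snd m"
    by (simp add: s3_act_eq t prod_eq_iff[of "snd m"])
  then have "m = s3_act p (msect P h u)" using fst by (simp only: prod_eq_iff)
  then show ?thesis using p unfolding u_def by blast
qed

lemma mcoord_s3_act:
  assumes "p \<in> Sp1" shows "mcoord P h (s3_act p m) = mcoord P h m"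
proof -
  have "(a *\<^sub>H qcnj p) *\<^sub>H (p *\<^sub>H t) = a *\<^sub>H t" for a t
  proof -
    have "(a *\<^sub>H qcnj p) *\<^sub>H (p *\<^sub>H t) = a *\<^sub>H ((qcnj p *\<^sub>H p) *\<^sub>H t)" by (simp only: qmul_assoc)
    then show ?thesis using assms by (simp add: qcnj_qmul_self Sp1_iff)
  qed
  then show ?thesis
    by (simp add: mcoord_def Let_def s3_act_eq qmat_mul_assoc[symmetric] qmat_mul_nth)
qed

lemma mdom_s3_act:
  assumes "p \<in> Sp1" "m \<in> mdom P h" shows "s3_act p m \<in> mdom P h"
proof -
  have "(P **\<^sub>H fst (s3_act p m)) $ 2 $ 2 = (P **\<^sub>H fst m) $ 2 $ 2"
    by (simp add: s3_act_eq qmat_mul_assoc[symmetric] qmat_mul_nth)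
  moreover have "fst (snd (s3_act p m)) = ht m" by (simp add: s3_act_eq)
  ultimately show ?thesis using assms s3_act_M14 by (simp add: mdom_def)
qed

lemma Ck_on_qm:
  assumes "open W" "Ck_on k a W" "Ck_on k b W" "Ck_on k c W" "Ck_on k d W"
  shows "Ck_on k (\<lambda>x. qm (a x) (b x) (c x) (d x)) W"
proof -
  have "Ck_on k (\<lambda>x. if i = 1 then (if j = 1 then a x else b x) else (if j = 1 then c x else d x)) W" for i j :: 2
    using assms by (cases "i = 1"; cases "j = 1") simp_all
  then show ?thesis unfolding qm_def by (intro Ck_on_vec assms(1))
qed

lemmas Ck_on_qmul = Ck_on_bilinear[OF bilinear_qmul]
lemmas Ck_on_qmat_mul = Ck_on_bilinear[OF bilinear_qmat_mul]
lemmas Ck_on_qcnj = Ck_on_linear_comp[OF bounded_linear_qcnj]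
lemmas Ck_on_intros = Ck_on_Pair Ck_on_scaleR Ck_on_inverse Ck_on_divide Ck_on_diff Ck_on_minus Ck_on_add Ck_on_mult
  Ck_on_qmul Ck_on_qcnj Ck_on_sqrt Ck_on_inner Ck_on_qm Ck_on_qmat_mul Ck_on_linear_comp[OF bounded_linear_qadj]
  Ck_on_snd Ck_on_fst Ck_on_vec_nth Ck_on_const Ck_on_id

lemma Ck_on_mcoord:
  assumes "open W" "\<And>m. m \<in> W \<Longrightarrow> 1 + h * ht m \<noteq> 0"
  shows "Ck_on k (mcoord P h) W"
  unfolding mcoord_def[abs_def] Let_def
  by (intro Ck_on_intros assms)

lemma open_model_dom: "open model_dom"
  unfolding model_dom_def by (intro open_Collect_less continuous_intros)

lemma Ck_on_msect: "Ck_on k (msect P h) model_dom"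
proof -
  have 1: "(1 - fst x \<bullet> fst x) > 0" "(1 - fst x \<bullet> fst x - fst (snd x) \<bullet> fst (snd x)) > 0" if "x \<in> model_dom" for x
    using model_dom_pos[OF that] by (simp_all only: power2_norm_eq_inner)
  have 2: "sqrt (1 - fst x \<bullet> fst x) \<noteq> 0" if "x \<in> model_dom" for x
    using 1(1)[OF that] by simp
  have 3: "1 + a \<bullet> a \<noteq> (0::real)" for a :: quat
    using inner_ge_zero[of a] by linarith
  show ?thesis
    unfolding msect_def[abs_def] Let_def qreal_def power2_norm_eq_inner
    by (intro Ck_on_intros open_model_dom 1 2 3)
qed

text \<open>Charts take values in \<open>real^11\<close>; the model has dimension 4 + 3 + 4, and any
  linear identification serves.\<close>

definition iso11 :: "model \<Rightarrow> real^11" where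
  "iso11 = (SOME J. linear J \<and> bij J)"

lemma iso11: "linear iso11" "bij iso11"
proof -
  have "dim (UNIV :: model set) = dim (UNIV :: (real^11) set)" by simp
  then obtain J :: "model \<Rightarrow> real^11" where "linear J" "J ` UNIV = UNIV" "inj_on J UNIV"
    using subspace_isomorphism[OF subspace_UNIV subspace_UNIV] by blast
  then have "linear J \<and> bij J" by (simp add: bij_def)
  then have "linear iso11 \<and> bij iso11" unfolding iso11_def by (rule someI[of "\<lambda>J. linear J \<and> bij J"])
  then show "linear iso11" "bij iso11" by blast+
qed

lemma inv_iso11: "inv iso11 (iso11 u) = u" "iso11 (inv iso11 y) = y"
  using iso11(2) by (simp_all add: bij_is_inj bij_is_surj surj_f_inv_f)

lemma linear_inv_iso11: "linear (inv iso11)"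
proof -
  obtain g where g: "linear g" "g \<circ> iso11 = id"
    using linear_injective_left_inverse[OF iso11(1) bij_is_inj[OF iso11(2)]] by blast
  have "g y = inv iso11 y" for y
    using fun_cong[OF g(2), of "inv iso11 y"] by (simp add: inv_iso11(2))
  then have "g = inv iso11" by (rule ext)
  then show ?thesis using g(1) by simp
qed

definition csect :: "qmat \<Rightarrow> real \<Rightarrow> real^11 \<Rightarrow> m14" where
  "csect P h y = msect P h (inv iso11 y)"

definition cdom :: "(real^11) set" where
  "cdom = iso11 ` model_dom"

text \<open>The choice of a representative is harmless because \<open>mcoord\<close> is constant on
  fibres.\<close>

definition mchart :: "qmat \<Rightarrow> real \<Rightarrow> (m14 set, 11) chart" where
  "mchart P h = (\<pi> ` mdom P h, \<lambda>q. iso11 (mcoord P h (SOME m. m \<in> q)))"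

lemma open_cdom: "open cdom"
  using open_surjective_linear_image[of model_dom iso11] open_model_dom iso11(1) bij_is_surj[OF iso11(2)]
  by (simp only: cdom_def)

lemma Ck_on_csect: "Ck_on k (csect P h) cdom"
proof -
  have "inv iso11 ` cdom \<subseteq> model_dom" by (auto simp: cdom_def inv_iso11)
  moreover have "bounded_linear (inv iso11)" using linear_inv_iso11 linear_conv_bounded_linear by blast
  ultimately show ?thesis
    unfolding csect_def[abs_def]
    by (intro Ck_on_compose[OF open_cdom open_model_dom Ck_on_linear Ck_on_msect] open_cdom)
qed

section \<open>The explicit charts as members of the quotient atlas\<close>

context berger
begin

lemma dom_mchart: "chart_dom (mchart P h) = mdom P h"
proof (intro equalityI subsetI)
  fix m assume "m \<in> chart_dom (mchart P h)"
  then obtain m' where m': "m \<in> M14" "m' \<in> mdom P h" "\<pi> m' = \<pi> m"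
    by (auto simp: chart_dom_def mchart_def)
  then obtain p where "p \<in> Sp1" "m = s3_act p m'" using proj_eq_iff mdom_M14 by blast
  then show "m \<in> mdom P h" using mdom_s3_act m'(2) by blast
qed (simp add: chart_dom_def mchart_def mdom_M14)

lemma crd_mchart:
  assumes "m \<in> M14" shows "crd (mchart P h) m = iso11 (mcoord P h m)"
proof -
  have "m \<in> \<pi> m"
    unfolding proj_def using equiv_class_self[OF equiv_s3_rel assms] .
  then have "(SOME m'. m' \<in> \<pi> m) \<in> \<pi> m" by (rule someI)
  then obtain p where "p \<in> Sp1" "(SOME m'. m' \<in> \<pi> m) = s3_act p m" unfolding proj_s3[OF assms] by blast
  then show ?thesis by (simp add: crd_def mchart_def mcoord_s3_act)
qed

lemma csect:
  assumes P: "P \<in> Sp2" and h: "h\<^sup>2 = 1"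
  shows "y \<in> cdom \<Longrightarrow> csect P h y \<in> mdom P h"
    "y \<in> cdom \<Longrightarrow> crd (mchart P h) (csect P h y) = y"
    "m \<in> mdom P h \<Longrightarrow> crd (mchart P h) m \<in> cdom"
    "m \<in> mdom P h \<Longrightarrow> \<exists>p\<in>Sp1. m = s3_act p (csect P h (crd (mchart P h) m))"
proof -
  show 1: "csect P h y \<in> mdom P h" if "y \<in> cdom" for y
    using that msect(1)[OF _ P h] by (auto simp: csect_def cdom_def inv_iso11)
  show "crd (mchart P h) (csect P h y) = y" if "y \<in> cdom" for y
    using that msect(2)[OF _ P h] crd_mchart[OF mdom_M14[OF 1[OF that]]]
    by (auto simp: csect_def cdom_def inv_iso11)
  show "crd (mchart P h) m \<in> cdom" if "m \<in> mdom P h" for m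
    using mcoord_model_dom[OF that P] by (simp add: crd_mchart[OF mdom_M14[OF that]] cdom_def)
  show "\<exists>p\<in>Sp1. m = s3_act p (csect P h (crd (mchart P h) m))" if "m \<in> mdom P h" for m
    using msect_mcoord[OF that P h] by (simp add: crd_mchart[OF mdom_M14[OF that]] csect_def inv_iso11)
qed

lemma mchart_Charts:
  assumes P: "P \<in> Sp2" and h: "h\<^sup>2 = 1"
  shows "mchart P h \<in> Charts"
proof -
  let ?c = "mchart P h"
  note cs = csect[OF P h]
  define W :: "m14 set" where "W = {m. 0 < fst ((P **\<^sub>H fst m) $ 2 $ 2)} \<inter> {m. 0 < 1 + h * ht m}"
  have W: "open W" "mdom P h = M14 \<inter> W"
  proof -
    have "continuous_on UNIV (\<lambda>m :: m14. fst ((P **\<^sub>H fst m) $ 2 $ 2))"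
      by (intro continuous_intros bounded_bilinear.continuous_on[OF bilinear_qmat_mul])
    from open_Collect_less[OF continuous_on_const this] show "open W" unfolding W_def
      by (intro open_Int) (auto intro!: open_Collect_less continuous_intros)
  qed (auto simp: W_def mdom_def)
  have "openin (top_of_set M14) (chart_dom ?c)" unfolding dom_mchart W(2) using W(1) by blast
  moreover have sm: "smooth_on (chart_dom ?c) (crd ?c)"
    unfolding smooth_on_def dom_mchart
  proof (intro ballI exI conjI allI)
    show "open W" by (rule W(1))
    show "m \<in> W" if "m \<in> mdom P h" for m using that W(2) by blast
    show "Ck_on k (\<lambda>m. iso11 (mcoord P h m)) W" for k
      by (rule Ck_on_linear_comp[OF _ W(1) Ck_on_mcoord[OF W(1)]])
        (use iso11(1) in \<open>auto simp: linear_conv_bounded_linear W_def\<close>)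
    show "iso11 (mcoord P h x) = crd ?c x" if "x \<in> mdom P h \<inter> W" for m x
      using that crd_mchart[OF mdom_M14[of x P h]] by simp
  qed
  ultimately have pre: "prechart ?c" by (simp add: prechart_def)
  have inj: "inj_on (snd ?c) (fst ?c)"
  proof (rule inj_onI)
    fix q q' assume q: "q \<in> fst ?c" "q' \<in> fst ?c" "snd ?c q = snd ?c q'"
    then obtain m m' where m: "m \<in> mdom P h" "m' \<in> mdom P h" "q = \<pi> m" "q' = \<pi> m'"
      by (auto simp: mchart_def)
    then have "crd ?c m = crd ?c m'" using q(3) by (simp add: crd_def)
    then obtain p p' where p: "p \<in> Sp1" "p' \<in> Sp1"
      "m = s3_act p (csect P h (crd ?c m))" "m' = s3_act p' (csect P h (crd ?c m))"
      using cs(4)[OF m(1)] cs(4)[OF m(2)] by metis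
    then show "q = q'"
      unfolding m(3,4) using proj_s3_act[OF mdom_M14[OF cs(1)[OF cs(3)[OF m(1)]]]] by metis
  qed
  have "fst ?c \<subseteq> M14 // s3_rel"
    by (auto simp: mchart_def proj_def intro!: quotientI mdom_M14)
  moreover have "snd ?c ` fst ?c = cdom"
  proof (intro equalityI subsetI)
    fix y assume "y \<in> snd ?c ` fst ?c"
    then obtain m where m: "m \<in> mdom P h" "y = snd ?c (\<pi> m)" by (auto simp: mchart_def)
    then show "y \<in> cdom" using cs(3)[OF m(1)] by (simp add: crd_def)
  next
    fix y assume y: "y \<in> cdom"
    have "snd ?c (\<pi> (csect P h y)) = y" using cs(2)[OF y] by (simp add: crd_def)
    moreover have "\<pi> (csect P h y) \<in> fst ?c" using cs(1)[OF y] by (simp add: mchart_def)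
    ultimately show "y \<in> snd ?c ` fst ?c" by (metis imageI)
  qed
  moreover have "dpr ?c m ` TM m = UNIV" if m: "m \<in> chart_dom ?c" for m
  proof (intro equalityI subsetI UNIV_I)
    fix v :: "real^11"
    have m': "m \<in> mdom P h" using m dom_mchart by simp
    define y where "y = crd ?c m"
    have y: "y \<in> cdom" unfolding y_def by (rule cs(3)[OF m'])
    obtain p where p: "p \<in> Sp1" "m = s3_act p (csect P h y)" using cs(4)[OF m'] unfolding y_def by blast
    \<comment> \<open>The explicit section, moved by p so that it passes through m and not merely
      through its fibre. Its derivative is a right inverse of \<open>dpr\<close>, which gives the
      submersion condition.\<close>
    let ?s = "\<lambda>x. s3_act p (csect P h x)"
    have s: "Ck_on (Suc 0) ?s cdom"
      by (rule Ck_on_linear_comp[OF bounded_linear_s3_act open_cdom Ck_on_csect])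
    have sM: "?s x \<in> M14" "crd ?c (?s x) = x" if "x \<in> cdom" for x
      using s3_act_M14[OF p(1)] crd_s3_act[OF mdom_M14 p(1)] cs(1,2)[OF that] mdom_M14 by auto
    have "dpr ?c m (fder ?s y v) = v"
      using section_dpr[OF pre open_cdom y s sM(1) _ sM(2)] m unfolding p(2) by blast
    moreover have "fder ?s y v \<in> TM m"
      using section_tangent[OF open_cdom y s sM(1)] unfolding p(2) .
    ultimately show "v \<in> dpr ?c m ` TM m" by (metis imageI)
  qed
  ultimately show ?thesis
    using pre inj open_cdom unfolding Charts_iff prechart_def by simp
qed

end


section \<open>Local sections\<close>

context berger
begin

definition lsection :: "(m14 set, 11) chart \<Rightarrow> (real^11) set \<Rightarrow> (real^11 \<Rightarrow> m14) \<Rightarrow> bool" where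
  "lsection c V s \<longleftrightarrow> open V \<and> (\<forall>k. Ck_on k s V) \<and> (\<forall>y\<in>V. s y \<in> chart_dom c \<and> crd c (s y) = y)"

lemma mchart_at:
  assumes m: "m \<in> M14"
  obtains P h where "P \<in> Sp2" "h\<^sup>2 = (1::real)" "m \<in> mdom P h"
proof -
  \<comment> \<open>Taking the sign of t1 keeps 1 + h t1 at least 1. Taking for P the adjoint of Q
    makes the (2,2) entry of P Q equal to 1.\<close>
  define h :: real where "h = (if ht m \<ge> 0 then 1 else - 1)"
  have "h\<^sup>2 = 1" "1 + h * ht m > 0" by (simp_all add: h_def)
  moreover have Q: "fst m \<in> Sp2" using m by (simp add: M14_iff)
  have "fst ((qadj (fst m) **\<^sub>H fst m) $ 2 $ 2) > 0"
    by (simp add: Sp2_left[OF Q]) (simp add: qreal_def)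
  ultimately show ?thesis using that[of "qadj (fst m)" h] Sp2_qadj[OF Q] m by (simp add: mdom_def)
qed

lemma chart_at:
  assumes "m \<in> M14" obtains c where "c \<in> Charts" "m \<in> chart_dom c"
  using mchart_at[OF assms] mchart_Charts dom_mchart by metis

lemma dpr_zero_vert:
  assumes c: "c \<in> Charts" and m: "m \<in> chart_dom c" and V: "V \<in> TM m" and 0: "dpr c m V = 0"
  obtains v where "V = vert m v"
proof -
  have "hor r1 m V = 0"
  proof (rule dpr_inj_Hor[OF c m])
    show "hor r1 m V \<in> Hor m" by (rule hor_Hor[OF dom_M14[OF m] V])
    show "0 \<in> Hor m" by (rule subspace_0[OF subspace_Hor[OF dom_M14[OF m]]])
    show "dpr c m (hor r1 m V) = dpr c m 0"
      by (simp add: dpr_hor[OF c m] 0 linear_0[OF chart_linear_dpr[OF c m]])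
  qed
  then show ?thesis using that unfolding hor_def by (metis eq_iff_diff_eq_0)
qed

text \<open>The transition from an explicit chart to \<open>c\<close> is a diffeomorphism; its inverse followed by
  the section of the explicit chart is a section over the domain of \<open>c\<close>.\<close>

lemma local_section:
  assumes c: "c \<in> Charts" and m0: "m0 \<in> chart_dom c"
  obtains V s where "lsection c V s" "crd c m0 \<in> V" "s (crd c m0) = m0"
proof -
  note mM = dom_M14[OF m0]
  obtain P h where P: "P \<in> Sp2" "h\<^sup>2 = (1::real)" "m0 \<in> mdom P h" by (rule mchart_at[OF mM])
  let ?c0 = "mchart P h"
  have c0: "?c0 \<in> Charts" by (rule mchart_Charts[OF P(1,2)])
  note cs = csect[OF P(1,2)]
  define y0 where "y0 = crd ?c0 m0"
  have y0: "y0 \<in> cdom" unfolding y0_def by (rule cs(3)[OF P(3)])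
  obtain p where p: "p \<in> Sp1" "m0 = s3_act p (csect P h y0)" using cs(4)[OF P(3)] unfolding y0_def by blast
  define \<sigma> where "\<sigma> y = s3_act p (csect P h y)" for y
  have \<sigma>C: "Ck_on k \<sigma> cdom" for k
    unfolding \<sigma>_def[abs_def]
    by (rule Ck_on_linear_comp[OF bounded_linear_s3_act open_cdom Ck_on_csect])
  have \<sigma>: "\<sigma> y \<in> M14" "\<sigma> y \<in> chart_dom ?c0" "crd ?c0 (\<sigma> y) = y" if "y \<in> cdom" for y
    using cs(1,2)[OF that] mdom_M14[OF cs(1)[OF that]] p(1)
    by (simp_all add: \<sigma>_def s3_act_M14 crd_s3_act dom_mchart mdom_s3_act)
  obtain T where T: "open T" "chart_dom c = M14 \<inter> T" using c unfolding Charts_iff openin_open by blast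
  define U where "U = cdom \<inter> \<sigma> -` T"
  have U: "open U"
    unfolding U_def by (rule continuous_open_preimage[OF _ open_cdom T(1)]) (use \<sigma>C[of 0] in simp)
  have Uc: "y \<in> cdom" "\<sigma> y \<in> chart_dom c" if "y \<in> U" for y using that \<sigma>(1) by (auto simp: U_def T(2))
  have y0U: "y0 \<in> U" using y0 m0 p(2) by (auto simp: U_def T(2) \<sigma>_def)
  have \<sigma>U: "Ck_on k \<sigma> U" for k by (rule Ck_on_subset[OF \<sigma>C]) (use Uc in blast)
  define \<tau> where "\<tau> y = crd c (\<sigma> y)" for y
  have \<tau>C: "Ck_on k \<tau> U" for k
  proof (rule Ck_on_local[OF U])
    fix y assume y: "y \<in> U"
    obtain W g where W: "open W" "\<sigma> y \<in> W" "\<And>k. Ck_on k g W" "\<And>x. x \<in> M14 \<inter> W \<Longrightarrow> x \<in> chart_dom c \<and> g x = crd c x"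
      by (rule chart_crd_extension[OF c Uc(2)[OF y]]) blast
    let ?V = "U \<inter> \<sigma> -` W"
    have V: "open ?V" by (rule continuous_open_preimage[OF _ U W(1)]) (use \<sigma>U[of 0] in simp)
    have "Ck_on k (\<lambda>y. g (\<sigma> y)) ?V"
      by (rule Ck_on_compose[OF V W(1) Ck_on_subset[OF \<sigma>U] W(3)]) auto
    then have "Ck_on k \<tau> ?V"
      by (rule Ck_on_cong[OF V, rotated]) (use W(4) \<sigma>(1) Uc(1) in \<open>auto simp: \<tau>_def\<close>)
    then show "\<exists>V. open V \<and> y \<in> V \<and> Ck_on k \<tau> V" using V y W(2) by blast
  qed
  \<comment> \<open>Equal coordinates in \<open>c\<close> mean equal fibres, hence equal coordinates
    in the explicit chart, of which \<sigma> is a section.\<close>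
  have inj: "inj_on \<tau> U"
  proof (rule inj_onI)
    fix y y' assume y: "y \<in> U" "y' \<in> U" "\<tau> y = \<tau> y'"
    then obtain q where q: "q \<in> Sp1" "\<sigma> y' = s3_act q (\<sigma> y)"
      using crd_eqD[OF c Uc(2) Uc(2)] unfolding \<tau>_def by metis
    then have "crd ?c0 (\<sigma> y') = crd ?c0 (\<sigma> y)" using crd_s3_act[OF \<sigma>(1)[OF Uc(1)[OF y(1)]] q(1)] by simp
    then show "y = y'" using \<sigma>(3) Uc(1) y(1,2) by simp
  qed
  have dinj: "inj (fder \<tau> y)" if y: "y \<in> U" for y
  proof -
    let ?D = "fder \<sigma> y"
    have \<sigma>M: "\<And>x. x \<in> U \<Longrightarrow> \<sigma> x \<in> M14" using \<sigma>(1) Uc(1) by blast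
    have "(\<tau> has_derivative (\<lambda>v. dpr c (\<sigma> y) (?D v))) (at y)"
      unfolding \<tau>_def[abs_def] by (rule section_derivative[OF Charts_prechart[OF c] U y \<sigma>U \<sigma>M Uc(2)[OF y]])
    then have D: "fder \<tau> y = (\<lambda>v. dpr c (\<sigma> y) (?D v))" "linear (\<lambda>v. dpr c (\<sigma> y) (?D v))"
      using frechet_derivative_at has_derivative_linear by metis+
    \<comment> \<open>A tangent vector killed by the differential of \<open>c\<close> is vertical,
      hence killed in the explicit chart too; there the section property returns v.\<close>
    have "v = 0" if z: "dpr c (\<sigma> y) (?D v) = 0" for v
    proof -
      have T: "?D v \<in> TM (\<sigma> y)" by (rule section_tangent[OF U y \<sigma>U \<sigma>M])
      obtain w where w: "?D v = vert (\<sigma> y) w" by (rule dpr_zero_vert[OF c Uc(2)[OF y] T z])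
      have "dpr ?c0 (\<sigma> y) (?D v) = v"
        by (rule section_dpr[OF Charts_prechart[OF c0] U y \<sigma>U \<sigma>M \<sigma>(2)[OF Uc(1)[OF y]]]) (use \<sigma>(3) Uc(1) in blast)+
      then show ?thesis unfolding w dpr_vert[OF c0 \<sigma>(2)[OF Uc(1)[OF y]]] by simp
    qed
    then show ?thesis unfolding D(1) using linear_injective_0[OF D(2)] by blast
  qed
  note inv = Ck_on_inv_into[OF U \<tau>C inj dinj]
  let ?s = "\<lambda>y. \<sigma> (inv_into U \<tau> y)"
  show ?thesis
  proof (rule that)
    have "Ck_on k ?s (\<tau> ` U)" for k
      by (rule Ck_on_compose[OF inv(1) U inv(2) \<sigma>U]) (auto intro: inv_into_into)
    moreover have "?s y \<in> chart_dom c" "crd c (?s y) = y" if "y \<in> \<tau> ` U" for y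
      using Uc(2)[OF inv_into_into[OF that]] f_inv_into_f[OF that] by (simp_all add: \<tau>_def)
    ultimately show "lsection c (\<tau> ` U) ?s" using inv(1) by (simp add: lsection_def)
    have "\<tau> y0 = crd c m0" by (simp add: \<tau>_def \<sigma>_def p(2)[symmetric])
    then show "crd c m0 \<in> \<tau> ` U" "?s (crd c m0) = m0"
      using y0U inv_into_f_f[OF inj y0U] by (metis imageI, simp add: \<sigma>_def p(2)[symmetric])
  qed
qed

lemma lsectionD:
  assumes "lsection c V s"
  shows "open V" "Ck_on k s V" "y \<in> V \<Longrightarrow> s y \<in> chart_dom c" "y \<in> V \<Longrightarrow> crd c (s y) = y" "y \<in> V \<Longrightarrow> s y \<in> M14"
  using assms dom_M14 unfolding lsection_def by blast+

lemma lsection_TM: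
  assumes s: "lsection c V s" and y: "y \<in> V"
  shows "fder s y v \<in> TM (s y)"
  by (rule section_tangent[OF lsectionD(1)[OF s] y lsectionD(2)[OF s]]) (rule lsectionD(5)[OF s])

lemma lsection_dpr:
  assumes c: "c \<in> Charts" and s: "lsection c V s" and y: "y \<in> V"
  shows "dpr c (s y) (fder s y v) = v"
  by (rule section_dpr[OF Charts_prechart[OF c] lsectionD(1)[OF s] y lsectionD(2)[OF s]])
    (use lsectionD[OF s] y in auto)

text \<open>The partial derivatives of a section lift the coordinate vectors smoothly but not
  horizontally, whence the correction by the moments. The formula exhibits the metric as a smooth
  function of the coordinates.\<close>

lemma gram_section:
  assumes c: "c \<in> Charts" and s: "lsection c V s" and y: "y \<in> V"
  shows "gr c y $ i $ j = (let D = fder s y in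
    met (s y) (D (axis i 1)) (D (axis j 1)) - moment r1 (s y) (D (axis i 1)) \<bullet> moment r1 (s y) (D (axis j 1)) / fibre_norm r1 (s y))"
proof -
  have "gr c y $ i $ j = axis i 1 \<bullet> (gr c y *v axis j 1)"
    by (simp add: matrix_vector_mul_component inner_axis inner_commute[of "axis i 1"] matrix_vector_mult_basis column_def)
  then show ?thesis
    using gram_eq_tangent[OF c lsectionD(3)[OF s y] lsection_TM[OF s y] lsection_TM[OF s y],
      of "axis i 1" "axis j 1"]
    unfolding lsection_dpr[OF c s y] lsectionD(4)[OF s y] Let_def by simp
qed

lemma Ck_on_gram:
  assumes c: "c \<in> Charts" and s: "lsection c V s"
  shows "Ck_on k (\<lambda>y. gr c y $ i $ j) V"
proof (rule Ck_on_cong[OF lsectionD(1)[OF s], rotated])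
  note V = lsectionD(1)[OF s]
  have sC: "Ck_on k s V" for k by (rule lsectionD(2)[OF s])
  have DC: "Ck_on k (\<lambda>y. fder s y v) V" for v using sC[of "Suc k"] by simp
  have f: "fibre_norm r1 m \<noteq> 0" for m using fibre_norm_pos[of m] by simp
  have mom: "Ck_on k (\<lambda>y. moment r1 (s y) (fder s y v)) V" for v
    unfolding moment_def
    by (intro Ck_on_intros V sC DC)
  show "Ck_on k (\<lambda>y. let D = fder s y in
    met (s y) (D (axis i 1)) (D (axis j 1)) - moment r1 (s y) (D (axis i 1)) \<bullet> moment r1 (s y) (D (axis j 1)) / fibre_norm r1 (s y)) V"
    unfolding Let_def
  proof (intro Ck_on_diff Ck_on_divide Ck_on_inner f V mom)
    show "Ck_on k (\<lambda>y. met (s y) (fder s y (axis i 1)) (fder s y (axis j 1))) V"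
      unfolding M14_metric_def Sp2_metric_def Let_def
      by (intro Ck_on_intros V sC DC)
    show "Ck_on k (\<lambda>y. fibre_norm r1 (s y)) V"
      unfolding fibre_norm_def power2_norm_eq_inner by (intro Ck_on_intros V sC)
  qed
qed (simp only: gram_section[OF c s])

lemma gram_det_pos: "c \<in> Charts \<Longrightarrow> m \<in> chart_dom c \<Longrightarrow> det (gr c (crd c m)) > 0"
  using posdef_det_pos gram_pos by blast


section \<open>The gradient\<close>

text \<open>The gradient of t1 on the unit sphere: the first unit vector projected to the tangent
  space.\<close>

definition grad14 :: "m14 \<Rightarrow> m14" where
  "grad14 m = (0, (1, 0) - ht m *\<^sub>R snd m)"

lemma grad14_TM: assumes m: "m \<in> M14" shows "grad14 m \<in> TM m"
proof -
  have "snd m \<bullet> snd m = 1" using m by (simp add: M14_iff S4_def norm_eq_1)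
  then have "snd m \<bullet> ((1, 0) - ht m *\<^sub>R snd m) = 0"
    by (simp add: inner_diff_right inner_prod_def[of _ "(1, 0)"])
  moreover have "(0 :: qmat) = fst m **\<^sub>H lie 0" using linear_0[OF linear_lie] by simp
  ultimately show ?thesis unfolding TM_eq[OF m] grad14_def by blast
qed

text \<open>The quaternion part of the gradient is the real multiple -t1 t2 of t2, and t2 times its
  conjugate is real.\<close>

lemma moment_grad14: "moment r1 m (grad14 m) = 0"
  by (simp add: moment_def grad14_def qmul_minus qmul_scaleR qmul_qcnj scaleR_qreal) (simp add: qreal_def)

lemma grad14_Hor: "m \<in> M14 \<Longrightarrow> grad14 m \<in> Hor m"
  by (simp add: horizontal_iff grad14_TM moment_grad14)

lemma metric_grad14:
  assumes m: "m \<in> M14" and V: "V \<in> TM m" shows "met m V (grad14 m) = fst (snd V)"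
proof -
  have "snd m \<bullet> snd V = 0" using V unfolding TM_eq[OF m] by auto
  then have "snd V \<bullet> ((1, 0) - ht m *\<^sub>R snd m) = fst (snd V)"
    by (simp add: inner_diff_right inner_prod_def[of _ "(1, 0)"] inner_commute[of "snd V"])
  then show ?thesis by (simp add: M14_metric_def Sp2_metric_def grad14_def)
qed

lemma fst_grad14: "fst (snd (grad14 m)) = 1 - (ht m)\<^sup>2"
  by (simp add: grad14_def power2_eq_square)

end

locale berger_function = berger +
  fixes F :: "m14 set \<Rightarrow> real"
  assumes F_pi1: "\<forall>m\<in>M14. F (pi1 m) = f14 m"
begin

abbreviation "N \<equiv> N11 r1 r2"

lemma F_proj: "m \<in> M14 \<Longrightarrow> F (\<pi> m) = ht m"
  using F_pi1 by (cases m) (auto simp: pi1_def)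

lemma N_simps: "points N = M14 // s3_rel" "charts N = Charts" "gram N = gr"
  by (simp_all add: N11_def riemannian_quotient_def)

lemma coord_rep_crd:
  assumes c: "c \<in> Charts" and m: "m \<in> chart_dom c" shows "coord_rep c F (crd c m) = ht m"
proof -
  have "inj_on (snd c) (fst c)" using c by (simp add: Charts_iff)
  then have "inv_into (fst c) (snd c) (crd c m) = \<pi> m"
    using m by (simp add: crd_def chart_dom_def)
  then show ?thesis by (simp add: coord_rep_def F_proj[OF dom_M14[OF m]])
qed

lemma Ck_on_coord_rep:
  assumes c: "c \<in> Charts" and s: "lsection c V s"
  shows "Ck_on k (coord_rep c F) V"
proof (rule Ck_on_cong[OF lsectionD(1)[OF s], rotated])
  show "Ck_on k (\<lambda>y. fst (snd (s y))) V"
    by (intro Ck_on_intros lsectionD[OF s])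
  show "fst (snd (s y)) = coord_rep c F y" if "y \<in> V" for y
    using coord_rep_crd[OF c lsectionD(3)[OF s that]] lsectionD(4)[OF s that] by simp
qed

lemma coord_rep_derivative:
  assumes c: "c \<in> Charts" and m: "m \<in> chart_dom c"
  shows "(coord_rep c F has_derivative fder (coord_rep c F) (crd c m)) (at (crd c m))"
    "V \<in> TM m \<Longrightarrow> fder (coord_rep c F) (crd c m) (dpr c m V) = fst (snd V)"
proof -
  obtain U s where s: "lsection c U s" "crd c m \<in> U" by (rule local_section[OF c m]) blast
  show D: "(coord_rep c F has_derivative fder (coord_rep c F) (crd c m)) (at (crd c m))"
    by (rule Ck_on_D[OF Ck_on_coord_rep[OF c s(1)] lsectionD(1)[OF s(1)] s(2)])
  assume V: "V \<in> TM m"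
  obtain \<gamma> where \<gamma>: "\<And>s. \<gamma> s \<in> M14" "\<gamma> 0 = m" "velocity \<gamma> V"
    using V by (rule tangent_spaceE) blast
  obtain W g where W: "open W" "m \<in> W" "\<And>x. x \<in> M14 \<inter> W \<Longrightarrow> x \<in> chart_dom c \<and> g x = crd c x"
    by (rule chart_crd_extension[OF c m]) blast
  have ev: "\<forall>\<^sub>F s in at 0. coord_rep c F (crd c (\<gamma> s)) = fst (snd (\<gamma> s))"
    using eventually_curve[OF W(1) _ \<gamma>(3)] W(2,3) \<gamma>(1,2) coord_rep_crd[OF c] by (simp add: eventually_mono)
  have "velocity (\<lambda>s. fst (snd (\<gamma> s))) (fder (coord_rep c F) (crd c m) (dpr c m V))"
    using velocity_eventually[OF frechet_curve[OF Ck_on_coord_rep[OF c s(1)] lsectionD(1)[OF s(1)] _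
          chart_dpr_curve[OF c m \<gamma>]] ev] s(2) coord_rep_crd[OF c m] \<gamma>(2) by simp
  moreover have "velocity (\<lambda>s. fst (snd (\<gamma> s))) (fst (snd V))"
    by (rule linear_velocity[OF bounded_linear_fst
          linear_velocity[OF bounded_linear_snd \<gamma>(3)]])
  ultimately show "fder (coord_rep c F) (crd c m) (dpr c m V) = fst (snd V)"
    by (rule vector_derivative_unique_at)
qed

text \<open>Paired with any v, lifted to a horizontal V, both sides give the t1 component of V: the
  left one because F lifts to t1, the right one by \<open>metric_grad14\<close>.\<close>

lemma partial_coord_rep:
  assumes c: "c \<in> Charts" and m: "m \<in> chart_dom c"
  shows "(\<chi> i. partial i (coord_rep c F) (crd c m)) = gr c (crd c m) *v dpr c m (grad14 m)"
proof -
  note mM = dom_M14[OF m]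
  let ?D = "fder (coord_rep c F) (crd c m)"
  let ?P = "\<chi> i. partial i (coord_rep c F) (crd c m)"
  have lin: "linear ?D" using coord_rep_derivative(1)[OF c m] has_derivative_linear by blast
  have "v \<bullet> ?P = v \<bullet> (gr c (crd c m) *v dpr c m (grad14 m))" for v
  proof -
    have v: "?D v = v \<bullet> ?P"
      using linear_rep_axis[OF lin, of v] by (simp add: inner_vec_def partial_def)
    obtain V where V: "V \<in> Hor m" "dpr c m V = v" by (rule dpr_surj_Hor[OF c m]) blast
    then have T: "V \<in> TM m" by (simp add: horizontal_iff mM)
    show ?thesis
      using gram_eq[OF c m V(1) grad14_Hor[OF mM]] coord_rep_derivative(2)[OF c m T] v
      unfolding V(2) metric_grad14[OF mM T] by simp
  qed
  then show ?thesis using vector_eq_ldot by blast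
qed

lemma chart_grad_eq:
  assumes c: "c \<in> Charts" and m: "m \<in> chart_dom c"
  shows "chart_grad N c F (crd c m) = dpr c m (grad14 m)"
proof -
  have "invertible (gr c (crd c m))" using gram_det_pos[OF c m] by (simp add: invertible_det_nz)
  then have "matrix_inv (gr c (crd c m)) ** gr c (crd c m) = mat 1"
    unfolding invertible_def matrix_inv_def by (rule someI2_ex) blast
  then show ?thesis
    unfolding chart_grad_def partial_coord_rep[OF c m] N_simps by (simp add: matrix_vector_mul_assoc)
qed

lemma points_E: assumes "p \<in> points N" obtains m where "m \<in> M14" "p = \<pi> m"
  using assms unfolding N_simps proj_def by (rule quotientE)

lemma in_chart: "m \<in> M14 \<Longrightarrow> \<pi> m \<in> fst c \<longleftrightarrow> m \<in> chart_dom c"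
  by (simp add: chart_dom_def)

lemma grad_norm_sq_eq:
  assumes m: "m \<in> M14" shows "grad_norm_sq N F (\<pi> m) = 1 - (ht m)\<^sup>2"
proof -
  let ?g = "\<lambda>c. chart_grad N c F (snd c (\<pi> m)) \<bullet>
    (gr c (snd c (\<pi> m)) *v chart_grad N c F (snd c (\<pi> m)))"
  have eq: "chart_grad N c F (crd c m) \<bullet> (gr c (crd c m) *v chart_grad N c F (crd c m)) = 1 - (ht m)\<^sup>2"
    if c: "c \<in> Charts" "m \<in> chart_dom c" for c
    unfolding chart_grad_eq[OF c] gram_eq[OF c grad14_Hor[OF m] grad14_Hor[OF m]]
    by (simp add: metric_grad14[OF m grad14_TM[OF m]] fst_grad14)
  \<comment> \<open>A condition on all charts around the point determines a value only if there is
    such a chart.\<close>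
  obtain c where c: "c \<in> Charts" "m \<in> chart_dom c" by (rule chart_at[OF m])
  show ?thesis
    unfolding grad_norm_sq_def N_simps Let_def in_chart[OF m] comp_def[symmetric]
  proof (rule the_equality)
    show "\<forall>c\<in>Charts. m \<in> chart_dom c \<longrightarrow> ?g c = 1 - (ht m)\<^sup>2"
      using eq unfolding crd_def comp_def by blast
    fix t assume "\<forall>c\<in>Charts. m \<in> chart_dom c \<longrightarrow> ?g c = t"
    then show "t = 1 - (ht m)\<^sup>2" using eq[OF c] c unfolding crd_def comp_def by metis
  qed
qed

lemma smooth_F: "smooth_fun N F"
  unfolding smooth_fun_def N_simps
proof (intro ballI)
  fix c assume c: "c \<in> Charts"
  show "smooth_on (snd c ` fst c) (coord_rep c F)"
    unfolding Charts_image[OF c]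
  proof (rule smooth_on_openI)
    show op: "open (crd c ` chart_dom c)" using c Charts_image[OF c] by (simp add: Charts_iff)
    fix k show "Ck_on k (coord_rep c F) (crd c ` chart_dom c)"
    proof (rule Ck_on_local[OF op])
      fix y assume "y \<in> crd c ` chart_dom c"
      then obtain m where m: "m \<in> chart_dom c" "y = crd c m" by blast
      obtain V s where "lsection c V s" "crd c m \<in> V" by (rule local_section[OF c m(1)]) blast
      then have "open V \<and> y \<in> V \<and> Ck_on k (coord_rep c F) V"
        using Ck_on_coord_rep[OF c, of V s] lsectionD(1)[of c V s] m(2) by simp
      then show "\<exists>V. open V \<and> y \<in> V \<and> Ck_on k (coord_rep c F) V" by (rule exI)
    qed
  qed
qed

text \<open>Away from the poles the gradient itself has the nonzero t1 component 1 - t1^2; at the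
  poles every tangent vector of the sphere is orthogonal to the t1 axis.\<close>

lemma critical_iff:
  assumes m: "m \<in> M14" shows "critical_point N F (\<pi> m) \<longleftrightarrow> (ht m)\<^sup>2 = 1"
proof
  assume crit: "critical_point N F (\<pi> m)"
  obtain c where c: "c \<in> Charts" "m \<in> chart_dom c" by (rule chart_at[OF m])
  have "(coord_rep c F has_derivative (\<lambda>_. 0)) (at (crd c m))"
    using crit c m unfolding critical_point_def N_simps crd_def by (simp add: in_chart)
  then have "fder (coord_rep c F) (crd c m) = (\<lambda>_. 0)"
    using frechet_derivative_at by metis
  then show "(ht m)\<^sup>2 = 1"
    using coord_rep_derivative(2)[OF c grad14_TM[OF m]] fst_grad14[of m] by simp
next
  assume 1: "(ht m)\<^sup>2 = 1"
  have "(norm (hq m))\<^sup>2 = 0" using m 1 by (simp add: M14_iff S4_iff)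
  then have 2: "hq m = 0" by simp
  have z: "fst (snd V) = 0" if V: "V \<in> TM m" for V
  proof -
    have "snd m \<bullet> snd V = 0" using V unfolding TM_eq[OF m] by auto
    then have "ht m * fst (snd V) = 0" by (simp add: inner_prod_def[of "snd m"] 2)
    then show ?thesis using 1 by auto
  qed
  have "(coord_rep c F has_derivative (\<lambda>_. 0)) (at (crd c m))" if c: "c \<in> Charts" "m \<in> chart_dom c" for c
  proof -
    have "fder (coord_rep c F) (crd c m) v = 0" for v
    proof -
      obtain V where "V \<in> TM m" "dpr c m V = v" by (rule dpr_surj[OF c])
      then show ?thesis using coord_rep_derivative(2)[OF c] z by metis
    qed
    then have "fder (coord_rep c F) (crd c m) = (\<lambda>_. 0)" by (rule ext)
    then show ?thesis using coord_rep_derivative(1)[OF c] by simp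
  qed
  moreover have "\<pi> m \<in> M14 // s3_rel" unfolding proj_def using m by (rule quotientI)
  ultimately show "critical_point N F (\<pi> m)"
    unfolding critical_point_def N_simps crd_def by (simp add: in_chart m)
qed

end


section \<open>The Laplacian\<close>

text \<open>The product rule separates the trace of the derivative, to be supplied by Jacobi's
  formula, from the logarithmic derivative of the density along X.\<close>

lemma weighted_divergence:
  fixes \<beta> :: "real^'n \<Rightarrow> real" and X :: "real^'n \<Rightarrow> real^'n"
  assumes \<beta>: "(\<beta> has_derivative \<beta>') (at u)" "\<beta> u \<noteq> 0" and X: "(X has_derivative X') (at u)"
  shows "(\<Sum>i\<in>UNIV. partial i (\<lambda>w. \<beta> w * X w $ i) u) / \<beta> u
    = (\<Sum>i\<in>UNIV. X' (axis i 1) $ i) + (\<Sum>i\<in>UNIV. X u $ i * \<beta>' (axis i 1)) / \<beta> u"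
proof -
  have "partial i (\<lambda>w. \<beta> w * X w $ i) u = \<beta> u * (X' (axis i 1) $ i) + \<beta>' (axis i 1) * X u $ i" for i
  proof -
    have 1: "((\<lambda>w. \<beta> w * X w $ i) has_derivative (\<lambda>v. \<beta> u * (X' v $ i) + \<beta>' v * X u $ i)) (at u)"
      by (rule has_derivative_mult[OF \<beta>(1) bounded_linear.has_derivative[OF bounded_linear_vec_nth X]])
    show ?thesis
      using fun_cong[OF frechet_derivative_at[OF 1], of "axis i 1"] by (simp add: partial_def)
  qed
  then have "(\<Sum>i\<in>UNIV. partial i (\<lambda>w. \<beta> w * X w $ i) u)
    = \<beta> u * (\<Sum>i\<in>UNIV. X' (axis i 1) $ i) + (\<Sum>i\<in>UNIV. X u $ i * \<beta>' (axis i 1))"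
    by (simp add: sum.distrib sum_distrib_left mult.commute)
  then show ?thesis using \<beta>(2) by (simp add: add_divide_distrib)
qed

lemma prod_Basis_prod:
  "(\<Prod>b\<in>(Basis :: ('a::euclidean_space \<times> 'b::euclidean_space) set). f b) = (\<Prod>i\<in>Basis. f (i, 0)) * (\<Prod>i\<in>Basis. f (0, i))"
proof -
  have "inj_on (\<lambda>u. (u::'a, 0::'b)) Basis" "inj_on (\<lambda>u. (0::'a, u::'b)) Basis"
    by (auto intro!: inj_onI)
  moreover have "(\<lambda>u. (u::'a, 0::'b)) ` Basis \<inter> (\<lambda>u. (0::'a, u::'b)) ` Basis = {}"
    by auto
  ultimately show ?thesis
    unfolding Basis_prod_def by (subst prod.union_disjoint) (auto simp: prod.reindex)
qed

section \<open>The metric in the frame and its determinant\<close>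

type_synonym frame = "real \<times> (real^3) \<times> quat \<times> (real^3)"

context berger
begin

text \<open>The Killing fields of the \<open>Sp(2)\<close>-action and the gradient, along a curve on which \<open>Q\<close>
  is constant.\<close>

definition frame_vec :: "m14 \<Rightarrow> frame \<Rightarrow> m14" where
  "frame_vec m e = fst e *\<^sub>R grad14 m + (fst m **\<^sub>H lie (snd e), 0)"

text \<open>The quotient metric in the frame. In the Sp(2) directions only the x coefficient differs
  from that of \<open>Sp2_metric\<close>, because the first component of a vertical vector has only
  an x entry.\<close>

definition frame_form :: "real \<Rightarrow> frame \<Rightarrow> frame \<Rightarrow> real" where
  "frame_form t e e' = (1 - t\<^sup>2) * (fst e * fst e')
    + r1 / 2 * (1 - t\<^sup>2) / (r1 / 2 + (1 - t\<^sup>2)) * (fst (snd e) \<bullet> fst (snd e'))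
    + fst (snd (snd e)) \<bullet> fst (snd (snd e')) + r2 / 2 * (snd (snd (snd e)) \<bullet> snd (snd (snd e')))"

definition lap_rhs :: "real \<Rightarrow> real" where
  "lap_rhs t = - (1 + 3 / (1 + 2 / r1 * (1 - t\<^sup>2))) * t"

text \<open>Both cubes come from the three imaginary units, in x and in z; the four y directions
  contribute factors 1.\<close>

definition frame_det :: "real \<Rightarrow> real" where
  "frame_det t = (1 - t\<^sup>2) * (r1 / 2 * (1 - t\<^sup>2) / (r1 / 2 + (1 - t\<^sup>2)))^3 * (r2 / 2)^3"

lemma lie_TM: assumes m: "m \<in> M14" shows "(fst m **\<^sub>H lie w, 0) \<in> TM m"
  unfolding TM_eq[OF m] using inner_zero_right by blast

lemma frame_vec_TM: "m \<in> M14 \<Longrightarrow> frame_vec m e \<in> TM m"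
  unfolding frame_vec_def
  by (intro subspace_add subspace_scale subspace_TM grad14_TM lie_TM)

lemma norm_snd_M14: "m \<in> M14 \<Longrightarrow> (norm (hq m))\<^sup>2 = 1 - (ht m)\<^sup>2"
  by (simp add: M14_iff S4_iff)

lemma frame_gram:
  assumes c: "c \<in> Charts" and m: "m \<in> chart_dom c"
  shows "dpr c m (frame_vec m e) \<bullet> (gr c (crd c m) *v dpr c m (frame_vec m e')) = frame_form (ht m) e e'"
proof -
  note mM = dom_M14[OF m]
  have Q: "fst m \<in> Sp2" using mM by (simp add: M14_iff)
  let ?L = "\<lambda>e. (fst m **\<^sub>H lie (snd e), 0 :: real \<times> quat)"
  let ?S = "r1 / 2 * (fst (snd e) \<bullet> fst (snd e')) + fst (snd (snd e)) \<bullet> fst (snd (snd e')) + r2 / 2 * (snd (snd (snd e)) \<bullet> snd (snd (snd e')))"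
  note lin = linear_M14_metric[of r1 r2 m]
  have "met m (?L e) (grad14 m) = 0" for e
    using metric_grad14[OF mM lie_TM[OF mM, of "snd e"]] by simp
  note g0 = this this[unfolded M14_metric_commute[of r1 r2 m _ "grad14 m"]]
  have "met m (frame_vec m e) (frame_vec m e') = fst e' * met m (frame_vec m e) (grad14 m) + met m (frame_vec m e) (?L e')"
    unfolding frame_vec_def[of m e'] linear_add[OF lin] linear_cmul[OF lin] by simp
  also have "met m (frame_vec m e) (grad14 m) = fst e * (1 - (ht m)\<^sup>2)"
    unfolding metric_grad14[OF mM frame_vec_TM[OF mM]] by (simp add: frame_vec_def fst_grad14)
  also have "met m (frame_vec m e) (?L e') = met m (?L e') (frame_vec m e)" by (rule M14_metric_commute)
  also have "\<dots> = met m (?L e') (?L e)"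
    unfolding frame_vec_def[of m e] linear_add[OF lin] linear_cmul[OF lin] g0 by simp
  also have "\<dots> = ?S"
    by (simp add: M14_metric_def Sp2_metric_lie[OF Q] inner_commute)
  finally have 1: "met m (frame_vec m e) (frame_vec m e') = fst e' * (fst e * (1 - (ht m)\<^sup>2)) +
     ?S" .
  have "moment r1 m (frame_vec m e) = - (r1 / 2) *\<^sub>R fst (snd e)" for e
    unfolding frame_vec_def linear_add[OF linear_moment] linear_cmul[OF linear_moment] moment_grad14
    by (simp add: moment_def Q)
  then have 2: "moment r1 m (frame_vec m e) \<bullet> moment r1 m (frame_vec m e') = r1 / 2 * (r1 / 2) * (fst (snd e) \<bullet> fst (snd e'))"
    by simp
  have f: "fibre_norm r1 m = r1 / 2 + (1 - (ht m)\<^sup>2)" by (simp add: fibre_norm_def norm_snd_M14[OF mM])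
  \<comment> \<open>With k = r1 / 2 and n = 1 - t^2, the fibre turns the coefficient k of the x
    block into k - k^2 / (k + n), that is, half the harmonic mean of k and n.\<close>
  have key: "k * a - k * k * a / (k + n) = k * n / (k + n) * a" if "k + n > 0" for k n a :: real
    using that by (simp add: field_simps)
  have "r1 / 2 + (1 - (ht m)\<^sup>2) > 0" using fibre_norm_pos[of m] f by simp
  from key[OF this, of "fst (snd e) \<bullet> fst (snd e')"] show ?thesis
    unfolding gram_eq_tangent[OF c m frame_vec_TM[OF mM] frame_vec_TM[OF mM]] 1 2 f frame_form_def
    by (simp add: algebra_simps)
qed

lemma frame_Basis_cases:
  assumes "b \<in> (Basis :: frame set)"
  obtains "b = (1, 0, 0, 0)" | x where "x \<in> Basis" "b = (0, x, 0, 0)" | y where "y \<in> Basis" "b = (0, 0, y, 0)"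
    | z where "z \<in> Basis" "b = (0, 0, 0, z)"
  using assms unfolding Basis_prod_def by (auto simp: zero_prod_def)

lemma frame_form_Basis:
  assumes "b \<in> Basis" "b' \<in> Basis" "b \<noteq> b'" shows "frame_form t b b' = 0"
  using assms(3)
  by (cases rule: frame_Basis_cases[OF assms(1)]; cases rule: frame_Basis_cases[OF assms(2)])
    (auto simp: frame_form_def inner_Basis)

lemma frame_form_prod: "(\<Prod>b\<in>Basis. frame_form t b b) = frame_det t"
  unfolding prod_Basis_prod frame_det_def
  by (simp add: frame_form_def inner_same_Basis)

lemma frame_det_pos: assumes "t\<^sup>2 < 1" shows "frame_det t > 0"
proof -
  have "1 - t\<^sup>2 > 0" using assms by simp
  then show ?thesis using r1_pos r2_pos by (simp add: frame_det_def add_pos_pos)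
qed

text \<open>The right-hand side is arranged for the chain rule along the gradient: there t has speed
  1 - t^2, so the logarithmic derivative becomes twice \<open>lap_rhs\<close>.\<close>

lemma frame_det_derivative:
  assumes t: "t\<^sup>2 < 1"
  shows "(frame_det has_real_derivative lap_rhs t * 2 * frame_det t / (1 - t\<^sup>2)) (at t)"
proof -
  define k n where "k = r1 / 2" and "n = 1 - t\<^sup>2"
  have k: "k > 0" and n: "n > 0" using r1_pos t by (auto simp: k_def n_def)
  have r1: "r1 = 2 * k" by (simp add: k_def)
  have dn: "((\<lambda>t. 1 - t\<^sup>2) has_real_derivative - 2 * t) (at t)"
    by (auto intro!: derivative_eq_intros)
  define D where "D = (k * (- 2 * t) * (k + n) - k * n * (0 + - 2 * t)) / ((k + n) * (k + n))"
  have dq: "((\<lambda>t. k * (1 - t\<^sup>2) / (k + (1 - t\<^sup>2))) has_real_derivative D) (at t)"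
    unfolding D_def n_def using k n
    by (intro DERIV_divide DERIV_cmult DERIV_add DERIV_const dn) (simp add: n_def)
  define q where "q = k * n / (k + n)"
  \<comment> \<open>Exhibits D as a multiple of q, so that the whole determinant can be factored out
    of its derivative.\<close>
  have D: "D = (- 2 * t) * q * (k / (k + n)) / n"
  proof -
    have "D = (- 2 * t) * ((k / (k + n)) * (k / (k + n)))"
      unfolding D_def by (simp add: algebra_simps)
    moreover have "q / n = k / (k + n)" using n by (simp add: q_def)
    moreover have "(- 2 * t) * q * (k / (k + n)) / n = (- 2 * t) * (q / n * (k / (k + n)))" by (simp add: mult_ac)
    ultimately show ?thesis by (simp only:)
  qed
  have "(frame_det has_real_derivative ((- 2 * t) * q^3 + (of_nat 3 * (D * q^(3 - Suc 0))) * n) * (r2 / 2)^3) (at t)"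
    using DERIV_cmult_right[OF DERIV_mult[OF dn DERIV_power[OF dq, of 3]], of "(r2 / 2)^3"]
    unfolding frame_det_def[abs_def] k_def[symmetric] n_def[symmetric] q_def[symmetric] .
  moreover have "((- 2 * t) * q^3 + (of_nat 3 * (D * q^(3 - Suc 0))) * n) * (r2 / 2)^3
     = - (1 + 3 / (1 + 2 / r1 * n)) * t * 2 * (n * q^3 * (r2 / 2)^3) / n"
  proof -
    have a: "3 / (1 + 2 / r1 * n) = 3 * (k / (k + n))" using k n by (simp add: r1 field_simps)
    have b: "D * n = (- 2 * t) * q * (k / (k + n))" using n by (simp add: D)
    have "(of_nat 3 * (D * q^(3 - Suc 0))) * n = 3 * (D * n) * q\<^sup>2" by (simp add: numeral_3_eq_3 power2_eq_square)
    also have "\<dots> = - 2 * t * (3 * (k / (k + n))) * q^3" unfolding b by (simp add: power2_eq_square power3_eq_cube)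
    finally have e: "(of_nat 3 * (D * q^(3 - Suc 0))) * n = - 2 * t * (3 * (k / (k + n))) * q^3" .
    have "x * (n * y * z) / n = x * (y * z)" for x y z using n by simp
    then show ?thesis unfolding a e by (simp only:) (simp add: algebra_simps)
  qed
  ultimately show ?thesis
    unfolding frame_det_def lap_rhs_def k_def[symmetric] n_def[symmetric] q_def[symmetric] by simp
qed

end

section \<open>The Laplacian at regular points and at the poles\<close>

context berger_function
begin

text \<open>The gradient solves a linear system whose matrix is the metric, so smoothness follows
  from Cramer's rule.\<close>

lemma Ck_on_chart_grad:
  assumes c: "c \<in> Charts" and s: "lsection c V s"
  shows "Ck_on k (chart_grad N c F) V"
proof (rule Ck_on_solve[OF lsectionD(1)[OF s], where A = "gr c" and b = "\<lambda>y. \<chi> i. partial i (coord_rep c F) y"])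
  show "Ck_on k (\<lambda>y. gr c y $ i $ j) V" for i j by (rule Ck_on_gram[OF c s])
  show "Ck_on k (\<lambda>y. (\<chi> i. partial i (coord_rep c F) y) $ i) V" for i
    using Ck_on_coord_rep[OF c s, of "Suc k"] by (simp add: partial_def)
  fix y assume y: "y \<in> V"
  note sy = lsectionD(3,4)[OF s y]
  show "det (gr c y) \<noteq> 0" using gram_det_pos[OF c sy(1)] sy(2) by simp
  show "gr c y *v chart_grad N c F y = (\<chi> i. partial i (coord_rep c F) y)"
    using partial_coord_rep[OF c sy(1)] chart_grad_eq[OF c sy(1)] sy(2) by simp
qed

definition vol :: "(m14 set, 11) chart \<Rightarrow> real^11 \<Rightarrow> real" where
  "vol c y = sqrt (det (gr c y))"

lemma vol_pos: "c \<in> Charts \<Longrightarrow> m \<in> chart_dom c \<Longrightarrow> vol c (crd c m) > 0"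
  by (simp add: vol_def gram_det_pos)

lemma Ck_on_vol:
  assumes c: "c \<in> Charts" and s: "lsection c V s"
  shows "Ck_on k (vol c) V"
  unfolding vol_def[abs_def]
proof (rule Ck_on_sqrt[OF lsectionD(1)[OF s] Ck_on_det[OF lsectionD(1)[OF s] Ck_on_gram[OF c s]]])
  show "det (gr c y) > 0" if "y \<in> V" for y
    using gram_det_pos[OF c lsectionD(3)[OF s that]] lsectionD(4)[OF s that] by simp
qed

abbreviation "lap c \<equiv> chart_div N c (chart_grad N c F)"

lemma lap_formula:
  assumes c: "c \<in> Charts" and s: "lsection c V s" and y: "y \<in> V"
  shows "lap c y = (\<Sum>i\<in>UNIV. fder (chart_grad N c F) y (axis i 1) $ i) +
    (\<Sum>i\<in>UNIV. chart_grad N c F y $ i * fder (vol c) y (axis i 1)) / vol c y"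
proof -
  have "vol c y \<noteq> 0" using vol_pos[OF c lsectionD(3)[OF s y]] lsectionD(4)[OF s y] by simp
  from weighted_divergence[OF Ck_on_D[OF Ck_on_vol[OF c s] lsectionD(1)[OF s] y] this
      Ck_on_D[OF Ck_on_chart_grad[OF c s] lsectionD(1)[OF s] y]]
  show ?thesis unfolding chart_div_def N_simps vol_def[symmetric] .
qed

text \<open>Needed at the poles, where the Laplacian is reached only as a limit.\<close>

lemma continuous_on_lap:
  assumes c: "c \<in> Charts" and s: "lsection c V s"
  shows "continuous_on V (lap c)"
proof -
  have X: "continuous_on V (chart_grad N c F)" "continuous_on V (\<lambda>y. fder (chart_grad N c F) y v)" for v
    using Ck_on_chart_grad[OF c s, of 0] Ck_on_chart_grad[OF c s, of "Suc 0"] by simp_all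
  have b: "continuous_on V (vol c)" "continuous_on V (\<lambda>y. fder (vol c) y v)" for v
    using Ck_on_vol[OF c s, of 0] Ck_on_vol[OF c s, of "Suc 0"] by simp_all
  have "vol c y \<noteq> 0" if "y \<in> V" for y
    using vol_pos[OF c lsectionD(3)[OF s that]] lsectionD(4)[OF s that] by simp
  then have "continuous_on V (\<lambda>y. (\<Sum>i\<in>UNIV. fder (chart_grad N c F) y (axis i 1) $ i) +
    (\<Sum>i\<in>UNIV. chart_grad N c F y $ i * fder (vol c) y (axis i 1)) / vol c y)"
    by (intro continuous_intros X b) blast
  then show ?thesis by (rule continuous_on_eq) (simp only: lap_formula[OF c s])
qed

text \<open>The frame fields commute with \<open>X = grad F\<close>, so along \<open>\<gamma>\<close> the frame matrix \<open>E\<close> satisfies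
  \<open>E' = DX E\<close> and Jacobi's formula turns the logarithmic derivative of
  \<open>det g (det E)\<^sup>2 = frame_det\<close> into twice the divergence of \<open>X\<close>.\<close>

lemma lap_regular:
  assumes c: "c \<in> Charts" and m: "m \<in> chart_dom c" and reg: "(ht m)\<^sup>2 < 1"
  shows "lap c (crd c m) = lap_rhs (ht m)"
proof -
  note mM = dom_M14[OF m]
  have Q: "fst m \<in> Sp2" and tS: "snd m \<in> S4" using mM by (auto simp: M14_iff)
  define u where "u = crd c m"
  define X where "X = chart_grad N c F"
  obtain V s where s: "lsection c V s" "u \<in> V" unfolding u_def by (rule local_section[OF c m]) blast
  note Vo = lsectionD(1)[OF s(1)]
  define DX where "DX = fder X u"
  define Db where "Db = fder (vol c) u"
  have XC: "Ck_on (Suc 0) X V" unfolding X_def by (rule Ck_on_chart_grad[OF c s(1)])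
  have linDX: "linear DX" unfolding DX_def using Ck_on_D[OF XC Vo s(2)] has_derivative_linear by blast
  have linDb: "linear Db"
    unfolding Db_def using Ck_on_D[OF Ck_on_vol[OF c s(1)] Vo s(2)] has_derivative_linear by blast
  have Xu: "X u = dpr c m (grad14 m)" unfolding X_def u_def by (rule chart_grad_eq[OF c m])
  obtain W g where W: "open W" "m \<in> W" "\<And>k. Ck_on k g W" "\<And>x. x \<in> M14 \<inter> W \<Longrightarrow> x \<in> chart_dom c \<and> g x = crd c x"
    by (rule chart_crd_extension[OF c m]) blast
  have dprW: "dpr c x v = fder g x v" if "x \<in> M14" "x \<in> W" "v \<in> TM x" for x v
    by (rule dpr_extension[OF c W(1) W(3) W(4) that])
  have gC: "Ck_on (Suc 0) (\<lambda>x. fder g x K) W" for K by (rule Ck_on_frechet[OF W(3)])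

  have "snd (grad14 m) \<in> tangent_space S4 (snd m)"
    using grad14_TM[OF mM] unfolding M14_def tangent_space_Times by (simp add: mem_Times_iff)
  then obtain \<gamma>2 where \<gamma>2: "\<And>r. \<gamma>2 r \<in> S4" "\<gamma>2 0 = snd m" "velocity \<gamma>2 (snd (grad14 m))"
    by (rule tangent_spaceE) blast
  \<comment> \<open>Keeping Q fixed makes the Killing fields constant ambient vectors along the
    curve. It only has to be tangent to the gradient at 0, since first derivatives at 0 are all that
    is used.\<close>
  define \<gamma> where "\<gamma> r = (fst m, \<gamma>2 r)" for r
  have \<gamma>M: "\<gamma> r \<in> M14" for r using \<gamma>2(1) Q by (simp add: \<gamma>_def M14_iff)
  have \<gamma>0: "\<gamma> 0 = m" by (simp add: \<gamma>_def \<gamma>2(2))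
  have "grad14 m = (0, snd (grad14 m))" by (simp add: grad14_def)
  then have \<gamma>': "velocity \<gamma> (grad14 m)"
    unfolding \<gamma>_def[abs_def] using has_vector_derivative_Pair[OF velocity_const \<gamma>2(3)] by metis
  have evW: "\<forall>\<^sub>F r in at 0. \<gamma> r \<in> W" by (rule eventually_curve[OF W(1) _ \<gamma>']) (simp add: \<gamma>0 W(2))
  have crd\<gamma>: "velocity (\<lambda>r. crd c (\<gamma> r)) (X u)"
    unfolding Xu by (rule chart_dpr_curve[OF c m \<gamma>M \<gamma>0 \<gamma>'])

  \<comment> \<open>1 + 3 + 4 + 3 = 11, so indexing the frame by the coordinates makes E a square
    matrix.\<close>
  have cardB: "card (UNIV :: 11 set) = card (Basis :: frame set)" by simp
  then obtain b :: "11 \<Rightarrow> frame" where b: "bij_betw b UNIV Basis"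
    using finite_same_card_bij[OF finite finite_Basis] by blast
  \<comment> \<open>The ambient extension g is used in place of \<open>dpr\<close> because its
    derivative can be differentiated once more; near 0 the two agree on the frame.\<close>
  define E where "E r = (\<chi> i. fder g (\<gamma> r) (frame_vec (\<gamma> r) (b i)))" for r
  have E: "E r $ i = dpr c (\<gamma> r) (frame_vec (\<gamma> r) (b i))" if "\<gamma> r \<in> W" for r i
    using dprW[OF \<gamma>M that frame_vec_TM[OF \<gamma>M]] by (simp add: E_def)

  have row: "velocity (\<lambda>r. E r $ i) (matrix DX *v (E 0 $ i))" for i
  proof -
    have E0: "E 0 $ i = dpr c m (frame_vec m (b i))" using E[of 0 i] W(2) by (simp add: \<gamma>0)
    have mDX: "matrix DX *v (E 0 $ i) = DX (E 0 $ i)" using fun_cong[OF matrix_vector_mul(2)[OF linDX]] by simp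
    have XX: "X (crd c x) = dpr c x (grad14 x)" if "x \<in> M14" "x \<in> W" for x
      unfolding X_def using chart_grad_eq[OF c] W(4) that by blast
    have "b i \<in> Basis" using b by (auto simp: bij_betw_def)
    then consider "b i = (1, 0)" | w where "b i = (0, w)" by (auto simp: Basis_prod_def)
    then show ?thesis
    proof cases
      case 1
      \<comment> \<open>The first frame vector is the gradient itself, so its row is X along the
        curve and the chain rule suffices.\<close>
      have fv: "frame_vec x (b i) = grad14 x" for x
        using linear_0[OF linear_lie] by (simp add: frame_vec_def 1 zero_prod_def[symmetric])
      have "velocity (\<lambda>r. X (crd c (\<gamma> r))) (fder X (crd c (\<gamma> 0)) (X u))"
        by (rule frechet_curve[OF XC Vo _ crd\<gamma>]) (use s(2) \<gamma>0 u_def in simp)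
      then have d: "velocity (\<lambda>r. X (crd c (\<gamma> r))) (DX (X u))"
        by (simp add: \<gamma>0 u_def[symmetric] DX_def)
      have e: "X (crd c (\<gamma> r)) = E r $ i" if "\<gamma> r \<in> W" for r
        unfolding E[OF that] fv XX[OF \<gamma>M that] ..
      have mX: "matrix DX *v (E 0 $ i) = DX (X u)"
        unfolding mDX by (simp add: E0 fv Xu)
      show ?thesis
        unfolding mX
      proof (rule velocity_eventually[OF d])
        show "\<forall>\<^sub>F r in at 0. X (crd c (\<gamma> r)) = E r $ i" using evW by eventually_elim (rule e)
        show "X (crd c (\<gamma> 0)) = E 0 $ i" by (rule e) (simp add: \<gamma>0 W(2))
      qed
    next
      case (2 w)
      define K where "K = (fst m **\<^sub>H lie w, 0 :: real \<times> quat)"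
      have fv: "frame_vec (\<gamma> r) (b i) = K" for r by (simp add: frame_vec_def 2 K_def \<gamma>_def)
      have K: "K \<in> TM m" unfolding K_def by (rule lie_TM[OF mM])
      have "fst m **\<^sub>H lie w \<in> tangent_space Sp2 (fst m)" unfolding tangent_space_Sp2[OF Q] by blast
      then obtain \<delta>1 where \<delta>1: "\<And>r. \<delta>1 r \<in> Sp2" "\<delta>1 0 = fst m" "velocity \<delta>1 (fst m **\<^sub>H lie w)"
        by (rule tangent_spaceE) blast
      \<comment> \<open>Moves only Q, so that \<open>grad14\<close> is constant along it. Together
        with \<gamma>, which moves only the sphere component, it replaces the commuting flows of K
        and of the gradient.\<close>
      define \<delta> where "\<delta> r = (\<delta>1 r, snd m)" for r
      have \<delta>M: "\<delta> r \<in> M14" for r using \<delta>1(1) tS by (simp add: \<delta>_def M14_iff)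
      have \<delta>0: "\<delta> 0 = m" by (simp add: \<delta>_def \<delta>1(2))
      have \<delta>': "velocity \<delta> K"
        unfolding \<delta>_def[abs_def] K_def by (rule has_vector_derivative_Pair[OF \<delta>1(3) velocity_const])
      have gd: "grad14 (\<delta> r) = grad14 m" for r by (simp add: grad14_def \<delta>_def)
      have "velocity (\<lambda>r. crd c (\<delta> r)) (dpr c m K)"
        by (rule chart_dpr_curve[OF c m \<delta>M \<delta>0 \<delta>'])
      from frechet_curve[OF XC Vo _ this]
      have 1: "velocity (\<lambda>r. X (crd c (\<delta> r))) (DX (dpr c m K))"
        using s(2) by (simp add: \<delta>0 u_def[symmetric] DX_def)
      have e: "X (crd c (\<delta> r)) = fder g (\<delta> r) (grad14 m)" if "\<delta> r \<in> W" for r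
        using XX[OF \<delta>M that] dprW[OF \<delta>M that grad14_TM[OF \<delta>M]] by (simp add: gd)
      have evd: "\<forall>\<^sub>F r in at 0. \<delta> r \<in> W" by (rule eventually_curve[OF W(1) _ \<delta>']) (simp add: \<delta>0 W(2))
      have "velocity (\<lambda>r. fder g (\<delta> r) (grad14 m)) (DX (dpr c m K))"
      proof (rule velocity_eventually[OF 1])
        show "\<forall>\<^sub>F r in at 0. X (crd c (\<delta> r)) = fder g (\<delta> r) (grad14 m)"
          using evd by eventually_elim (rule e)
        show "X (crd c (\<delta> 0)) = fder g (\<delta> 0) (grad14 m)" by (rule e) (simp add: \<delta>0 W(2))
      qed
      moreover have "velocity (\<lambda>r. fder g (\<delta> r) (grad14 m)) (fder (\<lambda>x. fder g x (grad14 m)) m K)"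
        using frechet_curve[OF gC W(1) _ \<delta>', of "grad14 m"] W(2) \<delta>0 by simp
      ultimately have "DX (dpr c m K) = fder (\<lambda>x. fder g x (grad14 m)) m K"
        by (rule vector_derivative_unique_at)
      \<comment> \<open>Symmetry of the second derivative of g stands for the vanishing bracket of K
        and the gradient.\<close>
      also have "\<dots> = fder (\<lambda>x. fder g x K) m (grad14 m)"
        by (rule symmetric_second_derivative[OF W(1,2) W(3)])
      finally have DXK: "DX (dpr c m K) = fder (\<lambda>x. fder g x K) m (grad14 m)" .
      have "E 0 $ i = dpr c m K" using E0 fv[of 0] by (simp add: \<gamma>0)
      moreover have "velocity (\<lambda>r. fder g (\<gamma> r) K) (fder (\<lambda>x. fder g x K) m (grad14 m))"
        using frechet_curve[OF gC W(1) _ \<gamma>', of K] W(2) \<gamma>0 by simp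
      moreover have "E r $ i = fder g (\<gamma> r) K" for r by (simp add: E_def fv)
      ultimately show ?thesis unfolding mDX by (simp add: DXK)
    qed
  qed

  have prod: "det (gr c (crd c (\<gamma> r))) * (det (E r))\<^sup>2 = frame_det (fst (\<gamma>2 r))" if r: "\<gamma> r \<in> W" for r
  proof -
    have d: "\<gamma> r \<in> chart_dom c" using W(4) \<gamma>M r by blast
    \<comment> \<open>The Gram matrix of the frame, whose entries no longer involve the chart; it is
      diagonal because distinct basis vectors are orthogonal for \<open>frame_form\<close>.\<close>
    let ?A = "E r ** gr c (crd c (\<gamma> r)) ** transpose (E r)"
    have A: "?A $ i $ j = frame_form (fst (\<gamma>2 r)) (b i) (b j)" for i j
    proof -
      have "?A $ i $ j = E r $ i \<bullet> (gr c (crd c (\<gamma> r)) *v E r $ j)"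
        unfolding matrix_mul_assoc[symmetric]
        by (simp add: matrix_matrix_mult_def matrix_vector_mult_def inner_vec_def transpose_def)
      then show ?thesis unfolding E[OF r] frame_gram[OF c d] by (simp add: \<gamma>_def)
    qed
    have bi: "b i \<in> Basis" "i \<noteq> j \<Longrightarrow> b i \<noteq> b j" for i j
      using b unfolding bij_betw_def by (auto dest: injD)
    have "det ?A = (\<Prod>i\<in>UNIV. frame_form (fst (\<gamma>2 r)) (b i) (b i))"
      by (subst det_diagonal) (simp_all add: A bi frame_form_Basis)
    also have "\<dots> = (\<Prod>e\<in>Basis. frame_form (fst (\<gamma>2 r)) e e)" by (rule prod.reindex_bij_betw[OF b])
    also have "\<dots> = frame_det (fst (\<gamma>2 r))" by (rule frame_form_prod)
    finally show ?thesis by (simp add: det_mul power2_eq_square mult_ac)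
  qed

  define t where "t = ht m"
  \<comment> \<open>The derivative of \<open>frame_det\<close> at t times the speed 1 - t^2 of the
    height along \<gamma>.\<close>
  let ?D' = "lap_rhs t * 2 * frame_det t / (1 - t\<^sup>2) * (1 - t\<^sup>2)"
  have fd: "frame_det t > 0" unfolding t_def by (rule frame_det_pos[OF reg])
  define vu du where "vu = vol c u" and "du = det (E 0)"
  have vpos: "vu > 0" unfolding vu_def u_def by (rule vol_pos[OF c m])
  have vsq: "(vol c (crd c x))\<^sup>2 = det (gr c (crd c x))" if "x \<in> chart_dom c" for x
    using gram_det_pos[OF c that] by (simp add: vol_def)
  have prod0: "vu\<^sup>2 * du\<^sup>2 = frame_det t"
    using prod[of 0] vsq[OF m] W(2) by (simp add: \<gamma>0 \<gamma>2(2) t_def vu_def du_def u_def)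
  then have du: "du \<noteq> 0" using fd by auto
  have d1: "((\<lambda>r. det (E r)) has_real_derivative trace (matrix DX) * du) (at 0)"
    unfolding du_def using jacobi_formula[OF row] du du_def by blast
  have d2: "((\<lambda>r. vol c (crd c (\<gamma> r))) has_real_derivative Db (X u)) (at 0)"
    using frechet_curve[OF Ck_on_vol[OF c s(1)] Vo _ crd\<gamma>] s(2)
    by (simp add: \<gamma>0 u_def[symmetric] Db_def has_real_derivative_iff_has_vector_derivative)
  have "((\<lambda>r. (vol c (crd c (\<gamma> r)))\<^sup>2 * (det (E r))\<^sup>2) has_real_derivative
      (2 * vu * Db (X u)) * du\<^sup>2 + (2 * du * (trace (matrix DX) * du)) * vu\<^sup>2) (at 0)"
    using DERIV_mult[OF DERIV_power[OF d2, of 2] DERIV_power[OF d1, of 2]]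
    by (simp add: \<gamma>0 u_def[symmetric] vu_def du_def mult_ac)
  moreover have "((\<lambda>r. fst (\<gamma>2 r)) has_real_derivative (1 - t\<^sup>2)) (at 0)"
    using linear_velocity[OF bounded_linear_fst \<gamma>2(3)]
    by (simp add: has_real_derivative_iff_has_vector_derivative fst_grad14 t_def)
  then have "((\<lambda>r. frame_det (fst (\<gamma>2 r))) has_real_derivative ?D') (at 0)"
    by (rule DERIV_chain2[rotated]) (use frame_det_derivative[of t] reg in \<open>simp only: \<gamma>2(2) t_def\<close>)
  then have "((\<lambda>r. (vol c (crd c (\<gamma> r)))\<^sup>2 * (det (E r))\<^sup>2) has_real_derivative ?D') (at 0)"
    unfolding has_real_derivative_iff_has_vector_derivative
  proof (rule velocity_eventually)
    have e: "frame_det (fst (\<gamma>2 r)) = (vol c (crd c (\<gamma> r)))\<^sup>2 * (det (E r))\<^sup>2" if "\<gamma> r \<in> W" for r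
      using prod[OF that] vsq[of "\<gamma> r"] W(4) \<gamma>M that by simp
    show "\<forall>\<^sub>F r in at 0. frame_det (fst (\<gamma>2 r)) = (vol c (crd c (\<gamma> r)))\<^sup>2 * (det (E r))\<^sup>2"
      using evW by eventually_elim (rule e)
    show "frame_det (fst (\<gamma>2 0)) = (vol c (crd c (\<gamma> 0)))\<^sup>2 * (det (E 0))\<^sup>2"
      by (rule e) (simp add: \<gamma>0 W(2))
  qed
  ultimately have "(2 * vu * Db (X u)) * du\<^sup>2 + (2 * du * (trace (matrix DX) * du)) * vu\<^sup>2
    = ?D'"
    by (rule DERIV_unique)
  also have "\<dots> = 2 * frame_det t * lap_rhs t"
    using reg by (simp add: t_def)
  also have "(2 * vu * Db (X u)) * du\<^sup>2 + (2 * du * (trace (matrix DX) * du)) * vu\<^sup>2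
    = 2 * (vu\<^sup>2 * du\<^sup>2) * (Db (X u) / vu + trace (matrix DX))"
    using vpos by (simp add: power2_eq_square field_simps)
  finally have "2 * frame_det t * (Db (X u) / vu + trace (matrix DX)) = 2 * frame_det t * lap_rhs t"
    unfolding prod0 .
  then have total: "Db (X u) / vu + trace (matrix DX) = lap_rhs t" using fd by simp
  moreover have "lap c u = trace (matrix DX) + Db (X u) / vu"
  proof -
    have "Db (X u) = (\<Sum>i\<in>UNIV. X u $ i * Db (axis i 1))"
      using linear_rep_axis[OF linDb, of "X u"] by simp
    moreover have "trace (matrix DX) = (\<Sum>i\<in>UNIV. DX (axis i 1) $ i)" by (simp add: trace_def matrix_def)
    ultimately show ?thesis
      using lap_formula[OF c s] unfolding X_def[symmetric] DX_def[symmetric] Db_def[symmetric] vu_def by simp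
  qed
  ultimately have "lap c u = lap_rhs t" using total unfolding X_def[symmetric] by simp
  then show ?thesis unfolding u_def t_def .
qed

text \<open>At a pole the frame degenerates, \<open>frame_det\<close> being 0 there, so the value is
  obtained by continuity along a curve that is regular for small r > 0.\<close>

lemma lap_eq:
  assumes c: "c \<in> Charts" and m: "m \<in> chart_dom c"
  shows "lap c (crd c m) = lap_rhs (ht m)"
proof (cases "(ht m)\<^sup>2 < 1")
  case True
  then show ?thesis by (rule lap_regular[OF c m])
next
  case False
  note mM = dom_M14[OF m]
  define t where "t = ht m"
  have "t\<^sup>2 + (norm (hq m))\<^sup>2 = 1" using mM by (simp add: M14_iff S4_iff t_def)
  moreover have "t\<^sup>2 \<ge> 1" using False by (simp add: t_def)
  ultimately have "t\<^sup>2 = 1" "(norm (hq m))\<^sup>2 = 0" using zero_le_power2[of "norm (hq m)"] by linarith+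
  then have t: "t\<^sup>2 = 1" "hq m = 0" by simp_all
  \<comment> \<open>An arc of a great circle leaving the pole t = 1 or t = -1; its quaternion part
    sin r is nonzero for 0 < r < 1.\<close>
  define \<gamma> where "\<gamma> r = (fst m, (cos r * t, qreal (sin r)))" for r
  have \<gamma>M: "\<gamma> r \<in> M14" for r
    using mM t(1) by (simp add: \<gamma>_def M14_iff S4_iff power_mult_distrib)
  have \<gamma>0: "\<gamma> 0 = m" using t(2) by (simp add: \<gamma>_def t_def prod_eq_iff)
  have cont: "isCont \<gamma> 0" unfolding \<gamma>_def[abs_def] qreal_def by (intro continuous_intros)
  obtain V s where s: "lsection c V s" "crd c m \<in> V" by (rule local_section[OF c m]) blast
  note Vo = lsectionD(1)[OF s(1)]
  obtain W g where W: "open W" "m \<in> W" "\<And>k. Ck_on k g W" "\<And>x. x \<in> M14 \<inter> W \<Longrightarrow> x \<in> chart_dom c \<and> g x = crd c x"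
    by (rule chart_crd_extension[OF c m]) blast
  have gm: "g m = crd c m" using W(2,4) mM by blast
  have "isCont g m" using W(1,2) W(3)[of 0] by (simp add: continuous_on_eq_continuous_at)
  moreover have "isCont (lap c) (crd c m)"
    using continuous_on_lap[OF c s(1)] Vo s(2) by (simp add: continuous_on_eq_continuous_at)
  ultimately have "isCont (\<lambda>r. lap c (g (\<gamma> r))) 0"
    using isCont_o2[OF isCont_o2[OF cont, of g], of "lap c"] by (simp add: \<gamma>0 gm)
  then have lim: "((\<lambda>r. lap c (g (\<gamma> r))) \<longlongrightarrow> lap c (crd c m)) (at_right 0)"
    unfolding continuous_at by (simp add: \<gamma>0 gm filterlim_at_split)
  have ev: "\<forall>\<^sub>F r in at_right 0. lap c (g (\<gamma> r)) = lap_rhs (cos r * t)"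
  proof -
    have "\<forall>\<^sub>F r in at 0. \<gamma> r \<in> W"
      using cont W(1,2) \<gamma>0 unfolding continuous_at tendsto_def by blast
    then have "\<forall>\<^sub>F r in at_right 0. \<gamma> r \<in> W" by (simp add: eventually_at_split)
    moreover have "\<forall>\<^sub>F r in at_right 0. r \<in> {0<..<1::real}" by (rule eventually_at_right_real) simp
    ultimately show ?thesis
    proof eventually_elim
      case (elim r)
      have "sin r > 0" using elim(2) pi_gt3 by (intro sin_gt_zero) auto
      then have "0 < (sin r)\<^sup>2" by simp
      then have "(cos r)\<^sup>2 < 1" using sin_cos_squared_add[of r] by linarith
      then have "(cos r * t)\<^sup>2 < 1" using t(1) by (simp add: power_mult_distrib)
      moreover have d: "\<gamma> r \<in> chart_dom c" "g (\<gamma> r) = crd c (\<gamma> r)" using W(4) \<gamma>M elim(1) by auto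
      ultimately show ?case using lap_regular[OF c d(1)] by (simp add: d(2)) (simp add: \<gamma>_def)
    qed
  qed
  have "((\<lambda>r. lap_rhs (cos r * t)) \<longlongrightarrow> lap c (crd c m)) (at_right 0)"
    by (rule Lim_transform_eventually[OF lim ev])
  moreover have "((\<lambda>r. lap_rhs (cos r * t)) \<longlongrightarrow> lap_rhs (cos 0 * t)) (at_right 0)"
    unfolding lap_rhs_def using t(1) by (intro tendsto_intros) (auto simp: power_mult_distrib)
  ultimately have "lap c (crd c m) = lap_rhs (cos 0 * t)"
    using tendsto_unique[OF trivial_limit_at_right_real] by blast
  then show ?thesis by (simp add: t_def)
qed

lemma laplacian_eq:
  assumes m: "m \<in> M14" shows "laplacian N F (\<pi> m) = lap_rhs (ht m)"
proof -
  obtain c where c: "c \<in> Charts" "m \<in> chart_dom c" by (rule chart_at[OF m])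
  have eq: "lap c (snd c (\<pi> m)) = lap_rhs (ht m)" if "c \<in> Charts" "m \<in> chart_dom c" for c
    using lap_eq[OF that] by (simp add: crd_def)
  show ?thesis
    unfolding laplacian_def N_simps in_chart[OF m]
  proof (rule the_equality)
    show "\<forall>c\<in>Charts. m \<in> chart_dom c \<longrightarrow> lap c (snd c (\<pi> m)) = lap_rhs (ht m)"
      using eq by blast
    show "t = lap_rhs (ht m)" if "\<forall>c\<in>Charts. m \<in> chart_dom c \<longrightarrow> lap c (snd c (\<pi> m)) = t" for t
      using that eq[OF c] c by simp
  qed
qed

end


section \<open>Orbits and level sets\<close>

lemma Sp1_transitive:
  assumes "norm t = norm t'" obtains p where "p \<in> Sp1" "p *\<^sub>H t = t'"
proof (cases "t = 0")
  case True
  then show ?thesis using assms that[of "qreal 1"] by (simp add: Sp1_iff)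
next
  case False
  \<comment> \<open>The quotient of t' by t.\<close>
  define p where "p = inverse ((norm t)\<^sup>2) *\<^sub>R (t' *\<^sub>H qcnj t)"
  have "norm t' \<noteq> 0" using assms False by (metis norm_eq_zero)
  then have "norm p = 1" by (simp add: p_def norm_qmul power2_eq_square assms field_simps)
  moreover have "p *\<^sub>H t = t'"
    using False by (simp add: p_def qmul_scaleR qmul_assoc qcnj_qmul_self qreal_mul)
  ultimately show ?thesis using that by (simp add: Sp1_iff)
qed

text \<open>Fixing the sphere component leaves only the Sp(2) component free, on which left
  multiplication is transitive; this turns level sets into orbits.\<close>

lemma M14_move:
  assumes m: "m \<in> M14" and t: "t \<in> S4" "fst t = ht m"
  obtains Q where "Q \<in> Sp2" "\<pi> m = \<pi> (Q, t)"
proof -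
  have "(fst t)\<^sup>2 + (norm (hq m))\<^sup>2 = 1" "(fst t)\<^sup>2 + (norm (snd t))\<^sup>2 = 1"
    using m t(1) by (simp_all only: M14_iff S4_iff t(2))
  then have "(norm (hq m))\<^sup>2 = (norm (snd t))\<^sup>2" by linarith
  then have "norm (hq m) = norm (snd t)" by (rule power2_eq_imp_eq) simp_all
  then obtain p where p: "p \<in> Sp1" "p *\<^sub>H hq m = snd t" by (rule Sp1_transitive)
  have e: "s3_act p m = (fst (s3_act p m), t)" using p(2) t(2) by (simp add: s3_act_eq prod_eq_iff)
  show ?thesis
  proof (rule that)
    show "fst (s3_act p m) \<in> Sp2" using s3_act_M14[OF p(1) m] by (simp add: M14_iff)
    show "\<pi> m = \<pi> (fst (s3_act p m), t)"
      using proj_s3_act[OF m p(1)] e by metis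
  qed
qed

lemma Psi_proj: "P \<in> Sp2 \<Longrightarrow> m \<in> M14 \<Longrightarrow> Psi P (\<pi> m) = \<pi> (P **\<^sub>H fst m, snd m)"
  using Psi_pi1[of P "fst m" "snd m"] by (simp add: pi1_def)

section \<open>Isotropy groups and orbit dimensions\<close>

lemma isotropy_iff:
  assumes m: "m \<in> M14"
  shows "P \<in> isotropy (\<pi> m) \<longleftrightarrow> P \<in> Sp2 \<and>
    (\<exists>p\<in>Sp1. P **\<^sub>H fst m = fst m **\<^sub>H qdiag (qcnj p) (qreal 1) \<and> p *\<^sub>H hq m = hq m)"
proof -
  have "Psi P (\<pi> m) = \<pi> m \<longleftrightarrow>
    (\<exists>p\<in>Sp1. P **\<^sub>H fst m = fst m **\<^sub>H qdiag (qcnj p) (qreal 1) \<and> p *\<^sub>H hq m = hq m)"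
    if P: "P \<in> Sp2"
  proof -
    have "(P **\<^sub>H fst m, snd m) \<in> M14" using m P Sp2_mul by (simp add: M14_iff)
    from proj_eq_iff[OF m this]
    have "\<pi> m = \<pi> (P **\<^sub>H fst m, snd m) \<longleftrightarrow> (\<exists>p\<in>Sp1. (P **\<^sub>H fst m, snd m) = s3_act p m)" .
    moreover have "(P **\<^sub>H fst m, snd m) = s3_act p m \<longleftrightarrow>
        P **\<^sub>H fst m = fst m **\<^sub>H qdiag (qcnj p) (qreal 1) \<and> p *\<^sub>H hq m = hq m" for p
    proof -
      have "(A, t) = (B, (fst t, q)) \<longleftrightarrow> A = B \<and> q = snd t" for A B :: qmat and t :: "real \<times> quat" and q
        by (cases t) auto
      then show ?thesis unfolding s3_act_eq .
    qed
    ultimately show ?thesis unfolding Psi_proj[OF P m] by auto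
  qed
  then show ?thesis unfolding isotropy_def by auto
qed

lemma qid_isotropy: "m \<in> M14 \<Longrightarrow> qid \<in> isotropy (\<pi> m)"
  unfolding isotropy_iff by (auto intro!: bexI[of _ "qreal 1"] simp: Sp1_iff simp flip: qid_def)

text \<open>Off the poles t2 is invertible, so p t2 = t2 forces p = 1.\<close>

lemma isotropy_regular:
  assumes m: "m \<in> M14" and reg: "(ht m)\<^sup>2 \<noteq> 1"
  shows "isotropy (\<pi> m) = {qid}"
proof -
  have t2: "hq m \<noteq> 0" using m reg by (auto simp: M14_iff S4_iff)
  have Q: "fst m \<in> Sp2" using m by (simp add: M14_iff)
  have "P = qid" if P: "P \<in> isotropy (\<pi> m)" for P
  proof -
    obtain p where p: "P **\<^sub>H fst m = fst m **\<^sub>H qdiag (qcnj p) (qreal 1)" "p *\<^sub>H hq m = hq m"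
      using P unfolding isotropy_iff[OF m] by blast
    have "(p *\<^sub>H hq m) *\<^sub>H qcnj (hq m) = hq m *\<^sub>H qcnj (hq m)" by (simp only: p(2))
    then have "(norm (hq m))\<^sup>2 *\<^sub>R p = (norm (hq m))\<^sup>2 *\<^sub>R qreal 1"
      by (simp add: qmul_assoc qmul_qcnj qreal_mul scaleR_qreal)
    then have "p = qreal 1" using t2 by simp
    then have "P **\<^sub>H fst m = fst m" using p(1) by (simp flip: qid_def)
    then have "(P **\<^sub>H fst m) **\<^sub>H qadj (fst m) = qid" using Sp2_right[OF Q] by simp
    then show ?thesis by (simp add: qmat_mul_assoc Sp2_right[OF Q])
  qed
  then show ?thesis using qid_isotropy[OF m] by blast
qed

text \<open>At a pole t2 = 0 puts no condition on p, so the isotropy group contains a conjugate of a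
  whole copy of Sp(1).\<close>

lemma isotropy_singular:
  assumes m: "m \<in> M14" and sing: "(ht m)\<^sup>2 = 1" and p: "p \<in> Sp1"
  shows "fst m **\<^sub>H qdiag (qcnj p) (qreal 1) **\<^sub>H qadj (fst m) \<in> isotropy (\<pi> m)"
proof -
  have Q: "fst m \<in> Sp2" using m by (simp add: M14_iff)
  have "(norm (hq m))\<^sup>2 = 0" using m sing by (simp add: M14_iff S4_iff)
  then have "hq m = 0" by simp
  moreover have "fst m **\<^sub>H qdiag (qcnj p) (qreal 1) **\<^sub>H qadj (fst m) \<in> Sp2"
    by (intro Sp2_mul Q Sp2_qdiag p Sp2_qadj)
  ultimately show ?thesis
    unfolding isotropy_iff[OF m]
    by (intro conjI bexI[OF _ p]) (simp_all add: qmat_mul_assoc Sp2_left[OF Q])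
qed

lemma tangent_space_mono: assumes "A \<subseteq> B" shows "tangent_space A a \<subseteq> tangent_space B a"
proof
  fix v assume "v \<in> tangent_space A a"
  then obtain \<gamma> where "\<And>s. \<gamma> s \<in> A" "\<gamma> 0 = a" "velocity \<gamma> v"
    by (rule tangent_spaceE) blast
  then show "v \<in> tangent_space B a" using assms by (intro tangent_spaceI[of \<gamma>]) auto
qed

lemma tangent_space_singleton: "tangent_space {a} a \<subseteq> {0}"
proof
  fix v assume "v \<in> tangent_space {a} a"
  then obtain \<gamma> where \<gamma>: "\<And>s. \<gamma> s \<in> {a}" "velocity \<gamma> v"
    by (rule tangent_spaceE) blast
  have "\<gamma> = (\<lambda>s. a)" by (rule ext) (use \<gamma>(1) in blast)
  then have "velocity (\<lambda>s. a) v" using \<gamma>(2) by simp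
  then have "v = 0" using velocity_const by (rule vector_derivative_unique_at)
  then show "v \<in> {0}" by simp
qed

text \<open>A single nonzero velocity is enough, because singular orbits are defined by a strict
  inequality of dimensions. It comes from conjugating a curve in Sp(1).\<close>

lemma tangent_isotropy_singular:
  assumes m: "m \<in> M14" and sing: "(ht m)\<^sup>2 = 1"
  shows "\<not> tangent_space (isotropy (\<pi> m)) qid \<subseteq> {0}"
proof
  assume *: "tangent_space (isotropy (\<pi> m)) qid \<subseteq> {0}"
  have Q: "fst m \<in> Sp2" using m by (simp add: M14_iff)
  define v :: "real^3" where "v = axis 1 1"
  define \<gamma> where "\<gamma> s = fst m **\<^sub>H qdiag (qcnj (imcurve v s)) (qreal 1) **\<^sub>H qadj (fst m)" for s
  define V where "V = fst m **\<^sub>H qdiag (qcnj (0, v)) 0 **\<^sub>H qadj (fst m)"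
  have "V \<in> tangent_space (isotropy (\<pi> m)) qid"
  proof (rule tangent_spaceI)
    show "\<gamma> s \<in> isotropy (\<pi> m)" for s
      unfolding \<gamma>_def by (rule isotropy_singular[OF m sing imcurve(1)])
    show "\<gamma> 0 = qid" using Sp2_right[OF Q] by (simp add: \<gamma>_def imcurve flip: qid_def)
    show "velocity \<gamma> V"
      unfolding \<gamma>_def[abs_def] V_def
      using qmat_mul_velocity[OF
        qmat_mul_velocity[OF velocity_const[of "fst m"]
          qdiag_curve(1)[OF linear_velocity[OF bounded_linear_qcnj imcurve(3)[of v]], where c = "qreal 1"]]
        velocity_const[of "qadj (fst m)"]]
      by simp
  qed
  then have "V = 0" using * by blast
  moreover have "qadj (fst m) **\<^sub>H V **\<^sub>H fst m = qdiag (qcnj (0, v)) 0"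
    by (simp add: V_def qmat_mul_assoc Q Sp2_left[OF Q])
  ultimately have "qdiag (qcnj (0, v)) 0 = 0" by simp
  then have "qcnj (0, v) = 0" by (simp add: qm_eq_iff)
  then show False by (simp add: v_def qcnj_def zero_prod_def axis_eq_0_iff)
qed

lemma orbit_dim_regular:
  assumes "m \<in> M14" "(ht m)\<^sup>2 \<noteq> 1"
  shows "orbit_dim (\<pi> m) = dim (tangent_space Sp2 qid)"
proof -
  have "dim (tangent_space {qid} qid) = 0" unfolding dim_eq_0 by (rule tangent_space_singleton)
  then show ?thesis by (simp only: orbit_dim_def isotropy_regular[OF assms] diff_zero)
qed

lemma orbit_dim_singular:
  assumes "m \<in> M14" "(ht m)\<^sup>2 = 1"
  shows "orbit_dim (\<pi> m) < dim (tangent_space Sp2 qid)"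
proof -
  note n = tangent_isotropy_singular[OF assms]
  have "isotropy (\<pi> m) \<subseteq> Sp2" by (auto simp: isotropy_def)
  then have "\<not> tangent_space Sp2 qid \<subseteq> {0}" using n tangent_space_mono by blast
  \<comment> \<open>Both dimensions must be positive, as subtraction of natural numbers truncates at
    0.\<close>
  then have "dim (tangent_space Sp2 qid) > 0" "dim (tangent_space (isotropy (\<pi> m)) qid) > 0"
    using n by (simp_all add: dim_eq_0 del: dim_eq_0 flip: neq0_conv) (simp_all add: dim_eq_0)
  then show ?thesis by (simp add: orbit_dim_def)
qed

section \<open>Level sets as orbits\<close>

context berger_function
begin

lemma proj_points: "m \<in> M14 \<Longrightarrow> \<pi> m \<in> M14 // s3_rel"
  unfolding proj_def by (rule quotientI)

lemma level_set_eq: "level_set N F s = {\<pi> m |m. m \<in> M14 \<and> ht m = s}" (is "_ = ?R")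
proof (intro equalityI subsetI)
  fix p assume "p \<in> level_set N F s"
  then have p: "p \<in> points N" "F p = s" by (simp_all add: level_set_def)
  obtain m where m: "m \<in> M14" "p = \<pi> m" by (rule points_E[OF p(1)])
  then have "ht m = s" using F_proj[OF m(1)] p(2) by simp
  then show "p \<in> ?R" using m by blast
next
  fix p assume "p \<in> ?R"
  then obtain m where m: "m \<in> M14" "p = \<pi> m" "ht m = s" by blast
  then show "p \<in> level_set N F s"
    using F_proj[OF m(1)] proj_points[OF m(1)] by (simp add: level_set_def N_simps)
qed

lemma orbit_eq_level_set:
  assumes m: "m \<in> M14" shows "orbit (\<pi> m) = level_set N F (ht m)"
proof (intro equalityI subsetI)
  have Q: "fst m \<in> Sp2" and t: "snd m \<in> S4" using m by (auto simp: M14_iff)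
  fix p assume "p \<in> orbit (\<pi> m)"
  then obtain P where P: "P \<in> Sp2" "p = Psi P (\<pi> m)" unfolding orbit_def by blast
  have "(P **\<^sub>H fst m, snd m) \<in> M14" using Sp2_mul[OF P(1) Q] t by (simp add: M14_iff)
  moreover have "p = \<pi> (P **\<^sub>H fst m, snd m)" using Psi_proj[OF P(1) m] P(2) by simp
  ultimately show "p \<in> level_set N F (ht m)" unfolding level_set_eq mem_Collect_eq by (metis snd_conv)
next
  have Q: "fst m \<in> Sp2" and t: "snd m \<in> S4" using m by (auto simp: M14_iff)
  fix p assume "p \<in> level_set N F (ht m)"
  then obtain m' where m': "m' \<in> M14" "ht m' = ht m" "p = \<pi> m'" unfolding level_set_eq by blast
  obtain Q' where Q': "Q' \<in> Sp2" "p = \<pi> (Q', snd m)"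
    using M14_move[OF m'(1) t m'(2)[symmetric]] m'(3) by metis
  have "p = Psi (Q' **\<^sub>H qadj (fst m)) (\<pi> m)"
    using Psi_proj[OF Sp2_mul[OF Q'(1) Sp2_qadj[OF Q]] m] Q'(2) by (simp add: qmat_mul_assoc Sp2_left[OF Q])
  then show "p \<in> orbit (\<pi> m)" unfolding orbit_def using Sp2_mul[OF Q'(1) Sp2_qadj[OF Q]] by blast
qed

lemma level_set_self: "m \<in> M14 \<Longrightarrow> \<pi> m \<in> level_set N F (ht m)"
  unfolding level_set_eq by blast

lemma level_sets_eq: "level_sets N F = {level_set N F (ht m) |m. m \<in> M14}"
  unfolding level_sets_def
proof (intro equalityI subsetI)
  fix L assume "L \<in> {level_set N F s |s. level_set N F s \<noteq> {}}"
  then obtain s p where L: "L = level_set N F s" "p \<in> level_set N F s" by blast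
  then obtain m where "m \<in> M14" "ht m = s" unfolding level_set_eq by blast
  then show "L \<in> {level_set N F (ht m) |m. m \<in> M14}" using L(1) by blast
qed (use level_set_self in blast)

lemma points_eq: "points N = {\<pi> m |m. m \<in> M14}"
  using points_E proj_points unfolding N_simps(1) by blast

lemma level_sets_orbits: "level_sets N F = {orbit p |p. p \<in> points N}"
  unfolding level_sets_eq points_eq using orbit_eq_level_set by blast

lemma critical_level_set:
  assumes m: "m \<in> M14" "p \<in> level_set N F (ht m)"
  shows "critical_point N F p \<longleftrightarrow> (ht m)\<^sup>2 = 1"
proof -
  obtain m' where "m' \<in> M14" "ht m' = ht m" "p = \<pi> m'"
    using m(2) unfolding level_set_eq by blast
  then show ?thesis using critical_iff by simp
qed

lemma regular_level_sets_eq: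
  "regular_level_sets N F = {level_set N F (ht m) |m. m \<in> M14 \<and> (ht m)\<^sup>2 \<noteq> 1}"
  unfolding regular_level_sets_def level_sets_eq using critical_level_set level_set_self by blast

lemma singular_level_sets_eq:
  "singular_level_sets N F = {level_set N F (ht m) |m. m \<in> M14 \<and> (ht m)\<^sup>2 = 1}"
  unfolding singular_level_sets_def level_sets_eq using critical_level_set level_set_self by blast

lemma Sp2_theta_eq:
  assumes "\<theta> \<in> {0<..<pi}" shows "level_set N F (cos \<theta>) = Sp2_theta \<theta>"
proof -
  let ?t = "(cos \<theta>, qreal (sin \<theta>))"
  have t: "?t \<in> S4" by (simp add: S4_iff)
  have M: "Q \<in> Sp2 \<Longrightarrow> (Q, ?t) \<in> M14" for Q using t by (simp add: M14_iff)
  show ?thesis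
  proof (intro equalityI subsetI)
    fix p assume "p \<in> level_set N F (cos \<theta>)"
    then obtain m where m: "m \<in> M14" "ht m = cos \<theta>" "p = \<pi> m" unfolding level_set_eq by blast
    obtain Q where "Q \<in> Sp2" "\<pi> m = \<pi> (Q, ?t)"
      by (rule M14_move[OF m(1) t]) (simp_all add: m(2))
    then show "p \<in> Sp2_theta \<theta>" unfolding Sp2_theta_def pi1_def m(3) by blast
  next
    fix p assume "p \<in> Sp2_theta \<theta>"
    then obtain Q where "Q \<in> Sp2" "p = \<pi> (Q, ?t)" unfolding Sp2_theta_def pi1_def by blast
    then show "p \<in> level_set N F (cos \<theta>)" using level_set_self[OF M] by simp
  qed
qed

lemma regular_Sp2_theta: "regular_level_sets N F = {Sp2_theta \<theta> |\<theta>. \<theta> \<in> {0<..<pi}}" (is "_ = ?R")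
  unfolding regular_level_sets_eq
proof (intro equalityI subsetI)
  fix L assume "L \<in> {level_set N F (ht m) |m. m \<in> M14 \<and> (ht m)\<^sup>2 \<noteq> 1}"
  then obtain m where m: "m \<in> M14" "(ht m)\<^sup>2 \<noteq> 1" "L = level_set N F (ht m)" by blast
  let ?s = "ht m"
  have "?s\<^sup>2 + (norm (hq m))\<^sup>2 = 1" using m(1) by (simp add: M14_iff S4_iff)
  then have "?s\<^sup>2 < 1" using m(2) zero_le_power2[of "norm (hq m)"] by linarith
  then have "\<bar>?s\<bar> < 1" by (simp add: abs_square_less_1)
  then have "0 < arccos ?s" "arccos ?s < pi" "cos (arccos ?s) = ?s"
    using arccos_lt_bounded[of ?s] by (auto simp: abs_less_iff)
  then show "L \<in> ?R"
    unfolding m(3) using Sp2_theta_eq[of "arccos ?s"] by auto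
next
  fix L assume "L \<in> ?R"
  then obtain \<theta> where \<theta>: "\<theta> \<in> {0<..<pi}" "L = level_set N F (cos \<theta>)" using Sp2_theta_eq by blast
  let ?m = "(qid, (cos \<theta>, qreal (sin \<theta>)))"
  have "?m \<in> M14" by (simp add: M14_iff S4_iff)
  moreover have "sin \<theta> > 0" using \<theta>(1) by (simp add: sin_gt_zero)
  then have "(sin \<theta>)\<^sup>2 > 0" by simp
  then have "(cos \<theta>)\<^sup>2 \<noteq> 1" using sin_cos_squared_add[of \<theta>] by linarith
  ultimately show "L \<in> {level_set N F (ht m) |m. m \<in> M14 \<and> (ht m)\<^sup>2 \<noteq> 1}"
    unfolding \<theta>(2) mem_Collect_eq by (intro exI[of _ ?m]) simp
qed

text \<open>At an equatorial point the isotropy group is trivial, whereas at a pole it contains a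
  conjugate of diag(-1, 1), which no conjugation makes trivial. Conversely the trivial group lies in
  every isotropy group.\<close>

lemma principal_iff:
  assumes m: "m \<in> M14"
  shows "(\<forall>q\<in>M14 // s3_rel. \<exists>P\<in>Sp2. (\<lambda>S. P **\<^sub>H S **\<^sub>H qadj P) ` isotropy (\<pi> m) \<subseteq> isotropy q)
    \<longleftrightarrow> (ht m)\<^sup>2 \<noteq> 1" (is "?P \<longleftrightarrow> _")
proof
  assume P: ?P
  show "(ht m)\<^sup>2 \<noteq> 1"
  proof
    assume sing: "(ht m)\<^sup>2 = 1"
    have Q: "fst m \<in> Sp2" using m by (simp add: M14_iff)
    let ?m = "(qid, (0::real, qreal 1))"
    have mM: "?m \<in> M14" by (simp add: M14_iff S4_iff)
    obtain P where P: "P \<in> Sp2" "(\<lambda>S. P **\<^sub>H S **\<^sub>H qadj P) ` isotropy (\<pi> m) \<subseteq> isotropy (\<pi> ?m)"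
      using P proj_points[OF mM] by blast
    let ?D = "qdiag (qcnj (qreal (- 1))) (qreal 1)"
    have "qreal (- 1) \<in> Sp1" by (simp add: Sp1_iff)
    from isotropy_singular[OF m sing this] P(2) isotropy_regular[OF mM]
    have e: "P **\<^sub>H (fst m **\<^sub>H ?D **\<^sub>H qadj (fst m)) **\<^sub>H qadj P = qid" by auto
    have "?D = qadj (fst m) **\<^sub>H (qadj P **\<^sub>H (P **\<^sub>H (fst m **\<^sub>H ?D **\<^sub>H qadj (fst m)) **\<^sub>H qadj P) **\<^sub>H P) **\<^sub>H fst m"
      using P(1) Q by (simp add: qmat_mul_assoc Sp2_left)
    also have "\<dots> = qid" unfolding e using P(1) Q by (simp add: Sp2_left)
    finally have "qreal (- 1) = qreal 1" by (simp add: qm_eq_iff)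
    then show False by simp
  qed
next
  assume reg: "(ht m)\<^sup>2 \<noteq> 1"
  show ?P
  proof
    fix q assume "q \<in> M14 // s3_rel"
    then obtain m' where "m' \<in> M14" "q = \<pi> m'" unfolding proj_def by (rule quotientE)
    then show "\<exists>P\<in>Sp2. (\<lambda>S. P **\<^sub>H S **\<^sub>H qadj P) ` isotropy (\<pi> m) \<subseteq> isotropy q"
      using qid_isotropy[of m'] Sp2_right[OF qid_Sp2] by (intro bexI[of _ qid]) (simp_all add: isotropy_regular[OF m reg])
  qed
qed

lemma principal_orbits_eq: "principal_orbits = {orbit (\<pi> m) |m. m \<in> M14 \<and> (ht m)\<^sup>2 \<noteq> 1}" (is "_ = ?R")
proof (intro equalityI subsetI)
  fix L assume "L \<in> principal_orbits"
  then obtain p where p: "L = orbit p" "p \<in> M14 // s3_rel"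
    "\<forall>q\<in>M14 // s3_rel. \<exists>P\<in>Sp2. (\<lambda>S. P **\<^sub>H S **\<^sub>H qadj P) ` isotropy p \<subseteq> isotropy q"
    unfolding principal_orbits_def by blast
  obtain m where m: "m \<in> M14" "p = \<pi> m" using points_E[unfolded N_simps, OF p(2)] .
  then show "L \<in> ?R"
    using principal_iff[OF m(1)] p(1,3) by blast
next
  fix L assume "L \<in> ?R"
  then obtain m where m: "m \<in> M14" "(ht m)\<^sup>2 \<noteq> 1" "L = orbit (\<pi> m)" by blast
  then show "L \<in> principal_orbits"
    unfolding principal_orbits_def using principal_iff[OF m(1)] proj_points[OF m(1)] by blast
qed

text \<open>Orbits off the poles already have the dimension of Sp(2), which no orbit exceeds, so
  only the poles can give a smaller one.\<close>

lemma singular_orbits_eq: "singular_orbits = {orbit (\<pi> m) |m. m \<in> M14 \<and> (ht m)\<^sup>2 = 1}" (is "_ = ?R")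
proof (intro equalityI subsetI)
  fix L assume "L \<in> singular_orbits"
  then obtain p q where L: "L = orbit p" "p \<in> M14 // s3_rel" "q \<in> M14 // s3_rel"
    "orbit q \<in> principal_orbits" "orbit_dim p < orbit_dim q"
    unfolding singular_orbits_def by blast
  obtain m where m: "m \<in> M14" "p = \<pi> m" using points_E[unfolded N_simps, OF L(2)] .
  have "(ht m)\<^sup>2 = 1"
  proof (rule ccontr)
    assume "(ht m)\<^sup>2 \<noteq> 1"
    then have "orbit_dim p = dim (tangent_space Sp2 qid)" using orbit_dim_regular m by blast
    moreover have "orbit_dim q \<le> dim (tangent_space Sp2 qid)" by (simp add: orbit_dim_def)
    ultimately show False using L(5) by simp
  qed
  then show "L \<in> ?R" using m L(1) by blast
next
  fix L assume "L \<in> ?R"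
  then obtain m where m: "m \<in> M14" "(ht m)\<^sup>2 = 1" "L = orbit (\<pi> m)" by blast
  let ?m = "(qid, (0::real, qreal 1))"
  have mM: "?m \<in> M14" by (simp add: M14_iff S4_iff)
  have r: "(fst (snd ?m))\<^sup>2 \<noteq> 1" by simp
  have "orbit_dim (\<pi> m) < orbit_dim (\<pi> ?m)"
    using orbit_dim_singular[OF m(1,2)] orbit_dim_regular[OF mM r] by simp
  moreover have "orbit (\<pi> ?m) \<in> principal_orbits" unfolding principal_orbits_eq using mM r by blast
  ultimately show "L \<in> singular_orbits"
    unfolding singular_orbits_def m(3) using proj_points[OF mM] proj_points[OF m(1)] by blast
qed

lemma F_sq_le_1:
  assumes "m \<in> M14" shows "(ht m)\<^sup>2 \<le> 1"
proof -
  have "(ht m)\<^sup>2 + (norm (hq m))\<^sup>2 = 1" using assms by (simp add: M14_iff S4_iff)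
  then show ?thesis using zero_le_power2[of "norm (hq m)"] by linarith
qed

lemma isoparametric_F: "isoparametric N F"
  unfolding isoparametric_def transnormal_def
proof (intro conjI exI ballI)
  show "smooth_fun N F" by (rule smooth_F)
  show "smooth_on UNIV (\<lambda>s::real. 1 - s\<^sup>2)"
    unfolding power2_eq_square by (intro smooth_on_openI Ck_on_intros open_UNIV)
  fix p assume "p \<in> points N"
  then obtain m where "m \<in> M14" "p = \<pi> m" by (rule points_E)
  then show "grad_norm_sq N F p = 1 - (F p)\<^sup>2" by (simp add: grad_norm_sq_eq F_proj)
next
  \<comment> \<open>The denominator of the stated formula vanishes at s^2 = 1 + r1 / 2, but
    continuity is required on the whole line. Truncating 1 - s^2 at 0 removes this zero and changes
    nothing on the range of F.\<close>
  have "1 + 2 / r1 * max 0 (1 - s\<^sup>2) \<noteq> 0" for s :: real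
    using r1_pos by (simp add: add_pos_nonneg order_less_imp_not_eq2)
  then show "continuous_on UNIV (\<lambda>s. - (1 + 3 / (1 + 2 / r1 * max 0 (1 - s\<^sup>2))) * s)"
    by (intro continuous_intros) blast
  fix p assume "p \<in> points N"
  then obtain m where m: "m \<in> M14" "p = \<pi> m" by (rule points_E)
  have "max 0 (1 - (ht m)\<^sup>2) = 1 - (ht m)\<^sup>2" using F_sq_le_1[OF m(1)] by simp
  then show "laplacian N F p = - (1 + 3 / (1 + 2 / r1 * max 0 (1 - (F p)\<^sup>2))) * F p"
    using m by (simp only: laplacian_eq F_proj lap_rhs_def)
qed

end

theorem proposition1p4:
  fixes r1 r2 :: real and F :: "m14 set \<Rightarrow> real"
  assumes "r1 > 0" and "r2 > 0" and "r1 + r2 \<le> 2"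
    and "\<forall>m\<in>M14. F (pi1 m) = f14 m"
  shows "isoparametric (N11 r1 r2) F
    \<and> (\<forall>p\<in>points (N11 r1 r2). grad_norm_sq (N11 r1 r2) F p = 1 - (F p)\<^sup>2)
    \<and> (\<forall>p\<in>points (N11 r1 r2). laplacian (N11 r1 r2) F p
          = - (1 + 3 / (1 + 2 / r1 * (1 - (F p)\<^sup>2))) * F p)
    \<and> level_sets (N11 r1 r2) F = {orbit p |p. p \<in> points (N11 r1 r2)}
    \<and> (\<forall>\<theta>\<in>{0<..<pi}. level_set (N11 r1 r2) F (cos \<theta>) = Sp2_theta \<theta>)
    \<and> regular_level_sets (N11 r1 r2) F = {Sp2_theta \<theta> |\<theta>. \<theta> \<in> {0<..<pi}}
    \<and> regular_level_sets (N11 r1 r2) F = principal_orbits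
    \<and> singular_level_sets (N11 r1 r2) F = singular_orbits"
proof -
  interpret berger_function r1 r2 F
    using assms by unfold_locales
  have "grad_norm_sq N F p = 1 - (F p)\<^sup>2" "laplacian N F p = - (1 + 3 / (1 + 2 / r1 * (1 - (F p)\<^sup>2))) * F p"
    if p: "p \<in> points N" for p
  proof -
    obtain m where "m \<in> M14" "p = \<pi> m" by (rule points_E[OF p])
    then show "grad_norm_sq N F p = 1 - (F p)\<^sup>2" "laplacian N F p = - (1 + 3 / (1 + 2 / r1 * (1 - (F p)\<^sup>2))) * F p"
      by (simp_all only: grad_norm_sq_eq laplacian_eq F_proj lap_rhs_def)
  qed
  moreover have "regular_level_sets N F = principal_orbits" "singular_level_sets N F = singular_orbits"
    unfolding regular_level_sets_eq principal_orbits_eq singular_level_sets_eq singular_orbits_eq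
    using orbit_eq_level_set by blast+
  ultimately show ?thesis
    using isoparametric_F level_sets_orbits Sp2_theta_eq regular_Sp2_theta by blast
qed

end
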